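(* Let $k$ be an algebraically closed field with $\operatorname{char}k=0$ or $\operatorname{char}k\ge14$, let $W$ be the Albert algebra over $k$, and let $G$ be the simply connected group of type $E_6$ stabilising its determinant. Realise the irreducible $G$-representation $V$ of highest weight $\omega_1+\omega_6$ as the space $\sigma(V)$ of trace-zero elements of $\operatorname{span}_k\{a_1a_2a_3\mid a_i\in W\}\subset\operatorname{End}(W)$. Then the space of commutative $G$-equivariant products on $V$ is spanned by $\odot_1$ and $\odot_2$, restricted to $\sigma(V)$.
   Context: **Albert algebra.** $\mathbb O$ is the split octonion algebra over $k$: an $8$-dimensional unital algebra with unit $e$ and nondegenerate isotropic multiplicative quadratic form $N$; $\langle x,y\rangle=N(x+y)-N(x)-N(y)$, $\overline x=\langle x,e\rangle e-x$. $W=\mathcal H_3(\mathbb O)$ is the $27$-dimensional space of hermitian matrices $x=\begin{pmatrix}\alpha_1&c&\bar b\\ \bar c&\alpha_2&a\\ b&\bar a&\alpha_3\end{pmatrix}$ with Jordan product $x\cdot y=\tfrac12(xy+yx)$, trace form $\langle x,y\rangle=\operatorname{Tr}(x\cdot y)$, determinant $\det(x)=\alpha_1\alpha_2\alpha_3-\alpha_1N(a)-\alpha_2N(b)-\alpha_3N(c)+\langle(ab)c,e\rangle$, and symmetric trilinear form $\langle x,y,z\rangle$ with $\langle x,x,x\rangle=\det(x)$. The cross product is defined by $3\langle x,y,z\rangle=\langle x\times y,z\rangle$ for all $z\in W$. $G\subset\mathrm{GL}(W)$ is the stabiliser of $\det$; it acts on $\operatorname{End}(W)$ by conjugation. **Operators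 and products.** For $x,y,z\in W$, $xyz\in\operatorname{End}(W)$ denotes $w\mapsto\langle w,x,y\rangle z+\langle w,y,z\rangle x+\langle w,z,x\rangle y$. The following are extended bilinearly to $\operatorname{span}_k\{a_1a_2a_3\mid a_i\in W\}$ (where they are well defined), and they restrict to products on $\sigma(V)$: - $f'(a_1a_2a_3,b_1b_2b_3)=\sum_{\tau,\rho\in\mathcal S_3}\langle a_{\tau(1)},b_{\rho(2)},b_{\rho(3)}\rangle\langle b_{\rho(1)},a_{\tau(2)},a_{\tau(3)}\rangle$. - $a_1a_2a_3\odot_1b_1b_2b_3=\sum_{\tau,\rho\in\mathcal S_3}\big((a_{\tau(1)}\times a_{\tau(2)})\times(b_{\rho(1)}\times b_{\rho(2)})\big)a_{\tau(3)}b_{\rho(3)}-\tfrac1{12}f'(a_1a_2a_3,b_1b_2b_3)\,\mathrm{id}_W$. - With $\mathrm{id}_W=\sum_m x_{m,1}x_{m,2}x_{m,3}$ a finite sum of such operators, $a_1a_2a_3\odot_2b_1b_2b_3=\sum_m\sum_{\sigma,\tau,\rho\in\mathcal S_3}\big((a_{\tau(1)}\times b_{\rho(1)})\times x_{m,\sigma(1)}\big)\big((a_{\tau(2)}\times a_{\tau(3)})\times(b_{\rho(2)}\times b_{\rho(3)})\big)\big(x_{m,\sigma(2)}\times x_{m,\sigma(3)}\big)-\tfrac54f'(a_1a_2a_3,b_1b_2b_3)\,\mathrm{id}_W$. In these formulas a juxtaposition of three elements of $W$ denotes the operator $xyz$. A commutative $G$-equivariant product on $V$ is a symmetric bilinear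 map $m\colon V\times V\to V$ with $m(gv,gw)=g\,m(v,w)$. *)

theory Defs
  imports
    "HOL-Analysis.Cartesian_Space"
    "HOL-Combinatorics.Permutations"
    "HOL-Computational_Algebra.Computational_Algebra"
    "HOL-Library.Function_Algebras"
begin

definition polar :: "('v::ab_group_add \<Rightarrow> 'k::ab_group_add) \<Rightarrow> 'v \<Rightarrow> 'v \<Rightarrow> 'k" where
  "polar q x y = q (x + y) - q x - q y"

definition fun_scale :: "('k \<Rightarrow> 'v \<Rightarrow> 'v) \<Rightarrow> 'k \<Rightarrow> ('a \<Rightarrow> 'v) \<Rightarrow> 'a \<Rightarrow> 'v" where
  "fun_scale s c f = (\<lambda>x. s c (f x))"

lemma vector_space_fun_scale:
  assumes "vector_space s"
  shows "vector_space (fun_scale s)"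
proof -
  interpret vector_space s by fact
  show ?thesis
    by unfold_locales
      (auto simp: fun_scale_def fun_eq_iff scale_right_distrib scale_left_distrib)
qed

text \<open>
  Products on a subspace \<open>S\<close> are encoded as total functions that vanish as soon as one argument
  lies outside \<open>S\<close>, so that they form a vector space under pointwise operations.
\<close>

definition supported_on :: "'a set \<Rightarrow> ('a \<Rightarrow> 'a \<Rightarrow> 'b::zero) \<Rightarrow> bool" where
  "supported_on S m \<longleftrightarrow> (\<forall>u v. u \<notin> S \<or> v \<notin> S \<longrightarrow> m u v = 0)"

definition restrict_product ::
    "'a set \<Rightarrow> ('a \<Rightarrow> 'a \<Rightarrow> 'b::zero) \<Rightarrow> 'a \<Rightarrow> 'a \<Rightarrow> 'b" where
  "restrict_product S m = (\<lambda>u v. if u \<in> S \<and> v \<in> S then m u v else 0)"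

text \<open>
  The tuple \<open>(\<alpha>\<^sub>1, \<alpha>\<^sub>2, \<alpha>\<^sub>3, a, b, c)\<close> stands for the hermitian matrix with diagonal
  \<open>\<alpha>\<^sub>1, \<alpha>\<^sub>2, \<alpha>\<^sub>3\<close> and entries \<open>a\<close>, \<open>b\<close>, \<open>c\<close> at the positions (2,3), (3,1), (1,2); see
  \<open>hmat\<close> below.
\<close>

type_synonym ('k, 'o) albert = "'k \<times> 'k \<times> 'k \<times> 'o \<times> 'o \<times> 'o"

type_synonym ('k, 'o) endo = "('k, 'o) albert \<Rightarrow> ('k, 'o) albert"

locale split_octonion_algebra = vector_space scale
  for scale :: "'k::field \<Rightarrow> 'o::ab_group_add \<Rightarrow> 'o"  (infixr "*s" 75) +
  fixes mult :: "'o \<Rightarrow> 'o \<Rightarrow> 'o"  (infixl "\<bullet>" 70)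
    and e :: 'o
    and N :: "'o \<Rightarrow> 'k"
  assumes dim_8: "dim UNIV = 8"
    and mult_linear_right: "Vector_Spaces.linear scale scale (\<lambda>y. x \<bullet> y)"
    and mult_linear_left: "Vector_Spaces.linear scale scale (\<lambda>x. x \<bullet> y)"
    and unit_left: "e \<bullet> x = x"
    and unit_right: "x \<bullet> e = x"
    and N_scale: "N (c *s x) = c\<^sup>2 * N x"
    and N_polar_linear: "Vector_Spaces.linear scale (*) (\<lambda>x. polar N x y)"
    and N_nondegenerate: "(\<And>y. polar N x y = 0) \<Longrightarrow> x = 0"
    and N_isotropic: "\<exists>x. x \<noteq> 0 \<and> N x = 0"
    and N_mult: "N (x \<bullet> y) = N x * N y"
begin

definition cnj :: "'o \<Rightarrow> 'o" where
  "cnj x = polar N x e *s e - x"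


subsection \<open>The Albert algebra\<close>

fun scaleW :: "'k \<Rightarrow> ('k, 'o) albert \<Rightarrow> ('k, 'o) albert" where
  "scaleW t (\<alpha>1, \<alpha>2, \<alpha>3, a, b, c) = (t * \<alpha>1, t * \<alpha>2, t * \<alpha>3, t *s a, t *s b, t *s c)"

sublocale W: vector_space scaleW
  by unfold_locales (auto simp: scale_right_distrib scale_left_distrib algebra_simps)

fun hmat :: "('k, 'o) albert \<Rightarrow> 'o^3^3" where
  "hmat (\<alpha>1, \<alpha>2, \<alpha>3, a, b, c) =
     vector [vector [\<alpha>1 *s e, c, cnj b],
             vector [cnj c, \<alpha>2 *s e, a],
             vector [b, cnj a, \<alpha>3 *s e]]"

definition mat_mult :: "'o^3^3 \<Rightarrow> 'o^3^3 \<Rightarrow> 'o^3^3" where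
  "mat_mult A B = (\<chi> i j. \<Sum>l\<in>UNIV. A $ i $ l \<bullet> B $ l $ j)"

definition jordan :: "('k, 'o) albert \<Rightarrow> ('k, 'o) albert \<Rightarrow> ('k, 'o) albert" where
  "jordan x y = (THE z. hmat z =
     (\<chi> i j. (1 / 2) *s (mat_mult (hmat x) (hmat y) + mat_mult (hmat y) (hmat x)) $ i $ j))"

fun Tr :: "('k, 'o) albert \<Rightarrow> 'k" where
  "Tr (\<alpha>1, \<alpha>2, \<alpha>3, a, b, c) = \<alpha>1 + \<alpha>2 + \<alpha>3"

definition trace_form :: "('k, 'o) albert \<Rightarrow> ('k, 'o) albert \<Rightarrow> 'k" where
  "trace_form x y = Tr (jordan x y)"

fun det :: "('k, 'o) albert \<Rightarrow> 'k" where
  "det (\<alpha>1, \<alpha>2, \<alpha>3, a, b, c) =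
     \<alpha>1 * \<alpha>2 * \<alpha>3 - \<alpha>1 * N a - \<alpha>2 * N b - \<alpha>3 * N c + polar N ((a \<bullet> b) \<bullet> c) e"

definition trilinear_form ::
    "('k, 'o) albert \<Rightarrow> ('k, 'o) albert \<Rightarrow> ('k, 'o) albert \<Rightarrow> 'k" where
  "trilinear_form = (THE t.
     (\<forall>x y z. t x y z = t y x z \<and> t x y z = t x z y) \<and>
     (\<forall>y z. Vector_Spaces.linear scaleW (*) (\<lambda>x. t x y z)) \<and>
     (\<forall>x. t x x x = det x))"

definition cross :: "('k, 'o) albert \<Rightarrow> ('k, 'o) albert \<Rightarrow> ('k, 'o) albert"
    (infixl "\<otimes>" 70) where
  "x \<otimes> y = (THE w. \<forall>z. 3 * trilinear_form x y z = trace_form w z)"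

definition G :: "('k, 'o) endo set" where
  "G = {g. Vector_Spaces.linear scaleW scaleW g \<and> bij g \<and> (\<forall>x. det (g x) = det x)}"


subsection \<open>Endomorphisms\<close>

abbreviation scaleE :: "'k \<Rightarrow> ('k, 'o) endo \<Rightarrow> ('k, 'o) endo" where
  "scaleE \<equiv> fun_scale scaleW"

sublocale E: vector_space scaleE
  by (rule vector_space_fun_scale) (rule W.vector_space_axioms)

definition conj_action :: "('k, 'o) endo \<Rightarrow> ('k, 'o) endo \<Rightarrow> ('k, 'o) endo" where
  "conj_action g u = g \<circ> u \<circ> inv g"

definition trace :: "('k, 'o) endo \<Rightarrow> 'k" where
  "trace u = (let B = (SOME B. W.independent B \<and> W.span B = UNIV)
              in \<Sum>b\<in>B. W.representation B (u b) b)"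

definition op3 ::
    "('k, 'o) albert \<Rightarrow> ('k, 'o) albert \<Rightarrow> ('k, 'o) albert \<Rightarrow> ('k, 'o) endo" where
  "op3 x y z = (\<lambda>w. scaleW (trilinear_form w x y) z + scaleW (trilinear_form w y z) x
                      + scaleW (trilinear_form w z x) y)"

definition opspan :: "('k, 'o) endo set" where
  "opspan = E.span {op3 x y z | x y z. True}"

definition \<sigma>V :: "('k, 'o) endo set" where
  "\<sigma>V = {u \<in> opspan. trace u = 0}"


subsection \<open>Products\<close>

definition bilinear_on ::
    "('k, 'o) endo set \<Rightarrow> (('k, 'o) endo \<Rightarrow> ('k, 'o) endo \<Rightarrow> ('k, 'o) endo) \<Rightarrow> bool" where
  "bilinear_on S m \<longleftrightarrow>
     (\<forall>u\<in>S. \<forall>v\<in>S. \<forall>w\<in>S. m (u + v) w = m u w + m v w \<and> m w (u + v) = m w u + m w v) \<and>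
     (\<forall>c. \<forall>u\<in>S. \<forall>v\<in>S. m (scaleE c u) v = scaleE c (m u v) \<and> m u (scaleE c v) = scaleE c (m u v))"

abbreviation scaleP ::
    "'k \<Rightarrow> (('k, 'o) endo \<Rightarrow> ('k, 'o) endo \<Rightarrow> ('k, 'o) endo) \<Rightarrow>
     ('k, 'o) endo \<Rightarrow> ('k, 'o) endo \<Rightarrow> ('k, 'o) endo" where
  "scaleP \<equiv> fun_scale (fun_scale scaleE)"

sublocale P: vector_space scaleP
  by (intro vector_space_fun_scale W.vector_space_axioms)

definition equivariant_products ::
    "(('k, 'o) endo \<Rightarrow> ('k, 'o) endo \<Rightarrow> ('k, 'o) endo) set" where
  "equivariant_products = {m. supported_on \<sigma>V m \<and> bilinear_on \<sigma>V m \<and>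
     (\<forall>u\<in>\<sigma>V. \<forall>v\<in>\<sigma>V. m u v \<in> \<sigma>V \<and> m u v = m v u) \<and>
     (\<forall>g\<in>G. \<forall>u\<in>\<sigma>V. \<forall>v\<in>\<sigma>V. m (conj_action g u) (conj_action g v) = conj_action g (m u v))}"

abbreviation op3v :: "('k, 'o) albert ^ 3 \<Rightarrow> ('k, 'o) endo" where
  "op3v a \<equiv> op3 (a $ 1) (a $ 2) (a $ 3)"

abbreviation S3 :: "(3 \<Rightarrow> 3) set" where
  "S3 \<equiv> {\<pi>. \<pi> permutes UNIV}"

definition bilinear_extension ::
    "(('k, 'o) albert ^ 3 \<Rightarrow> ('k, 'o) albert ^ 3 \<Rightarrow> ('k, 'o) endo) \<Rightarrow>
     ('k, 'o) endo \<Rightarrow> ('k, 'o) endo \<Rightarrow> ('k, 'o) endo" where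
  "bilinear_extension \<phi> = (THE m. supported_on opspan m \<and> bilinear_on opspan m \<and>
     (\<forall>a b. m (op3v a) (op3v b) = \<phi> a b))"

definition f' :: "('k, 'o) albert ^ 3 \<Rightarrow> ('k, 'o) albert ^ 3 \<Rightarrow> 'k" where
  "f' a b = (\<Sum>\<tau>\<in>S3. \<Sum>\<rho>\<in>S3.
     trilinear_form (a $ \<tau> 1) (b $ \<rho> 2) (b $ \<rho> 3) *
     trilinear_form (b $ \<rho> 1) (a $ \<tau> 2) (a $ \<tau> 3))"

definition odot1 :: "('k, 'o) endo \<Rightarrow> ('k, 'o) endo \<Rightarrow> ('k, 'o) endo" where
  "odot1 = bilinear_extension (\<lambda>a b.
     (\<Sum>\<tau>\<in>S3. \<Sum>\<rho>\<in>S3.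
        op3 ((a $ \<tau> 1 \<otimes> a $ \<tau> 2) \<otimes> (b $ \<rho> 1 \<otimes> b $ \<rho> 2)) (a $ \<tau> 3) (b $ \<rho> 3))
     - scaleE (1 / 12 * f' a b) id)"

text \<open>
  The list \<open>xs\<close> ranges over all decompositions of the identity as a finite sum of operators
  \<open>x\<^sub>1x\<^sub>2x\<^sub>3\<close>; \<open>THE\<close> is meaningful only if the value does not depend on the decomposition.
\<close>

definition odot2_gen ::
    "('k, 'o) albert ^ 3 \<Rightarrow> ('k, 'o) albert ^ 3 \<Rightarrow> ('k, 'o) endo" where
  "odot2_gen a b = (THE r. \<exists>xs. id = (\<Sum>x\<leftarrow>xs. op3v x) \<and>
     r = (\<Sum>x\<leftarrow>xs. \<Sum>\<sigma>\<in>S3. \<Sum>\<tau>\<in>S3. \<Sum>\<rho>\<in>S3.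
            op3 ((a $ \<tau> 1 \<otimes> b $ \<rho> 1) \<otimes> x $ \<sigma> 1)
                ((a $ \<tau> 2 \<otimes> a $ \<tau> 3) \<otimes> (b $ \<rho> 2 \<otimes> b $ \<rho> 3))
                (x $ \<sigma> 2 \<otimes> x $ \<sigma> 3))
         - scaleE (5 / 4 * f' a b) id)"

definition odot2 :: "('k, 'o) endo \<Rightarrow> ('k, 'o) endo \<Rightarrow> ('k, 'o) endo" where
  "odot2 = bilinear_extension odot2_gen"

end

end

theory Submission
  imports Defs
begin

text \<open>
  Let \<open>W = E1 \<oplus> E2 \<oplus> E3 \<oplus> a \<oplus> b \<oplus> c\<close> be the decomposition of the Albert algebra into diagonal and
  off-diagonal entries, and let \<open>v0 = E1 \<otimes> E3*\<close> and \<open>vl = E3 \<otimes> E1*\<close> be a highest and a lowest weight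
  vector of \<open>V\<close>.  As \<open>v0 \<otimes> vl\<close> generates \<open>V \<otimes> V\<close>, an equivariant product \<open>m\<close> is determined by
  \<open>m v0 vl\<close>.  This value commutes with the Levi subgroup (a torus and \<open>Spin8\<close>), hence acts by scalars
  on the six summands of \<open>W\<close>; for commutative \<open>m\<close> it is also invariant under the exchange of
  \<open>E1\<close> and \<open>E3\<close>.  Being orthogonal to the Lie algebra of \<open>G\<close> and to the identity, it lies in a space of
  dimension 2, which is spanned by the values of \<open>\<odot>\<^sub>1\<close> and \<open>\<odot>\<^sub>2\<close>.

  With respect to the trace form one has \<open>3 abc = (a \<times> b) \<otimes> c + (b \<times> c) \<otimes> a + (c \<times> a) \<otimes> b\<close> as rank
  one operators, so both products are contractions of the operators themselves.  This shows that they are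
  well defined.  They are equivariant because \<open>G\<close> and its contragredient act compatibly with \<open>\<times>\<close>, a
  consequence of \<open>(x \<times> x) \<times> (x \<times> x) = det(x) x\<close>.
\<close>

text \<open>The arguments of Lie theory are carried out with explicit elements of \<open>G\<close>.
  Derivatives of one-parameter unipotent groups become coefficients of polynomial curves that stay
  in a subspace, and an identity proved where \<open>det\<close> or some minors do not vanish
  extends to all \<open>x\<close> along the line \<open>x + t I\<close>, because \<open>k\<close> is
  infinite. The generation claim needs care: while \<open>v0\<close> is moved and \<open>vl\<close>
  is held fixed, only subspaces stable under the stabiliser of \<open>vl\<close> are at hand. Hence
  the generation lemma is proved for stability under the unipotents \<open>U12\<close>,
  \<open>U23\<close>, \<open>U13\<close> alone, which fix \<open>vl\<close>. The dimension 2 arises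
  from six scalars: the exchange of \<open>E1\<close> and \<open>E3\<close> identifies two pairs of
  them, orthogonality to one Cartan element gives a third relation, and trace zero a fourth. The
  multiples of \<open>f'\<close> subtracted in the two products are those that make the trace
  vanish; since the trace of a product is again an equivariant bilinear map, this too is checked at
  the single pair \<open>v0\<close>, \<open>vl\<close>.\<close>

no_notation fps_nth (infixl "$" 75)
no_notation inner (infix "\<bullet>" 70)
no_notation vector_scalar_mult (infixl "*s" 70)

section \<open>Infinite fields and polynomial curves in a subspace\<close>

lemma infinite_UNIV_alg_closed: "infinite (UNIV :: 'k::alg_closed_field set)"
proof
  assume fin: "finite (UNIV :: 'k set)"
  define p :: "'k poly" where "p = (\<Prod>a\<in>UNIV. [:-a, 1:])"
  have "degree p = card (UNIV :: 'k set)"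
    unfolding p_def by (subst degree_prod_eq_sum_degree) auto
  then have "degree p > 0"
    using fin by (simp add: card_gt_0_iff)
  then have "degree (p + 1) > 0"
    by (simp add: degree_add_eq_left)
  then obtain x where "poly (p + 1) x = 0"
    using alg_closed_imp_poly_has_root by blast
  moreover have "poly p x = 0"
    using fin by (auto simp: p_def poly_prod intro!: prod_zero)
  ultimately show False
    by simp
qed

lemma numeral_nonzero_of_CHAR:
  assumes "CHAR('k::field) = 0 \<or> CHAR('k) \<ge> 14"
  shows "(2::'k) \<noteq> 0" "(3::'k) \<noteq> 0"
proof -
  have "of_nat m \<noteq> (0::'k)" if "0 < m" "m < 14" for m
    using that assms by (auto simp: of_nat_eq_0_iff_char_dvd dest: dvd_imp_le)
  from this[of 2] this[of 3] show "(2::'k) \<noteq> 0" "(3::'k) \<noteq> 0"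
    by auto
qed

text \<open>Induction on the degree by division: \<open>(p t - p t0) / (t - t0)\<close> is a curve
  of lower degree whose values for \<open>t \<noteq> t0\<close> still lie in \<open>S\<close>.
  Allowing any infinite \<open>T\<close> leaves room to exclude the roots of a polynomial from the
  parameters.\<close>

lemma (in vector_space) poly_curve_coeffs_in_subspace:
  assumes S: "subspace S" and T: "infinite T"
    and c: "\<And>t. t \<in> T \<Longrightarrow> (\<Sum>i<n. scale (t ^ i) (c i)) \<in> S"
  shows "\<forall>i<n. c i \<in> S"
  using T c
proof (induction n arbitrary: T c)
  case 0
  then show ?case by simp
next
  case (Suc n)
  obtain t0 where t0: "t0 \<in> T"
    using infinite_imp_nonempty[OF Suc.prems(1)] by auto
  \<comment> \<open>The coefficients of the quotient of \<open>p t - p t0\<close> by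
    \<open>t - t0\<close>, as in synthetic division. With \<open>d n = 0\<close> the recursion also
    covers the top coefficient.\<close>
  define d where "d i = (\<Sum>j<n - i. scale (t0 ^ j) (c (Suc (i + j))))" for i
  have rec: "d i = c (Suc i) + scale t0 (d (Suc i))" if "i < n" for i
  proof -
    define k where "k = n - Suc i"
    then have k: "n - i = Suc k" "n - Suc i = k"
      using that by auto
    show ?thesis
      unfolding d_def k by (subst sum.lessThan_Suc_shift) (simp add: scale_sum_right)
  qed
  have dn: "d n = 0"
    by (simp add: d_def)
  define p where "p t = (\<Sum>i<Suc n. scale (t ^ i) (c i))" for t
  have p0: "p t0 = c 0 + scale t0 (d 0)"
    unfolding p_def d_def by (subst sum.lessThan_Suc_shift) (simp add: scale_sum_right)
  \<comment> \<open>Truncated at \<open>m\<close>, the product leaves the error term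
    \<open>t ^ m * t0 * d m\<close>, which disappears at \<open>m = n\<close>.\<close>
  have "scale (t - t0) (\<Sum>i<m. scale (t ^ i) (d i))
      = (\<Sum>i<Suc m. scale (t ^ i) (c i)) + scale (t ^ m) (scale t0 (d m)) - p t0" if "m \<le> n" for t m
    using that
  proof (induction m)
    case 0
    then show ?case by (simp add: p0)
  next
    case (Suc m)
    then have "d m = c (Suc m) + scale t0 (d (Suc m))"
      by (intro rec) simp
    then have "scale (t ^ Suc m) (d m)
        = scale (t ^ Suc m) (c (Suc m)) + scale (t ^ Suc m) (scale t0 (d (Suc m)))"
      by (simp add: scale_right_distrib)
    with Suc show ?case
      by (simp add: scale_right_distrib scale_left_diff_distrib algebra_simps)
  qed
  from this[of n] have fac: "scale (t - t0) (\<Sum>i<n. scale (t ^ i) (d i)) = p t - p t0" for t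
    by (simp add: dn p_def)
  have "(\<Sum>i<n. scale (t ^ i) (d i)) \<in> S" if t: "t \<in> T - {t0}" for t
  proof -
    have "p t - p t0 \<in> S"
      unfolding p_def using t t0 by (intro subspace_diff[OF S] Suc.prems(2)) auto
    then have "scale (inverse (t - t0)) (scale (t - t0) (\<Sum>i<n. scale (t ^ i) (d i))) \<in> S"
      unfolding fac by (rule subspace_scale[OF S])
    with t show ?thesis by simp
  qed
  then have dS: "\<forall>i<n. d i \<in> S"
    using Suc.prems(1) by (intro Suc.IH[of "T - {t0}"]) auto
  have dS': "d i \<in> S" if "i \<le> n" for i
    using dS dn subspace_0[OF S] that by (cases "i = n") auto
  have "c 0 = p t0 - scale t0 (d 0)"
    by (simp add: p0)
  moreover have "p t0 \<in> S"
    unfolding p_def using t0 by (rule Suc.prems(2))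
  ultimately have "c 0 \<in> S"
    using dS'[of 0] by (simp add: subspace_diff subspace_scale S)
  moreover have "c (Suc i) \<in> S" if "i < n" for i
  proof -
    have "c (Suc i) = d i - scale t0 (d (Suc i))"
      using rec[OF that] by simp
    then show ?thesis
      using dS'[of i] dS'[of "Suc i"] that by (simp add: subspace_diff subspace_scale S)
  qed
  ultimately show ?case
    by (metis less_Suc_eq_0_disj)
qed

context split_octonion_algebra
begin

section \<open>Identities of composition algebras\<close>

abbreviation ip :: "'o \<Rightarrow> 'o \<Rightarrow> 'k" where
  "ip x y \<equiv> polar N x y"

lemma mult_add_left [simp]: "(x + y) \<bullet> z = x \<bullet> z + y \<bullet> z"
  and mult_scale_left [simp]: "(t *s x) \<bullet> z = t *s (x \<bullet> z)"
  using mult_linear_left[of z] by (auto simp: Vector_Spaces.linear_iff)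

lemma mult_add_right [simp]: "z \<bullet> (x + y) = z \<bullet> x + z \<bullet> y"
  and mult_scale_right [simp]: "z \<bullet> (t *s x) = t *s (z \<bullet> x)"
  using mult_linear_right[of z] by (auto simp: Vector_Spaces.linear_iff)

lemma mult_zero_left [simp]: "0 \<bullet> x = 0"
  and mult_zero_right [simp]: "x \<bullet> 0 = 0"
  and mult_minus_left [simp]: "(- x) \<bullet> y = - (x \<bullet> y)"
  and mult_minus_right [simp]: "x \<bullet> (- y) = - (x \<bullet> y)"
  using mult_scale_left[of 0 0 x] mult_scale_right[of x 0 0]
    mult_scale_left[of "-1" x y] mult_scale_right[of x "-1" y] by simp_all

lemma mult_diff_left [simp]: "(x - y) \<bullet> z = x \<bullet> z - y \<bullet> z"
  and mult_diff_right [simp]: "z \<bullet> (x - y) = z \<bullet> x - z \<bullet> y"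
  using mult_add_left[of x "- y" z] mult_add_right[of z x "- y"] by simp_all

lemma ip_commute: "ip x y = ip y x"
  by (simp add: polar_def add.commute)

lemma ip_add_left [simp]: "ip (x + y) z = ip x z + ip y z"
  and ip_scale_left [simp]: "ip (t *s x) z = t * ip x z"
  using N_polar_linear[of z] by (auto simp: Vector_Spaces.linear_iff)

lemma ip_add_right [simp]: "ip z (x + y) = ip z x + ip z y"
  and ip_scale_right [simp]: "ip z (t *s x) = t * ip z x"
  by (simp_all add: ip_commute[of z])

lemma ip_zero_left [simp]: "ip 0 x = 0"
  and ip_zero_right [simp]: "ip x 0 = 0"
  and ip_minus_left [simp]: "ip (- x) y = - ip x y"
  and ip_minus_right [simp]: "ip x (- y) = - ip x y"
  using ip_scale_left[of 0 0 x] ip_scale_right[of x 0 0]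
    ip_scale_left[of "-1" x y] ip_scale_right[of x "-1" y] by simp_all

lemma ip_diff_left [simp]: "ip (x - y) z = ip x z - ip y z"
  and ip_diff_right [simp]: "ip z (x - y) = ip z x - ip z y"
  using ip_add_left[of x "- y" z] ip_add_right[of z x "- y"] by simp_all

lemma ip_sum_left: "ip (sum f A) z = (\<Sum>x\<in>A. ip (f x) z)"
  by (induction A rule: infinite_finite_induct) auto

lemma ip_sum_right: "ip z (sum f A) = (\<Sum>x\<in>A. ip z (f x))"
  by (induction A rule: infinite_finite_induct) auto

lemma ip_ext: "(\<And>z. ip x z = ip y z) \<Longrightarrow> x = y"
  using N_nondegenerate[of "x - y"] by simp

lemma N_add: "N (x + y) = N x + N y + ip x y"
  by (simp add: polar_def)

lemma N_zero [simp]: "N 0 = 0"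
  using N_scale[of 0 0] by simp

lemma N_minus [simp]: "N (- x) = N x"
  using N_scale[of "-1" x] by simp

lemma N_diff: "N (x - y) = N x + N y - ip x y"
  using N_add[of x "- y"] by simp

lemma ip_self: "ip x x = 2 * N x"
proof -
  have "x + x = 2 *s x"
    by (metis one_add_one scale_left_distrib scale_one)
  then have "N (x + x) = 4 * N x"
    by (simp add: N_scale)
  then show ?thesis
    by (simp add: polar_def)
qed

lemma e_nonzero: "e \<noteq> 0"
proof
  assume "e = 0"
  then have "x = 0" for x :: 'o
    using unit_left[of x] by simp
  then have "(UNIV :: 'o set) = {0}"
    by auto
  then show False
    using dim_8 dim_le_card[of UNIV "{}"] by (auto simp: span_empty)
qed

lemma N_e [simp]: "N e = 1"
proof -
  have "N e \<noteq> 0"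
  proof
    assume "N e = 0"
    then have "N x = 0" for x
      using N_mult[of e x] by (simp add: unit_left)
    then have "e = 0"
      by (intro N_nondegenerate) (simp add: polar_def)
    then show False
      using e_nonzero by simp
  qed
  moreover have "N e * N e = N e"
    using N_mult[of e e] by (simp add: unit_left)
  ultimately show ?thesis
    by simp
qed

lemma ip_mult_same_left: "ip (x \<bullet> y) (x \<bullet> z) = N x * ip y z"
  using N_mult[of x "y + z"] by (simp add: N_add N_mult algebra_simps)

lemma ip_mult_same_right: "ip (x \<bullet> z) (y \<bullet> z) = N z * ip x y"
  using N_mult[of "x + y" z] by (simp add: N_add N_mult algebra_simps)

text \<open>The full linearisation of \<open>N_mult\<close>. Putting \<open>e\<close> for one of the
  arguments turns it into the adjointness of multiplication by \<open>z\<close> and by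
  \<open>cnj z\<close>, on either side.\<close>

lemma ip_mult_exchange: "ip (x \<bullet> y) (z \<bullet> w) + ip (x \<bullet> w) (z \<bullet> y) = ip x z * ip y w"
  using ip_mult_same_left[of "x + z" y w]
  by (simp add: ip_mult_same_left N_add algebra_simps ip_commute[of "z \<bullet> y"])

lemma cnj_add [simp]: "cnj (x + y) = cnj x + cnj y"
  and cnj_scale [simp]: "cnj (t *s x) = t *s cnj x"
  and cnj_zero [simp]: "cnj 0 = 0"
  and cnj_minus [simp]: "cnj (- x) = - cnj x"
  and cnj_diff [simp]: "cnj (x - y) = cnj x - cnj y"
  by (simp_all add: cnj_def scale_left_distrib scale_right_diff_distrib scale_left_diff_distrib)

lemma ip_e_e: "ip e e = 2"
  by (simp add: ip_self)

lemma cnj_cnj [simp]: "cnj (cnj x) = x"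
  by (simp add: cnj_def ip_e_e scale_left_diff_distrib scale_left_distrib mult_2_right)

lemma cnj_e [simp]: "cnj e = e"
  using scale_left_distrib[of 1 1 e] by (simp add: cnj_def ip_e_e)

lemma ip_cnj_cnj [simp]: "ip (cnj x) (cnj y) = ip x y"
  by (simp add: cnj_def ip_e_e ip_commute[of e y] algebra_simps)

lemma ip_cnj_left: "ip (cnj x) y = ip x (cnj y)"
  using ip_cnj_cnj[of x "cnj y"] by simp

lemma N_cnj [simp]: "N (cnj x) = N x"
  by (simp add: cnj_def N_diff N_scale power2_eq_square ip_commute[of e x])

lemma ip_mult_left: "ip (z \<bullet> w) y = ip w (cnj z \<bullet> y)"
  using ip_mult_exchange[of e y z w]
  by (simp add: unit_left cnj_def ip_commute[of e z] ip_commute[of y "z \<bullet> w"] ip_commute[of y w] algebra_simps)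

lemma ip_mult_right: "ip (z \<bullet> w) y = ip z (y \<bullet> cnj w)"
  using ip_mult_exchange[of z w y e]
  by (simp add: unit_right cnj_def algebra_simps)

lemma cnj_mult [simp]: "cnj (x \<bullet> y) = cnj y \<bullet> cnj x"
proof (rule ip_ext)
  fix z
  have "ip (cnj (x \<bullet> y)) z = ip y (cnj x \<bullet> cnj z)"
    by (simp add: ip_cnj_left ip_mult_left)
  also have "\<dots> = ip (y \<bullet> z) (cnj x)"
    by (simp add: ip_mult_right)
  also have "\<dots> = ip (cnj y \<bullet> cnj x) z"
    by (simp add: ip_mult_left ip_commute[of "cnj x"])
  finally show "ip (cnj (x \<bullet> y)) z = ip (cnj y \<bullet> cnj x) z" .
qed

text \<open>The alternative law in cancellation form: by adjointness, pairing the left side with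
  \<open>z\<close> gives \<open>ip (x \<bullet> y) (x \<bullet> z)\<close>.\<close>

lemma cnj_mult_cancel [simp]: "cnj x \<bullet> (x \<bullet> y) = N x *s y"
proof (rule ip_ext)
  fix z
  show "ip (cnj x \<bullet> (x \<bullet> y)) z = ip (N x *s y) z"
    using ip_mult_same_left[of x y z] by (simp add: ip_mult_left[of "cnj x"])
qed

lemma mult_cnj_cancel [simp]: "(y \<bullet> x) \<bullet> cnj x = N x *s y"
  using arg_cong[OF cnj_mult_cancel[of "cnj x" "cnj y"], of cnj] by simp

lemma mult_cnj_cancel_left [simp]: "x \<bullet> (cnj x \<bullet> y) = N x *s y"
  and mult_cnj_cancel_right [simp]: "(y \<bullet> cnj x) \<bullet> x = N x *s y"
  using cnj_mult_cancel[of "cnj x" y] mult_cnj_cancel[of y "cnj x"] by simp_all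

lemma cnj_mult_self [simp]: "cnj x \<bullet> x = N x *s e"
  and mult_cnj_self [simp]: "x \<bullet> cnj x = N x *s e"
  using cnj_mult_cancel[of x e] mult_cnj_cancel[of e x] by (simp_all add: unit_left unit_right)

lemma mult_cnj_add: "x \<bullet> cnj y + y \<bullet> cnj x = ip x y *s e"
  by (simp add: polar_def scale_left_diff_distrib flip: mult_cnj_self)

abbreviation trip :: "'o \<Rightarrow> 'o \<Rightarrow> 'o \<Rightarrow> 'k" where
  "trip a b c \<equiv> ip a (cnj (b \<bullet> c))"

lemma trip_eq: "ip ((a \<bullet> b) \<bullet> c) e = ip a (cnj (b \<bullet> c))"
  by (simp add: ip_mult_right[of "a \<bullet> b" c] ip_mult_right[of a b] unit_left)

lemma trip_rotate: "ip a (cnj (b \<bullet> c)) = ip b (cnj (c \<bullet> a))"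
  using ip_mult_right[of b c "cnj a"] ip_cnj_left[of a "b \<bullet> c"] ip_commute[of "cnj a"] by simp

text \<open>
  The two sides of the middle Moufang identity \<open>(ab)(ca) = a(bc)a\<close>, in a form that needs no
  triple products.
\<close>

lemma middle_moufang: "(a \<bullet> b) \<bullet> (c \<bullet> a) = ip a (cnj (b \<bullet> c)) *s a - N a *s cnj (b \<bullet> c)"
proof (rule ip_ext)
  fix z
  have "ip (c \<bullet> a) ((cnj b \<bullet> cnj a) \<bullet> z) + ip (c \<bullet> z) ((cnj b \<bullet> cnj a) \<bullet> a)
      = ip c (cnj b \<bullet> cnj a) * ip a z"
    by (rule ip_mult_exchange)
  moreover have "ip ((a \<bullet> b) \<bullet> (c \<bullet> a)) z = ip (c \<bullet> a) ((cnj b \<bullet> cnj a) \<bullet> z)"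
    using ip_mult_left[of "a \<bullet> b" "c \<bullet> a" z] by simp
  moreover have "ip (c \<bullet> z) ((cnj b \<bullet> cnj a) \<bullet> a) = N a * ip (cnj (b \<bullet> c)) z"
    using ip_mult_left[of c z "cnj b"] by (simp add: ip_commute[of z "cnj c \<bullet> cnj b"])
  moreover have "ip c (cnj b \<bullet> cnj a) = ip a (cnj (b \<bullet> c))"
    using trip_rotate[of c a b] by simp
  ultimately show "ip ((a \<bullet> b) \<bullet> (c \<bullet> a)) z
      = ip (ip a (cnj (b \<bullet> c)) *s a - N a *s cnj (b \<bullet> c)) z"
    by (simp only: ip_diff_left ip_scale_left eq_diff_eq)
qed

text \<open>For a basis \<open>B\<close>, the map \<open>T\<close> that sends \<open>x\<close> to
  the sum of \<open>ip x b *s b\<close> is injective by nondegeneracy, hence surjective; preimages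
  of the basis vectors are the dual vectors.\<close>

lemma exists_dual_basis:
  obtains B d where "finite B" "card B = 8" "\<And>y. (\<Sum>b\<in>B. ip (d b) y *s b) = y"
    "\<And>y. (\<Sum>b\<in>B. ip b y *s d b) = y" "\<And>b. b \<in> B \<Longrightarrow> ip (d b) b = 1"
proof -
  obtain B where "B \<subseteq> UNIV" "independent B" "UNIV \<subseteq> span B" "card B = dim UNIV"
    by (rule basis_exists)
  then have B: "independent B" "span B = UNIV" "card B = 8"
    by (auto simp: dim_8)
  have fin: "finite B"
    using B(3) by (intro card_ge_0_finite) simp
  interpret finite_dimensional_vector_space scale B
    by unfold_locales (use B fin in auto)
  define T where "T x = (\<Sum>b\<in>B. ip x b *s b)" for x
  have "Vector_Spaces.linear scale scale T"
    unfolding T_def Vector_Spaces.linear_iff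
    by (auto intro: vector_space_axioms simp: scale_left_distrib sum.distrib scale_sum_right)
  moreover have ker: "x = 0" if "T x = 0" for x
  proof (rule N_nondegenerate)
    fix y
    have x: "\<forall>b\<in>B. ip x b = 0"
      using independentD[OF B(1) fin order_refl, of "ip x"] \<open>T x = 0\<close> by (simp add: T_def)
    have "y \<in> span B"
      using B by simp
    then show "ip x y = 0"
      using x by (induction rule: span_induct_alt) auto
  qed
  moreover have "inj T"
  proof (rule injI)
    fix x y assume "T x = T y"
    moreover have "T (x - y) = T x - T y"
      by (simp add: T_def scale_left_diff_distrib sum_subtractf)
    ultimately show "x = y"
      using ker[of "x - y"] by simp
  qed
  ultimately have "surj T"
    by (intro linear_inj_imp_surj) auto
  then have "\<forall>b. \<exists>x. T x = b"
    by (metis surjD)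
  then obtain d where d: "\<And>b. T (d b) = b"
    by metis
  have dd: "ip (d b) b' = (if b = b' then 1 else 0)" if "b \<in> B" "b' \<in> B" for b b'
  proof -
    have "(\<Sum>c\<in>B. (ip (d b) c - (if c = b then 1 else 0)) *s c) = 0"
      using that fin d[of b] unfolding T_def
      by (simp add: scale_left_diff_distrib sum_subtractf if_distrib[of "\<lambda>t. t *s _"] cong: if_cong)
    then have "ip (d b) b' - (if b' = b then 1 else 0) = 0"
      using independentD[OF B(1) fin order_refl, of "\<lambda>c. ip (d b) c - (if c = b then 1 else 0)"] that
      by blast
    then show ?thesis
      by auto
  qed
  have rec: "(\<Sum>b\<in>B. ip (d b) y *s b) = y" for y
  proof -
    have "y \<in> span B"
      using B by simp
    then show ?thesis
    proof (induction rule: span_induct_alt)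
      case base
      then show ?case by simp
    next
      case (step c x y)
      have "(\<Sum>b\<in>B. ip (d b) x *s b) = x"
        using step(1) fin
        by (simp add: dd if_distrib[of "\<lambda>t. t *s _"] cong: if_cong)
      moreover have "(\<Sum>b\<in>B. (c * ip (d b) x) *s b) = c *s (\<Sum>b\<in>B. ip (d b) x *s b)"
        by (simp add: scale_sum_right)
      ultimately have "(\<Sum>b\<in>B. (c * ip (d b) x) *s b) = c *s x"
        by simp
      with step(2) show ?case
        by (simp add: scale_left_distrib sum.distrib)
    qed
  qed
  moreover have "(\<Sum>b\<in>B. ip b y *s d b) = y" for y
  proof (rule ip_ext)
    fix z
    have "ip (\<Sum>b\<in>B. ip b y *s d b) z = ip (\<Sum>b\<in>B. ip (d b) z *s b) y"
      by (simp add: ip_sum_left ip_sum_right mult.commute)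
    then show "ip (\<Sum>b\<in>B. ip b y *s d b) z = ip y z"
      by (simp only: rec ip_commute[of z y])
  qed
  ultimately show ?thesis
    using that[of B d] fin B(3) dd by simp
qed

end

text \<open>The Jordan product divides by 2 and the trilinear form by 3; together they make 6
  invertible, as polarising the cubic form \<open>det\<close> demands, and also
  \<open>27 = trace id\<close>.\<close>

locale albert_algebra = split_octonion_algebra scale mult e N
  for scale :: "'k::alg_closed_field \<Rightarrow> 'o::ab_group_add \<Rightarrow> 'o"  (infixr "*s" 75)
    and mult :: "'o \<Rightarrow> 'o \<Rightarrow> 'o"  (infixl "\<bullet>" 70)
    and e :: 'o
    and N :: "'o \<Rightarrow> 'k" +
  assumes two_nonzero [simp]: "(2::'k) \<noteq> 0"
    and three_nonzero [simp]: "(3::'k) \<noteq> 0"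
begin

lemma small_numerals_nonzero [simp]:
  "(4::'k) \<noteq> 0" "(6::'k) \<noteq> 0" "(8::'k) \<noteq> 0" "(9::'k) \<noteq> 0" "(12::'k) \<noteq> 0"
  "(16::'k) \<noteq> 0" "(18::'k) \<noteq> 0" "(24::'k) \<noteq> 0" "(27::'k) \<noteq> 0"
proof -
  have "(4::'k) = 2 * 2" "(6::'k) = 2 * 3" "(8::'k) = 2 * 2 * 2" "(9::'k) = 3 * 3" "(12::'k) = 2 * 2 * 3"
    "(16::'k) = 2 * 2 * 2 * 2" "(18::'k) = 2 * 3 * 3" "(24::'k) = 2 * 2 * 2 * 3" "(27::'k) = 3 * 3 * 3"
    by simp_all
  then show "(4::'k) \<noteq> 0" "(6::'k) \<noteq> 0" "(8::'k) \<noteq> 0" "(9::'k) \<noteq> 0" "(12::'k) \<noteq> 0"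
    "(16::'k) \<noteq> 0" "(18::'k) \<noteq> 0" "(24::'k) \<noteq> 0" "(27::'k) \<noteq> 0"
    by (metis two_nonzero three_nonzero mult_eq_0_iff)+
qed

lemma half_double [simp]: "(1 / 2) *s (x + x) = x"
proof -
  have "x + x = 2 *s x"
    using scale_left_distrib[of 1 1 x] by simp
  then show ?thesis
    by simp
qed

text \<open>The trace of the product \<open>(a \<bullet> b) \<bullet> c\<close>. It is written with
  \<open>cnj c \<bullet> cnj b\<close> because the simp rule \<open>cnj_mult\<close> produces this
  form; the next lemma collects its cyclic variants under one name.\<close>

definition trp :: "'o \<Rightarrow> 'o \<Rightarrow> 'o \<Rightarrow> 'k" where
  "trp a b c = ip a (cnj c \<bullet> cnj b)"

lemma trp_a: "ip (cnj c \<bullet> cnj b) a = trp a b c"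
  and trp_b: "ip (cnj a \<bullet> cnj c) b = trp a b c"
  and trp_c: "ip (cnj b \<bullet> cnj a) c = trp a b c"
  using trip_rotate[of a b c] trip_rotate[of b c a]
  by (simp_all add: trp_def ip_commute[of "cnj c \<bullet> cnj b"] ip_commute[of "cnj a \<bullet> cnj c"]
      ip_commute[of "cnj b \<bullet> cnj a"])

lemma trp_rotate: "trp a b c = trp b c a"
  using trip_rotate[of a b c] by (simp add: trp_def)

lemma trp_linear [simp]:
  "trp (a + a') b c = trp a b c + trp a' b c" "trp a (b + b') c = trp a b c + trp a b' c"
  "trp a b (c + c') = trp a b c + trp a b c'"
  "trp (a - a') b c = trp a b c - trp a' b c" "trp a (b - b') c = trp a b c - trp a b' c"
  "trp a b (c - c') = trp a b c - trp a b c'"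
  "trp (t *s a) b c = t * trp a b c" "trp a (t *s b) c = t * trp a b c" "trp a b (t *s c) = t * trp a b c"
  "trp 0 b c = 0" "trp a 0 c = 0" "trp a b 0 = 0"
  by (simp_all add: trp_def)

lemma det_eq: "det (\<alpha>1, \<alpha>2, \<alpha>3, a, b, c)
    = \<alpha>1 * \<alpha>2 * \<alpha>3 - \<alpha>1 * N a - \<alpha>2 * N b - \<alpha>3 * N c + trp a b c"
  by (simp add: trip_eq trp_def)

declare det.simps [simp del]


subsection \<open>The trace form, the cross product and the trilinear form in coordinates\<close>

text \<open>\<open>tf\<close>, \<open>crs\<close> and \<open>tri\<close> are coordinate candidates
  for \<open>trace_form\<close>, \<open>cross\<close> and \<open>trilinear_form\<close>. The latter
  rest on \<open>THE\<close>, so the candidates must satisfy the characterising properties before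
  they can be identified with them.\<close>

fun tf :: "('k, 'o) albert \<Rightarrow> ('k, 'o) albert \<Rightarrow> 'k" where
  "tf (\<alpha>1, \<alpha>2, \<alpha>3, a, b, c) (\<beta>1, \<beta>2, \<beta>3, a', b', c')
    = \<alpha>1 * \<beta>1 + \<alpha>2 * \<beta>2 + \<alpha>3 * \<beta>3 + ip a a' + ip b b' + ip c c'"

text \<open>The polarised Freudenthal adjoint: \<open>crs x x\<close> is the gradient of
  \<open>det\<close> at \<open>x\<close> with respect to \<open>tf\<close>.\<close>

fun crs :: "('k, 'o) albert \<Rightarrow> ('k, 'o) albert \<Rightarrow> ('k, 'o) albert" where
  "crs (\<alpha>1, \<alpha>2, \<alpha>3, a, b, c) (\<beta>1, \<beta>2, \<beta>3, a', b', c') =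
    ((\<alpha>2 * \<beta>3 + \<alpha>3 * \<beta>2 - ip a a') / 2,
     (\<alpha>3 * \<beta>1 + \<alpha>1 * \<beta>3 - ip b b') / 2,
     (\<alpha>1 * \<beta>2 + \<alpha>2 * \<beta>1 - ip c c') / 2,
     (1 / 2) *s (cnj c' \<bullet> cnj b + cnj c \<bullet> cnj b' - \<alpha>1 *s a' - \<beta>1 *s a),
     (1 / 2) *s (cnj a' \<bullet> cnj c + cnj a \<bullet> cnj c' - \<alpha>2 *s b' - \<beta>2 *s b),
     (1 / 2) *s (cnj b' \<bullet> cnj a + cnj b \<bullet> cnj a' - \<alpha>3 *s c' - \<beta>3 *s c))"

definition tri :: "('k, 'o) albert \<Rightarrow> ('k, 'o) albert \<Rightarrow> ('k, 'o) albert \<Rightarrow> 'k" where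
  "tri x y z = tf (crs x y) z / 3"

lemma tf_commute: "tf x y = tf y x"
  by (cases x; cases y) (simp add: ip_commute mult.commute)

lemma tf_linear [simp]:
  "tf (x + y) z = tf x z + tf y z" "tf z (x + y) = tf z x + tf z y"
  "tf (scaleW t x) z = t * tf x z" "tf z (scaleW t x) = t * tf z x"
  "tf 0 z = 0" "tf z 0 = 0"
  by (cases x; cases y; cases z; simp add: zero_prod_def algebra_simps)+

lemma tf_diff [simp]: "tf (x - y) z = tf x z - tf y z" "tf z (x - y) = tf z x - tf z y"
  using tf_linear(1)[of "x - y" y z] tf_linear(2)[of z "x - y" y] by (simp_all add: eq_diff_eq)

lemma crs_commute: "crs x y = crs y x"
  by (cases x; cases y) (simp add: ip_commute algebra_simps)

lemma crs_linear_left: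
  "crs (x + y) z = crs x z + crs y z" "crs (scaleW t x) z = scaleW t (crs x z)" "crs 0 z = 0"
  by (cases x; cases y; cases z;
      simp add: zero_prod_def scale_right_distrib scale_right_diff_distrib scale_left_distrib
        add_divide_distrib diff_divide_distrib algebra_simps)+

lemma crs_linear [simp]:
  "crs (x + y) z = crs x z + crs y z" "crs z (x + y) = crs z x + crs z y"
  "crs (scaleW t x) z = scaleW t (crs x z)" "crs z (scaleW t x) = scaleW t (crs z x)"
  "crs 0 z = 0" "crs z 0 = 0"
  by (simp_all add: crs_linear_left crs_commute[of z])

lemma crs_diff [simp]: "crs (x - y) z = crs x z - crs y z" "crs z (x - y) = crs z x - crs z y"
  using crs_linear(1)[of "x - y" y z] crs_linear(2)[of z "x - y" y] by (simp_all add: eq_diff_eq)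

lemma tf_crs_swap: "tf (crs x y) z = tf (crs x z) y"
proof -
  obtain \<alpha>1 \<alpha>2 \<alpha>3 a b c where x: "x = (\<alpha>1, \<alpha>2, \<alpha>3, a, b, c)" by (cases x)
  obtain \<beta>1 \<beta>2 \<beta>3 a' b' c' where y: "y = (\<beta>1, \<beta>2, \<beta>3, a', b', c')" by (cases y)
  obtain \<gamma>1 \<gamma>2 \<gamma>3 a'' b'' c'' where z: "z = (\<gamma>1, \<gamma>2, \<gamma>3, a'', b'', c'')" by (cases z)
  show ?thesis
    unfolding x y z
    by (simp add: trp_a[of c' b a''] trp_a[of c b' a''] trp_b[of a' c b''] trp_b[of a c' b'']
        trp_c[of b' a c''] trp_c[of b a' c''] trp_a[of c'' b a'] trp_a[of c b'' a'] trp_b[of a'' c b']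
        trp_b[of a c'' b'] trp_c[of b'' a c'] trp_c[of b a'' c'])
      (simp add: add_divide_distrib diff_divide_distrib algebra_simps ip_commute)
qed

lemma tri_symmetric: "tri x y z = tri y x z" "tri x y z = tri x z y"
  unfolding tri_def by (simp only: crs_commute[of x y], simp only: tf_crs_swap[of x y z])

lemma tri_linear [simp]:
  "tri (x + y) z w = tri x z w + tri y z w" "tri z (x + y) w = tri z x w + tri z y w"
  "tri z w (x + y) = tri z w x + tri z w y"
  "tri (x - y) z w = tri x z w - tri y z w" "tri z (x - y) w = tri z x w - tri z y w"
  "tri z w (x - y) = tri z w x - tri z w y"
  "tri (scaleW t x) z w = t * tri x z w" "tri z (scaleW t x) w = t * tri z x w"
  "tri z w (scaleW t x) = t * tri z w x"
  "tri 0 z w = 0" "tri z 0 w = 0" "tri z w 0 = 0"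
  by (simp_all add: tri_def add_divide_distrib diff_divide_distrib)

lemma crs_self: "crs (\<alpha>1, \<alpha>2, \<alpha>3, a, b, c) (\<alpha>1, \<alpha>2, \<alpha>3, a, b, c) =
    (\<alpha>2 * \<alpha>3 - N a, \<alpha>3 * \<alpha>1 - N b, \<alpha>1 * \<alpha>2 - N c,
     cnj c \<bullet> cnj b - \<alpha>1 *s a, cnj a \<bullet> cnj c - \<alpha>2 *s b, cnj b \<bullet> cnj a - \<alpha>3 *s c)"
proof -
  have half: "(1 / 2) *s (x + x - y - y) = x - y" for x y
    using half_double[of "x - y"] by (simp add: algebra_simps)
  have "(s + t - 2 * u) / 2 = s - u" if "s = t" for s t u :: 'k
    using that by (simp add: field_simps)
  then show ?thesis
    by (simp add: half ip_self mult.commute)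
qed

lemma tri_self: "tri x x x = det x"
proof -
  obtain \<alpha>1 \<alpha>2 \<alpha>3 a b c where x: "x = (\<alpha>1, \<alpha>2, \<alpha>3, a, b, c)" by (cases x)
  show ?thesis
    unfolding x tri_def crs_self
    by (simp add: det_eq trp_a trp_b[of a c b] trp_c[of b a c] trp_rotate[of b c a]
        trp_rotate[of c a b] ip_self field_simps)
qed

lemma tf_ext: "(\<And>z. tf x z = tf y z) \<Longrightarrow> x = y"
proof -
  assume *: "\<And>z. tf x z = tf y z"
  obtain \<alpha>1 \<alpha>2 \<alpha>3 a b c where x: "x = (\<alpha>1, \<alpha>2, \<alpha>3, a, b, c)" by (cases x)
  obtain \<beta>1 \<beta>2 \<beta>3 a' b' c' where y: "y = (\<beta>1, \<beta>2, \<beta>3, a', b', c')" by (cases y)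
  have "a = a'" "b = b'" "c = c'"
    using *[of "(0, 0, 0, z, 0, 0)" for z] *[of "(0, 0, 0, 0, z, 0)" for z] *[of "(0, 0, 0, 0, 0, z)" for z]
    by (auto intro!: ip_ext simp: x y)
  then show "x = y"
    using *[of "(1, 0, 0, 0, 0, 0)"] *[of "(0, 1, 0, 0, 0, 0)"] *[of "(0, 0, 1, 0, 0, 0)"]
    by (simp add: x y)
qed

text \<open>The adjoint identity of Jordan theory. The off-diagonal entries contain products such as
  \<open>(a \<bullet> b) \<bullet> (c \<bullet> a)\<close>, which the middle Moufang identity
  reduces to multiples of \<open>a\<close> and of \<open>cnj c \<bullet> cnj b\<close>.\<close>

lemma crs_crs_self: "crs (crs x x) (crs x x) = scaleW (det x) x"
proof -
  obtain \<alpha>1 \<alpha>2 \<alpha>3 a b c where x: "x = (\<alpha>1, \<alpha>2, \<alpha>3, a, b, c)" by (cases x)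
  have m: "(a \<bullet> b) \<bullet> (c \<bullet> a) = trp a b c *s a - N a *s (cnj c \<bullet> cnj b)" for a b c
    using middle_moufang[of a b c] by (simp add: trp_def)
  show ?thesis
    unfolding x crs_self det_eq
    apply (simp add: N_diff N_mult N_scale trp_a trp_b[of a c b] trp_c[of b a c] m power2_eq_square
        trp_rotate[of b c a] trp_rotate[of c a b])
    apply (simp add: scale_left_distrib scale_right_distrib scale_left_diff_distrib
        scale_right_diff_distrib algebra_simps)
    done
qed

declare split_paired_All [simp del] split_paired_Ex [simp del]

lemma linear_WK_iff: "Vector_Spaces.linear scaleW (*) f \<longleftrightarrow>
    (\<forall>x y. f (x + y) = f x + f y) \<and> (\<forall>t x. f (scaleW t x) = t * f x)"
  unfolding Vector_Spaces.linear_iff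
  by (auto intro: W.vector_space_axioms intro!: vector_space.intro simp: algebra_simps)

lemma linear_W_iff: "Vector_Spaces.linear scaleW scaleW f \<longleftrightarrow>
    (\<forall>x y. f (x + y) = f x + f y) \<and> (\<forall>t x. f (scaleW t x) = scaleW t (f x))"
  unfolding Vector_Spaces.linear_iff by (auto intro: W.vector_space_axioms)

lemma polarize_symmetric_trilinear:
  fixes t :: "('k, 'o) albert \<Rightarrow> ('k, 'o) albert \<Rightarrow> ('k, 'o) albert \<Rightarrow> 'k"
  assumes sym: "\<And>x y z. t x y z = t y x z" "\<And>x y z. t x y z = t x z y"
    and add: "\<And>x x' y z. t (x + x') y z = t x y z + t x' y z"
  shows "6 * t x y z = t (x + y + z) (x + y + z) (x + y + z) - t (x + y) (x + y) (x + y)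
    - t (y + z) (y + z) (y + z) - t (x + z) (x + z) (x + z) + t x x x + t y y y + t z z z"
proof -
  have add2: "t y (x + x') z = t y x z + t y x' z" "t y z (x + x') = t y z x + t y z x'" for x x' y z
    by (metis sym add)+
  have perms: "t x z y = t x y z" "t y x z = t x y z" "t y z x = t x y z" "t z x y = t x y z"
    "t z y x = t x y z"
    by (metis sym)+
  have "t y x x = t x x y" "t x y x = t x x y" for x y
    by (metis sym)+
  then show ?thesis
    by (simp add: add add2 perms algebra_simps)
qed

lemma trilinear_form_eq: "trilinear_form = tri"
  unfolding trilinear_form_def
proof (rule the_equality)
  show "(\<forall>x y z. tri x y z = tri y x z \<and> tri x y z = tri x z y) \<and>
      (\<forall>y z. Vector_Spaces.linear scaleW (*) (\<lambda>x. tri x y z)) \<and> (\<forall>x. tri x x x = det x)"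
    unfolding linear_WK_iff by (intro conjI allI tri_symmetric tri_self) simp_all
next
  fix t
  assume t: "(\<forall>x y z. t x y z = t y x z \<and> t x y z = t x z y) \<and>
      (\<forall>y z. Vector_Spaces.linear scaleW (*) (\<lambda>x. t x y z)) \<and> (\<forall>x. t x x x = det x)"
  have t': "t x y z = t y x z" "t x y z = t x z y" "t (x + x') y z = t x y z + t x' y z"
    "t x x x = det x" for x x' y z
    using t unfolding linear_WK_iff by blast+
  have "6 * t x y z = 6 * tri x y z" for x y z
    unfolding polarize_symmetric_trilinear[of t, OF t'(1-3)]
      polarize_symmetric_trilinear[of tri, OF tri_symmetric tri_linear(1)]
    by (simp only: t'(4) tri_self)
  then show "t = tri"
    by (intro ext) (metis mult_left_cancel small_numerals_nonzero(2))
qed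

fun jm :: "('k, 'o) albert \<Rightarrow> ('k, 'o) albert \<Rightarrow> ('k, 'o) albert" where
  "jm (\<alpha>1, \<alpha>2, \<alpha>3, a, b, c) (\<beta>1, \<beta>2, \<beta>3, a', b', c') =
    (\<alpha>1 * \<beta>1 + (ip b b' + ip c c') / 2, \<alpha>2 * \<beta>2 + (ip c c' + ip a a') / 2,
     \<alpha>3 * \<beta>3 + (ip a a' + ip b b') / 2,
     (1 / 2) *s (cnj c \<bullet> cnj b' + cnj c' \<bullet> cnj b + (\<alpha>2 + \<alpha>3) *s a' + (\<beta>2 + \<beta>3) *s a),
     (1 / 2) *s (cnj a \<bullet> cnj c' + cnj a' \<bullet> cnj c + (\<alpha>3 + \<alpha>1) *s b' + (\<beta>3 + \<beta>1) *s b),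
     (1 / 2) *s (cnj b \<bullet> cnj a' + cnj b' \<bullet> cnj a + (\<alpha>1 + \<alpha>2) *s c' + (\<beta>1 + \<beta>2) *s c))"

lemma hmat_jm: "hmat (jm x y) =
  (\<chi> i j. (1 / 2) *s (mat_mult (hmat x) (hmat y) + mat_mult (hmat y) (hmat x)) $ i $ j)"
proof -
  obtain \<alpha>1 \<alpha>2 \<alpha>3 a b c where x: "x = (\<alpha>1, \<alpha>2, \<alpha>3, a, b, c)" by (cases x)
  obtain \<beta>1 \<beta>2 \<beta>3 a' b' c' where y: "y = (\<beta>1, \<beta>2, \<beta>3, a', b', c')" by (cases y)
  have diag: "(\<alpha> * \<beta> + (s + t) / 2) *s e
      = (1 / 2) *s ((\<alpha> * \<beta>) *s e + s *s e + t *s e + (\<beta> * \<alpha>) *s e)" for \<alpha> \<beta> s t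
  proof -
    have "\<alpha> * \<beta> + (s + t) / 2 = 1 / 2 * (\<alpha> * \<beta> + s + t + \<beta> * \<alpha>)"
      by (simp add: field_simps)
    then show ?thesis
      by (simp only: scale_scale[symmetric] scale_left_distrib)
  qed
  have 1: "y \<bullet> cnj x = ip x y *s e - x \<bullet> cnj y" for x y
    using mult_cnj_add[of x y] by (simp add: eq_diff_eq add.commute)
  have 2: "cnj y \<bullet> x = ip x y *s e - cnj x \<bullet> y" for x y
    using mult_cnj_add[of "cnj x" "cnj y"] by (simp add: eq_diff_eq add.commute)
  \<comment> \<open>In each symmetrised product the factor with the primed entry is moved to the
    right. The rules are instantiated because, left general, they would undo each other.\<close>
  note rules = 1[where y = a' and x = a] 1[where y = b' and x = b] 1[where y = c' and x = c]
    2[where y = a' and x = a] 2[where y = b' and x = b] 2[where y = c' and x = c]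
  show ?thesis
    unfolding x y vec_eq_iff forall_3
    apply (simp add: mat_mult_def sum_3 unit_left unit_right diag rules)
    apply (simp add: scale_right_distrib scale_left_distrib add_ac)
    done
qed

lemma hmat_inject: "hmat x = hmat y \<Longrightarrow> x = y"
  using e_nonzero by (cases x; cases y) (auto simp: vec_eq_iff forall_3)

lemma trace_form_eq: "trace_form = tf"
proof (intro ext)
  fix x y
  have "jordan x y = jm x y"
    unfolding jordan_def hmat_jm[symmetric] using hmat_inject by blast
  then show "trace_form x y = tf x y"
    unfolding trace_form_def by (cases x; cases y) (simp add: field_simps)
qed

lemma cross_eq: "x \<otimes> y = crs x y"
  unfolding cross_def trilinear_form_eq trace_form_eq
proof (rule the_equality)
  show "\<forall>z. 3 * tri x y z = tf (crs x y) z"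
    by (simp add: tri_def)
  show "w = crs x y" if "\<forall>z. 3 * tri x y z = tf w z" for w
  proof (rule tf_ext)
    show "tf w z = tf (crs x y) z" for z
      using spec[OF that, of z] by (simp add: tri_def)
  qed
qed


subsection \<open>Contraction over dual bases\<close>

definition is_dual_basis :: "'o set \<times> ('o \<Rightarrow> 'o) \<Rightarrow> bool" where
  "is_dual_basis p \<longleftrightarrow> finite (fst p) \<and> card (fst p) = 8 \<and>
    (\<forall>y. (\<Sum>b\<in>fst p. ip (snd p b) y *s b) = y) \<and>
    (\<forall>y. (\<Sum>b\<in>fst p. ip b y *s snd p b) = y) \<and> (\<forall>b\<in>fst p. ip (snd p b) b = 1)"

definition dual_basis :: "'o set \<times> ('o \<Rightarrow> 'o)" where
  "dual_basis = (SOME p. is_dual_basis p)"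

abbreviation "OB \<equiv> fst dual_basis"
abbreviation "od \<equiv> snd dual_basis"

lemma dual_basis: "finite OB" "card OB = 8" "(\<Sum>b\<in>OB. ip (od b) y *s b) = y"
  "(\<Sum>b\<in>OB. ip b y *s od b) = y" "b \<in> OB \<Longrightarrow> ip (od b) b = 1"
proof -
  obtain B d where "finite B" "card B = 8" "\<And>y. (\<Sum>b\<in>B. ip (d b) y *s b) = y"
    "\<And>y. (\<Sum>b\<in>B. ip b y *s d b) = y" "\<And>b. b \<in> B \<Longrightarrow> ip (d b) b = 1"
    by (rule exists_dual_basis) blast
  then have "is_dual_basis (B, d)"
    by (simp add: is_dual_basis_def)
  then have "is_dual_basis dual_basis"
    unfolding dual_basis_def by (rule someI)
  then show "finite OB" "card OB = 8" "(\<Sum>b\<in>OB. ip (od b) y *s b) = y"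
    "(\<Sum>b\<in>OB. ip b y *s od b) = y" "b \<in> OB \<Longrightarrow> ip (od b) b = 1"
    by (simp_all add: is_dual_basis_def)
qed

abbreviation E1 :: "('k, 'o) albert" where "E1 \<equiv> (1, 0, 0, 0, 0, 0)"
abbreviation E2 :: "('k, 'o) albert" where "E2 \<equiv> (0, 1, 0, 0, 0, 0)"
abbreviation E3 :: "('k, 'o) albert" where "E3 \<equiv> (0, 0, 1, 0, 0, 0)"
abbreviation Ea :: "'o \<Rightarrow> ('k, 'o) albert" where "Ea x \<equiv> (0, 0, 0, x, 0, 0)"
abbreviation Eb :: "'o \<Rightarrow> ('k, 'o) albert" where "Eb x \<equiv> (0, 0, 0, 0, x, 0)"
abbreviation Ec :: "'o \<Rightarrow> ('k, 'o) albert" where "Ec x \<equiv> (0, 0, 0, 0, 0, x)"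

text \<open>Evaluation of \<open>\<phi>\<close> on the canonical element of
  \<open>W \<otimes> W\<close> given by dual bases for \<open>tf\<close>. It replaces all index
  sums; its arbitrary codomain allows contractions to be nested and to take values in scalars,
  vectors or endomorphisms.\<close>

definition ctr :: "(('k, 'o) albert \<Rightarrow> ('k, 'o) albert \<Rightarrow> 'v) \<Rightarrow> 'v::ab_group_add" where
  "ctr \<phi> = \<phi> E1 E1 + \<phi> E2 E2 + \<phi> E3 E3 + (\<Sum>b\<in>OB. \<phi> (Ea b) (Ea (od b)))
    + (\<Sum>b\<in>OB. \<phi> (Eb b) (Eb (od b))) + (\<Sum>b\<in>OB. \<phi> (Ec b) (Ec (od b)))"

lemma ctr_cong: "(\<And>x y. \<phi> x y = \<psi> x y) \<Longrightarrow> ctr \<phi> = ctr \<psi>"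
  by (simp add: ctr_def)

lemma ctr_add: "ctr (\<lambda>x y. \<phi> x y + \<psi> x y) = ctr \<phi> + ctr \<psi>"
  by (simp add: ctr_def sum.distrib algebra_simps)

lemma ctr_hom:
  assumes "f 0 = 0" "\<And>u v. f (u + v) = f u + f v"
  shows "f (ctr \<phi>) = ctr (\<lambda>x y. f (\<phi> x y))"
proof -
  have "f (sum g A) = (\<Sum>x\<in>A. f (g x))" for g and A :: "'o set"
    using assms by (induction A rule: infinite_finite_induct) auto
  then show ?thesis
    by (simp add: ctr_def assms)
qed

lemma ctr_swap: "ctr (\<lambda>x y. ctr (\<lambda>z w. \<phi> x y z w)) = ctr (\<lambda>z w. ctr (\<lambda>x y. \<phi> x y z w))"
  by (simp add: ctr_def sum.distrib algebra_simps
      sum.swap[of "\<lambda>x y. \<phi> (Ea x) (Ea (od x)) (Eb y) (Eb (od y))"]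
      sum.swap[of "\<lambda>x y. \<phi> (Ea x) (Ea (od x)) (Ec y) (Ec (od y))"]
      sum.swap[of "\<lambda>x y. \<phi> (Eb x) (Eb (od x)) (Ec y) (Ec (od y))"]
      sum.swap[of "\<lambda>x y. \<phi> (Eb x) (Eb (od x)) (Ea y) (Ea (od y))"]
      sum.swap[of "\<lambda>x y. \<phi> (Ec x) (Ec (od x)) (Ea y) (Ea (od y))"]
      sum.swap[of "\<lambda>x y. \<phi> (Ec x) (Ec (od x)) (Eb y) (Eb (od y))"]
      sum.swap[of "\<lambda>x y. \<phi> (Ea x) (Ea (od x)) (Ea y) (Ea (od y))"]
      sum.swap[of "\<lambda>x y. \<phi> (Eb x) (Eb (od x)) (Eb y) (Eb (od y))"]
      sum.swap[of "\<lambda>x y. \<phi> (Ec x) (Ec (od x)) (Ec y) (Ec (od y))"])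

lemma sum_E: "(\<Sum>x\<in>A. Ea (f x)) = Ea (sum f A)" "(\<Sum>x\<in>A. Eb (f x)) = Eb (sum f A)"
  "(\<Sum>x\<in>A. Ec (f x)) = Ec (sum f A)"
  by (induction A rule: infinite_finite_induct) (auto simp: zero_prod_def)

lemma ctr_tf: "ctr (\<lambda>x y. scaleW (tf x w) y) = w" "ctr (\<lambda>x y. scaleW (tf y w) x) = w"
  by (cases w; simp add: ctr_def sum_E dual_basis)+

text \<open>Contracting one leg against \<open>tf w\<close> substitutes \<open>w\<close> for the
  other leg: expand \<open>w\<close> in dual bases and apply the linear \<open>f\<close>. The
  scaling \<open>s\<close> is a parameter because \<open>f\<close> is used with several
  codomains.\<close>

lemma ctr_reconstruct:
  assumes s: "\<And>u. s 0 u = 0"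
    and f: "\<And>u v. f (u + v) = f u + f v" "\<And>t u. f (scaleW t u) = s t (f u)"
  shows "ctr (\<lambda>x y. s (tf x w) (f y)) = f w" "ctr (\<lambda>x y. s (tf y w) (f x)) = f w"
    "ctr (\<lambda>x y. s (tf w x) (f y)) = f w" "ctr (\<lambda>x y. s (tf w y) (f x)) = f w"
proof -
  have f0: "f 0 = 0"
    using f(2)[of 0 0] s by simp
  show *: "ctr (\<lambda>x y. s (tf x w) (f y)) = f w" "ctr (\<lambda>x y. s (tf y w) (f x)) = f w"
    using ctr_hom[of f "\<lambda>x y. scaleW (tf x w) y", OF f0 f(1)]
      ctr_hom[of f "\<lambda>x y. scaleW (tf y w) x", OF f0 f(1)]
    by (simp_all only: ctr_tf f(2))
  show "ctr (\<lambda>x y. s (tf w x) (f y)) = f w" "ctr (\<lambda>x y. s (tf w y) (f x)) = f w"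
    unfolding tf_commute[of w] by (fact *)+
qed


subsection \<open>Linear endomorphisms and the trace\<close>

abbreviation lin :: "('k, 'o) endo \<Rightarrow> bool" where
  "lin \<equiv> Vector_Spaces.linear scaleW scaleW"

lemma lin_add: "lin u \<Longrightarrow> u (x + y) = u x + u y"
  and lin_scale: "lin u \<Longrightarrow> u (scaleW t x) = scaleW t (u x)"
  by (simp_all add: linear_W_iff)

lemma lin_zero: "lin u \<Longrightarrow> u 0 = 0"
  using lin_scale[of u 0 0] by simp

lemma lin_comp: "lin u \<Longrightarrow> lin v \<Longrightarrow> lin (u \<circ> v)"
  by (simp add: linear_W_iff)

lemma lin_id: "lin id"
  by (simp add: linear_W_iff)

lemma lin_ops: "lin 0" "lin u \<Longrightarrow> lin v \<Longrightarrow> lin (u + v)" "lin u \<Longrightarrow> lin (scaleE t u)"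
  unfolding linear_W_iff
  by (simp_all add: fun_scale_def W.scale_right_distrib W.scale_left_commute algebra_simps)

lemma scaleE_apply [simp]: "scaleE t u x = scaleW t (u x)"
  by (simp add: fun_scale_def)

lemma finite_spanning_W: obtains S where "finite S" "W.span S = UNIV"
proof
  let ?S = "{E1, E2, E3} \<union> Ea ` OB \<union> Ea ` od ` OB \<union> Eb ` OB \<union> Eb ` od ` OB \<union> Ec ` OB \<union> Ec ` od ` OB"
  show "finite ?S"
    by (simp add: dual_basis)
  have "ctr (\<lambda>x y. scaleW (tf x w) y) \<in> W.span ?S" for w
    unfolding ctr_def by (intro W.span_add W.span_sum W.span_scale W.span_base) auto
  then show "W.span ?S = UNIV"
    by (auto simp only: ctr_tf)
qed

text \<open>The basis \<open>B\<close> picked by \<open>SOME\<close> is unrelated to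
  \<open>tf\<close>. Expanding each \<open>u b\<close> over the dual pairs and exchanging the two
  sums reassembles the coordinates with respect to \<open>B\<close> into the vector
  \<open>u x\<close>.\<close>

lemma trace_eq:
  assumes "lin u"
  shows "trace u = ctr (\<lambda>x y. tf (u x) y)"
proof -
  define B where "B = (SOME B. W.independent B \<and> W.span B = UNIV)"
  obtain B' where "B' \<subseteq> UNIV" "W.independent B'" "UNIV \<subseteq> W.span B'"
    by (rule W.maximal_independent_subset)
  then have "W.independent B' \<and> W.span B' = UNIV"
    by auto
  then have "W.independent B \<and> W.span B = UNIV"
    unfolding B_def by (rule someI)
  then have B: "W.independent B" "W.span B = UNIV"
    by auto
  obtain S where "finite S" "W.span S = UNIV"
    by (rule finite_spanning_W)
  then have fin: "finite B"
    using W.independent_span_bound[of S B] B by simp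
  define r where "r w b = W.representation B w b" for w b
  have r0: "r 0 b = 0" and r_add: "r (v + w) b = r v b + r w b"
    and r_scale: "r (scaleW t w) b = t * r w b" for v w b t
    using B by (auto simp: r_def W.representation_zero W.representation_add W.representation_scale)
  have r_sum: "(\<Sum>b\<in>B. scaleW (r v b) b) = v" for v
    unfolding r_def using B fin by (intro W.sum_representation_eq) auto
  have tf_sum: "tf x (sum g A) = (\<Sum>b\<in>A. tf x (g b))" for x g and A :: "('k, 'o) albert set"
    by (induction A rule: infinite_finite_induct) auto
  have sum_ctr: "(\<Sum>b\<in>A. ctr (\<phi> b)) = ctr (\<lambda>x y. \<Sum>b\<in>A. \<phi> b x y)"
    for \<phi> :: "('k, 'o) albert \<Rightarrow> ('k, 'o) albert \<Rightarrow> ('k, 'o) albert \<Rightarrow> 'k" and A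
    by (induction A rule: infinite_finite_induct) (auto simp: ctr_add, simp_all add: ctr_def)
  have "trace u = (\<Sum>b\<in>B. r (u b) b)"
    unfolding trace_def B_def[symmetric] r_def by simp
  also have "\<dots> = (\<Sum>b\<in>B. ctr (\<lambda>x y. tf y b * r (u x) b))"
  proof (rule sum.cong[OF refl])
    fix b
    have "ctr (\<lambda>x y. scaleW (tf y b) (u x)) = u b"
      by (rule ctr_reconstruct) (simp_all add: lin_add lin_scale assms)
    moreover have "r (ctr (\<lambda>x y. scaleW (tf y b) (u x))) b = ctr (\<lambda>x y. r (scaleW (tf y b) (u x)) b)"
      using r0 r_add by (rule ctr_hom[where f = "\<lambda>w. r w b"])
    ultimately show "r (u b) b = ctr (\<lambda>x y. tf y b * r (u x) b)"
      by (simp add: r_scale)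
  qed
  also have "\<dots> = ctr (\<lambda>x y. \<Sum>b\<in>B. tf y b * r (u x) b)"
    by (rule sum_ctr)
  also have "\<dots> = ctr (\<lambda>x y. tf (u x) y)"
  proof (rule ctr_cong)
    fix x y
    have "(\<Sum>b\<in>B. tf y b * r (u x) b) = tf y (\<Sum>b\<in>B. scaleW (r (u x) b) b)"
      by (simp add: tf_sum mult.commute)
    then show "(\<Sum>b\<in>B. tf y b * r (u x) b) = tf (u x) y"
      by (simp add: r_sum tf_commute[of y "u x"])
  qed
  finally show ?thesis .
qed

lemma trace_add: "lin u \<Longrightarrow> lin v \<Longrightarrow> trace (u + v) = trace u + trace v"
  by (simp add: trace_eq lin_ops flip: ctr_add)

lemma trace_scale: "lin u \<Longrightarrow> trace (scaleE t u) = t * trace u"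
  by (simp add: trace_eq lin_ops ctr_hom[of "\<lambda>s. t * s"] algebra_simps)

lemma trace_zero: "trace 0 = 0"
  using trace_scale[of 0 0] by (simp add: lin_ops)

lemma trace_id: "trace id = 27"
  using dual_basis(5) by (simp add: trace_eq lin_id ctr_def dual_basis(2) ip_commute[of _ "od _"])

lemma trace_comp_commute:
  assumes u: "lin u" and v: "lin v"
  shows "trace (u \<circ> v) = trace (v \<circ> u)"
proof -
  have *: "trace (u \<circ> v) = ctr (\<lambda>x y. ctr (\<lambda>z w. tf w (v x) * tf (u z) y))"
    if "lin u" "lin v" for u v
  proof -
    have "trace (u \<circ> v) = ctr (\<lambda>x y. tf (u (v x)) y)"
      using that by (simp add: trace_eq lin_comp)
    also have "\<dots> = ctr (\<lambda>x y. ctr (\<lambda>z w. tf w (v x) * tf (u z) y))"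
      by (rule ctr_cong, rule ctr_reconstruct(2)[symmetric])
        (simp_all add: lin_add lin_scale that)
    finally show ?thesis .
  qed
  show ?thesis
    unfolding *[OF u v] *[OF v u]
    by (subst ctr_swap) (intro ctr_cong, simp add: mult.commute tf_commute)
qed

lemma trace_rank1:
  assumes "\<And>x y. \<phi> (x + y) = \<phi> x + \<phi> y" "\<And>t x. \<phi> (scaleW t x) = t * \<phi> x"
  shows "trace (\<lambda>w. scaleW (\<phi> w) v) = \<phi> v"
proof -
  have "trace (\<lambda>w. scaleW (\<phi> w) v) = ctr (\<lambda>x y. tf (scaleW (\<phi> x) v) y)"
    by (subst trace_eq) (simp_all add: linear_W_iff assms W.scale_left_distrib)
  also have "\<dots> = ctr (\<lambda>x y. tf v y * \<phi> x)"
    by (rule ctr_cong) simp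
  also have "\<dots> = \<phi> v"
    by (rule ctr_reconstruct) (simp_all add: assms)
  finally show ?thesis .
qed

subsection \<open>The operators spanned by triple products\<close>

lemma op3_eq: "op3 x y z = (\<lambda>w. scaleW (tri w x y) z + scaleW (tri w y z) x + scaleW (tri w z x) y)"
  by (simp add: op3_def trilinear_form_eq)

lemma op3_apply: "op3 x y z w = scaleW (1 / 3) (scaleW (tf (crs x y) w) z + scaleW (tf (crs y z) w) x
    + scaleW (tf (crs z x) w) y)"
proof -
  have "tri w x y = 1 / 3 * tf (crs x y) w" for x y
    unfolding tri_symmetric(1)[of w x y] tri_symmetric(2)[of x w y] by (simp add: tri_def)
  then show ?thesis
    by (simp only: op3_eq W.scale_right_distrib W.scale_scale)
qed

lemma op3_symmetric: "op3 x y z = op3 y x z" "op3 x y z = op3 x z y"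
  unfolding op3_eq
  by (simp_all only: tri_symmetric(2)[of _ y x] tri_symmetric(2)[of _ z x] tri_symmetric(2)[of _ z y]
      add_ac)

lemma op3_linear [simp]:
  "op3 (x + x') y z = op3 x y z + op3 x' y z"
  "op3 y (x + x') z = op3 y x z + op3 y x' z"
  "op3 y z (x + x') = op3 y z x + op3 y z x'"
  "op3 (scaleW t x) y z = scaleE t (op3 x y z)"
  "op3 y (scaleW t x) z = scaleE t (op3 y x z)"
  "op3 y z (scaleW t x) = scaleE t (op3 y z x)"
  by (rule ext, simp add: op3_eq W.scale_left_distrib W.scale_right_distrib algebra_simps)+

lemma op3_zero [simp]: "op3 0 y z = 0" "op3 y 0 z = 0" "op3 y z 0 = 0"
  by (rule ext, simp add: op3_eq)+

lemma lin_op3: "lin (op3 x y z)"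
  unfolding linear_W_iff by (simp add: op3_eq W.scale_left_distrib W.scale_right_distrib algebra_simps)

lemma subspace_lin: "E.subspace {u. lin u}"
  by (auto intro!: E.subspaceI lin_ops)

lemma lin_opspan: "u \<in> opspan \<Longrightarrow> lin u"
  using E.span_minimal[OF _ subspace_lin, of "{op3 x y z | x y z. True}"] lin_op3
  unfolding opspan_def by blast

lemma op3_opspan: "op3 x y z \<in> opspan"
  unfolding opspan_def by (rule E.span_base) blast

lemma subspace_opspan: "E.subspace opspan"
  unfolding opspan_def by (rule E.subspace_span)

lemma opspan_induct [consumes 1, case_names zero add]:
  assumes "u \<in> opspan" "P 0"
    "\<And>t x y z v. v \<in> opspan \<Longrightarrow> P v \<Longrightarrow> P (scaleE t (op3 x y z) + v)"
  shows "P u"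
proof -
  have "u \<in> opspan \<and> P u"
    using assms(1)[unfolded opspan_def]
  proof (induction rule: E.span_induct_alt)
    case base
    show ?case
      by (intro conjI assms(2) E.subspace_0[OF subspace_opspan])
  next
    case (step t w v)
    then obtain x y z where "w = op3 x y z"
      by auto
    with step show ?case
      using assms(3) E.subspace_add[OF subspace_opspan] E.subspace_scale[OF subspace_opspan] op3_opspan
      by blast
  qed
  then show ?thesis ..
qed

lemma op3v_exists: "\<exists>a. op3 x y z = op3v a"
  by (rule exI[of _ "vector [x, y, z]"]) simp

subsection \<open>Sums over permutations as contractions\<close>

lemma S3_triples:
  "bij_betw (\<lambda>\<pi>. (\<pi> 1, \<pi> 2, \<pi> 3)) S3 {(1, 2, 3), (1, 3, 2), (2, 1, 3), (2, 3, 1), (3, 1, 2), (3, 2, 1)}"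
  (is "bij_betw ?f _ ?T")
proof (rule bij_betw_imageI)
  show "inj_on ?f S3"
  proof (rule inj_onI, rule ext)
    fix \<pi> \<rho> :: "3 \<Rightarrow> 3" and x :: 3
    assume "?f \<pi> = ?f \<rho>"
    then show "\<pi> x = \<rho> x"
      using exhaust_3[of x] by auto
  qed
  show "?f ` S3 = ?T"
  proof (intro equalityI subsetI)
    fix t assume "t \<in> ?f ` S3"
    then obtain \<pi> :: "3 \<Rightarrow> 3" where \<pi>: "\<pi> permutes UNIV" "t = (\<pi> 1, \<pi> 2, \<pi> 3)"
      by auto
    have "\<pi> 1 \<noteq> \<pi> 2" "\<pi> 1 \<noteq> \<pi> 3" "\<pi> 2 \<noteq> \<pi> 3"
      using permutes_inj[OF \<pi>(1)] by (simp_all add: inj_eq)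
    then show "t \<in> ?T"
      using exhaust_3[of "\<pi> 1"] exhaust_3[of "\<pi> 2"] exhaust_3[of "\<pi> 3"] unfolding \<pi>(2)
      by (elim disjE) simp_all
  next
    fix t assume "t \<in> ?T"
    then obtain i j k where t: "t = (i, j, k)" "i \<noteq> j" "i \<noteq> k" "j \<noteq> k"
      by auto
    define \<pi> :: "3 \<Rightarrow> 3" where "\<pi> x = (if x = 1 then i else if x = 2 then j else k)" for x
    have "inj \<pi>"
    proof (rule injI)
      fix x y assume "\<pi> x = \<pi> y"
      then show "x = y"
        using t exhaust_3[of x] exhaust_3[of y] by (auto simp: \<pi>_def split: if_splits)
    qed
    then have "\<pi> permutes UNIV"
      using finite_UNIV_inj_surj[of \<pi>] by (intro bij_imp_permutes) (simp_all add: bij_def)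
    then show "t \<in> ?f ` S3"
      using t by (intro image_eqI[of _ _ \<pi>]) (auto simp: \<pi>_def)
  qed
qed

lemma sum_S3: "(\<Sum>\<pi>\<in>S3. F (\<pi> 1) (\<pi> 2) (\<pi> 3))
    = F 1 2 3 + F 1 3 2 + F 2 1 3 + F 2 3 1 + F 3 1 2 + (F 3 2 1 :: 'v::ab_group_add)"
  using sum.reindex_bij_betw[OF S3_triples, of "\<lambda>(i, j, k). F i j k"] by (simp add: add_ac)

text \<open>The vector space axioms of the target are part of the predicate, so that one hypothesis
  suffices to interpret the scaling in each contraction lemma.\<close>

definition bilinW :: "('k \<Rightarrow> 'v \<Rightarrow> 'v) \<Rightarrow> (('k, 'o) albert \<Rightarrow> ('k, 'o) albert \<Rightarrow> 'v::ab_group_add) \<Rightarrow> bool"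
  where "bilinW s \<Phi> \<longleftrightarrow> vector_space s \<and>
    (\<forall>x y z. \<Phi> (x + y) z = \<Phi> x z + \<Phi> y z) \<and> (\<forall>x y z. \<Phi> z (x + y) = \<Phi> z x + \<Phi> z y) \<and>
    (\<forall>t x z. \<Phi> (scaleW t x) z = s t (\<Phi> x z)) \<and> (\<forall>t x z. \<Phi> z (scaleW t x) = s t (\<Phi> z x))"

lemma ctr_op3:
  assumes "bilinW s \<Phi>"
  shows "ctr (\<lambda>x y. \<Phi> y (op3 a b c x)) = s (1 / 3) (\<Phi> (crs a b) c + \<Phi> (crs b c) a + \<Phi> (crs c a) b)"
proof -
  note \<Phi> = assms[unfolded bilinW_def]
  interpret s: vector_space s
    using \<Phi> by blast
  have f: "ctr (\<lambda>x y. s (tf w x) (\<Phi> y d)) = \<Phi> w d" for w d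
    by (rule ctr_reconstruct(3)) (use \<Phi> in auto)
  have "ctr (\<lambda>x y. \<Phi> y (op3 a b c x)) = ctr (\<lambda>x y. s (1 / 3)
      (s (tf (crs a b) x) (\<Phi> y c) + s (tf (crs b c) x) (\<Phi> y a) + s (tf (crs c a) x) (\<Phi> y b)))"
    by (rule ctr_cong) (simp only: \<Phi> op3_apply)
  also have "\<dots> = s (1 / 3) (ctr (\<lambda>x y.
      s (tf (crs a b) x) (\<Phi> y c) + s (tf (crs b c) x) (\<Phi> y a) + s (tf (crs c a) x) (\<Phi> y b)))"
    by (rule ctr_hom[symmetric, where f = "s (1 / 3)"]) (simp_all add: s.scale_right_distrib)
  finally show ?thesis
    by (simp only: ctr_add f)
qed

text \<open>Each of the three ways to single out one factor comes from two permutations, and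
  \<open>op3\<close> carries the factor 1/3; hence \<open>6 = 2 * 3\<close>. The first form matches
  the indices in the first product, the second those in \<open>f'\<close> and in the second
  product.\<close>

lemma sum_S3_crs:
  assumes "bilinW s \<Phi>"
  shows "(\<Sum>\<pi>\<in>S3. \<Phi> (crs (a $ \<pi> 1) (a $ \<pi> 2)) (a $ \<pi> 3)) = s 6 (ctr (\<lambda>x y. \<Phi> y (op3v a x)))"
    and "(\<Sum>\<pi>\<in>S3. \<Phi> (crs (a $ \<pi> 2) (a $ \<pi> 3)) (a $ \<pi> 1)) = s 6 (ctr (\<lambda>x y. \<Phi> y (op3v a x)))"
proof -
  interpret s: vector_space s
    using assms bilinW_def by blast
  have two: "s 2 x = x + x" for x
    using s.scale_left_distrib[of 1 1 x] by simp
  have "s 6 (ctr (\<lambda>x y. \<Phi> y (op3v a x))) = s 2 (\<Phi> (crs (a $ 1) (a $ 2)) (a $ 3)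
      + \<Phi> (crs (a $ 2) (a $ 3)) (a $ 1) + \<Phi> (crs (a $ 3) (a $ 1)) (a $ 2))"
    unfolding ctr_op3[OF assms] by simp
  then show "(\<Sum>\<pi>\<in>S3. \<Phi> (crs (a $ \<pi> 1) (a $ \<pi> 2)) (a $ \<pi> 3)) = s 6 (ctr (\<lambda>x y. \<Phi> y (op3v a x)))"
    "(\<Sum>\<pi>\<in>S3. \<Phi> (crs (a $ \<pi> 2) (a $ \<pi> 3)) (a $ \<pi> 1)) = s 6 (ctr (\<lambda>x y. \<Phi> y (op3v a x)))"
    unfolding two
      sum_S3[of "\<lambda>i j k. \<Phi> (crs (a $ i) (a $ j)) (a $ k)"]
      sum_S3[of "\<lambda>i j k. \<Phi> (crs (a $ j) (a $ k)) (a $ i)"]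
      crs_commute[of "a $ 2" "a $ 1"] crs_commute[of "a $ 3" "a $ 2"] crs_commute[of "a $ 1" "a $ 3"]
    by (simp_all only: add_ac)
qed

lemma ctr_scaleE: "ctr (\<lambda>x y. scaleE t (\<phi> x y)) = scaleE t (ctr \<phi>)"
  by (rule ctr_hom[symmetric, where f = "scaleE t"]) (simp_all add: E.scale_right_distrib)

lemma bilinWE_I:
  assumes "\<And>x y z. \<Phi> (x + y) z = \<Phi> x z + \<Phi> y z" "\<And>x y z. \<Phi> z (x + y) = \<Phi> z x + \<Phi> z y"
    "\<And>t x z. \<Phi> (scaleW t x) z = scaleE t (\<Phi> x z)" "\<And>t x z. \<Phi> z (scaleW t x) = scaleE t (\<Phi> z x)"
  shows "bilinW scaleE \<Phi>"
  using assms E.vector_space_axioms by (simp add: bilinW_def)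

lemma bilinWK_I:
  assumes "\<And>x y z. \<Phi> (x + y) z = \<Phi> x z + \<Phi> y z" "\<And>x y z. \<Phi> z (x + y) = \<Phi> z x + \<Phi> z y"
    "\<And>t x z. \<Phi> (scaleW t x) z = t * (\<Phi> x z)" "\<And>t x z. \<Phi> z (scaleW t x) = t * (\<Phi> z x)"
  shows "bilinW (*) \<Phi>"
  using assms by (auto simp: bilinW_def algebra_simps intro!: vector_space.intro)

text \<open>\<open>F1\<close> and \<open>F2\<close> are the two products before normalisation, read
  as contractions: a tensor \<open>(a1 \<times> a2) \<otimes> a3\<close>, symmetrised, becomes the
  pair \<open>x'\<close>, \<open>u x\<close>. In \<open>F2\<close> the operator belonging to the
  decomposition of the identity is \<open>id\<close>, so its pair is just \<open>z'\<close>,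
  \<open>z\<close>.\<close>

definition F1 :: "('k, 'o) endo \<Rightarrow> ('k, 'o) endo \<Rightarrow> ('k, 'o) endo" where
  "F1 u v = ctr (\<lambda>x x'. ctr (\<lambda>y y'. op3 (crs x' y') (u x) (v y)))"

definition F2 :: "('k, 'o) endo \<Rightarrow> ('k, 'o) endo \<Rightarrow> ('k, 'o) endo" where
  "F2 u v = ctr (\<lambda>z z'. ctr (\<lambda>x x'. ctr (\<lambda>y y'. op3 (crs (crs (u x) (v y)) z) (crs x' y') z')))"

lemma F1_op3v:
  "(\<Sum>\<tau>\<in>S3. \<Sum>\<rho>\<in>S3. op3 (crs (crs (a $ \<tau> 1) (a $ \<tau> 2)) (crs (b $ \<rho> 1) (b $ \<rho> 2))) (a $ \<tau> 3) (b $ \<rho> 3))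
    = scaleE 36 (F1 (op3v a) (op3v b))"
proof -
  have "(\<Sum>\<rho>\<in>S3. op3 (crs y (crs (b $ \<rho> 1) (b $ \<rho> 2))) x (b $ \<rho> 3))
      = scaleE 6 (ctr (\<lambda>z z'. op3 (crs y z') x (op3v b z)))" for x y
    by (rule sum_S3_crs(1)[of scaleE "\<lambda>z' z. op3 (crs y z') x z"]) (rule bilinWE_I; simp)
  moreover have "(\<Sum>\<tau>\<in>S3. scaleE 6 (ctr (\<lambda>z z'. op3 (crs (crs (a $ \<tau> 1) (a $ \<tau> 2)) z') (a $ \<tau> 3) (op3v b z))))
      = scaleE 6 (ctr (\<lambda>x x'. scaleE 6 (ctr (\<lambda>z z'. op3 (crs x' z') (op3v a x) (op3v b z)))))"
    by (rule sum_S3_crs(1)[of scaleE "\<lambda>x' x. scaleE 6 (ctr (\<lambda>z z'. op3 (crs x' z') x (op3v b z)))"])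
      (rule bilinWE_I; simp add: ctr_add ctr_scaleE E.scale_right_distrib E.scale_left_commute)
  ultimately show ?thesis
    by (simp add: F1_def ctr_scaleE)
qed

text \<open>The right side does not mention \<open>xs\<close>: this is the independence of the
  decomposition. The factor is \<open>6 ^ 3\<close>, one 6 for each of the three sums over
  permutations.\<close>

lemma F2_op3v:
  assumes id: "id = (\<Sum>x\<leftarrow>xs. op3v x)"
  shows "(\<Sum>x\<leftarrow>xs. \<Sum>\<sigma>\<in>S3. \<Sum>\<tau>\<in>S3. \<Sum>\<rho>\<in>S3.
      op3 (crs (crs (a $ \<tau> 1) (b $ \<rho> 1)) (x $ \<sigma> 1))
        (crs (crs (a $ \<tau> 2) (a $ \<tau> 3)) (crs (b $ \<rho> 2) (b $ \<rho> 3))) (crs (x $ \<sigma> 2) (x $ \<sigma> 3)))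
    = scaleE 216 (F2 (op3v a) (op3v b))"
proof -
  define \<Psi> where "\<Psi> z' z = (\<Sum>\<tau>\<in>S3. \<Sum>\<rho>\<in>S3. op3 (crs (crs (a $ \<tau> 1) (b $ \<rho> 1)) z)
      (crs (crs (a $ \<tau> 2) (a $ \<tau> 3)) (crs (b $ \<rho> 2) (b $ \<rho> 3))) z')" for z' z
  have "(\<Sum>\<rho>\<in>S3. op3 (crs (crs x (b $ \<rho> 1)) z) (crs x' (crs (b $ \<rho> 2) (b $ \<rho> 3))) z')
      = scaleE 6 (ctr (\<lambda>y y'. op3 (crs (crs x (op3v b y)) z) (crs x' y') z'))" for x x' z z'
    by (rule sum_S3_crs(2)[of scaleE "\<lambda>y' y. op3 (crs (crs x y) z) (crs x' y') z'"])
      (rule bilinWE_I; simp)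
  moreover have "(\<Sum>\<tau>\<in>S3. scaleE 6 (ctr (\<lambda>y y'. op3 (crs (crs (a $ \<tau> 1) (op3v b y)) z)
        (crs (crs (a $ \<tau> 2) (a $ \<tau> 3)) y') z')))
      = scaleE 6 (ctr (\<lambda>x x'. scaleE 6 (ctr (\<lambda>y y'. op3 (crs (crs (op3v a x) (op3v b y)) z) (crs x' y') z'))))"
    for z z'
    by (rule sum_S3_crs(2)[of scaleE "\<lambda>x' x. scaleE 6 (ctr (\<lambda>y y'. op3 (crs (crs x (op3v b y)) z) (crs x' y') z'))"])
      (rule bilinWE_I; simp add: ctr_add ctr_scaleE E.scale_right_distrib E.scale_left_commute)
  ultimately have \<Psi>: "\<Psi> z' z
      = scaleE 36 (ctr (\<lambda>x x'. ctr (\<lambda>y y'. op3 (crs (crs (op3v a x) (op3v b y)) z) (crs x' y') z')))" for z z'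
    by (simp add: \<Psi>_def ctr_scaleE)
  have bil: "bilinW scaleE \<Psi>"
    by (rule bilinWE_I; simp add: \<Psi> ctr_add ctr_scaleE E.scale_right_distrib E.scale_left_commute)
  \<comment> \<open>By additivity of \<open>\<Psi>\<close>, the list enters only through the sum of
    its operators, which is \<open>id\<close> for \<open>xs\<close>.\<close>
  have \<Psi>_sum: "(\<Sum>x\<leftarrow>ys. ctr (\<lambda>z z'. \<Psi> z' (op3v x z))) = ctr (\<lambda>z z'. \<Psi> z' ((\<Sum>x\<leftarrow>ys. op3v x) z))" for ys
  proof (induction ys)
    case Nil
    have "\<Psi> z 0 = 0" for z
      by (simp add: \<Psi>_def)
    then show ?case
      by (simp add: ctr_def flip: zero_fun_def)
  next
    case (Cons y ys)
    have "\<Psi> z' ((u + v) z) = \<Psi> z' (u z) + \<Psi> z' (v z)" for u v :: "('k, 'o) endo" and z z'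
      using bil by (simp add: bilinW_def)
    with Cons show ?case
      by (simp only: list.map sum_list.Cons ctr_add)
  qed
  have "(\<Sum>\<sigma>\<in>S3. \<Psi> (crs (x $ \<sigma> 2) (x $ \<sigma> 3)) (x $ \<sigma> 1)) = scaleE 6 (ctr (\<lambda>z z'. \<Psi> z' (op3v x z)))" for x
    by (rule sum_S3_crs(2)[OF bil])
  then have "(\<Sum>x\<leftarrow>xs. \<Sum>\<sigma>\<in>S3. \<Psi> (crs (x $ \<sigma> 2) (x $ \<sigma> 3)) (x $ \<sigma> 1))
      = (\<Sum>x\<leftarrow>xs. scaleE 6 (ctr (\<lambda>z z'. \<Psi> z' (op3v x z))))"
    by simp
  also have "\<dots> = scaleE 6 (\<Sum>x\<leftarrow>xs. ctr (\<lambda>z z'. \<Psi> z' (op3v x z)))"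
    by (induction xs) (simp_all add: E.scale_right_distrib del: plus_fun_apply zero_fun_apply scaleE_apply)
  also have "\<dots> = scaleE 6 (ctr (\<lambda>z z'. \<Psi> z' z))"
    by (simp add: \<Psi>_sum flip: id)
  also have "\<dots> = scaleE 216 (F2 (op3v a) (op3v b))"
    by (simp add: \<Psi> F2_def ctr_scaleE)
  finally show ?thesis
    by (simp add: \<Psi>_def)
qed

text \<open>The two sums over permutations contribute \<open>6 * 6\<close> and the two trilinear
  forms \<open>1/3 * 1/3\<close>, whence 4. So \<open>f'\<close> is a multiple of the trace form on
  operators and extends bilinearly.\<close>

lemma f'_eq: "f' a b = 4 * trace (op3v a \<circ> op3v b)"
proof -
  have t: "tri x y z = 1 / 3 * tf (crs y z) x" for x y z
    unfolding tri_symmetric(1)[of x y z] tri_symmetric(2)[of y x z] by (simp add: tri_def)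
  have "(\<Sum>\<rho>\<in>S3. tf (crs (b $ \<rho> 2) (b $ \<rho> 3)) x * tf y (b $ \<rho> 1)) = 6 * tf y (op3v b x)" for x y
  proof -
    have "(\<Sum>\<rho>\<in>S3. tf (crs (b $ \<rho> 2) (b $ \<rho> 3)) x * tf y (b $ \<rho> 1))
        = 6 * ctr (\<lambda>z z'. tf z' x * tf y (op3v b z))"
      by (rule sum_S3_crs(2)[of "(*)" "\<lambda>z' z. tf z' x * tf y z"])
        (rule bilinWK_I; simp add: algebra_simps)
    also have "ctr (\<lambda>z z'. tf z' x * tf y (op3v b z)) = tf y (op3v b x)"
      by (rule ctr_reconstruct) (simp_all add: lin_add lin_scale lin_op3)
    finally show ?thesis .
  qed
  moreover have "(\<Sum>\<tau>\<in>S3. 6 * tf (crs (a $ \<tau> 2) (a $ \<tau> 3)) (op3v b (a $ \<tau> 1)))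
      = 6 * ctr (\<lambda>z z'. 6 * tf z' (op3v b (op3v a z)))"
    by (rule sum_S3_crs(2)[of "(*)" "\<lambda>z' z. 6 * tf z' (op3v b z)"])
      (rule bilinWK_I; simp add: lin_add lin_scale lin_op3 algebra_simps)
  moreover have "ctr (\<lambda>z z'. 6 * tf z' (op3v b (op3v a z))) = 6 * trace (op3v b \<circ> op3v a)"
    by (simp add: trace_eq lin_comp lin_op3 tf_commute ctr_hom[of "\<lambda>s. 6 * s"] distrib_left)
  ultimately have "(\<Sum>\<tau>\<in>S3. \<Sum>\<rho>\<in>S3. tf (crs (b $ \<rho> 2) (b $ \<rho> 3)) (a $ \<tau> 1) * tf (crs (a $ \<tau> 2) (a $ \<tau> 3)) (b $ \<rho> 1))
      = 36 * trace (op3v a \<circ> op3v b)"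
    by (simp add: trace_comp_commute[of "op3v b" "op3v a"] lin_op3)
  moreover have "f' a b = 1 / 9 * (\<Sum>\<tau>\<in>S3. \<Sum>\<rho>\<in>S3.
      tf (crs (b $ \<rho> 2) (b $ \<rho> 3)) (a $ \<tau> 1) * tf (crs (a $ \<tau> 2) (a $ \<tau> 3)) (b $ \<rho> 1))"
    unfolding f'_def trilinear_form_eq t by (simp add: sum_distrib_left)
  ultimately have "9 * f' a b = 9 * (4 * trace (op3v a \<circ> op3v b))"
    by (simp add: mult.commute)
  then show ?thesis
    by (metis mult_left_cancel small_numerals_nonzero(4))
qed

lemmas fun_applies = plus_fun_apply zero_fun_apply scaleE_apply

declare fun_applies [simp del]

lemma F1_linear:
  "F1 (u + u') v = F1 u v + F1 u' v" "F1 v (u + u') = F1 v u + F1 v u'"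
  "F1 (scaleE t u) v = scaleE t (F1 u v)" "F1 v (scaleE t u) = scaleE t (F1 v u)"
  by (simp_all add: F1_def fun_applies(1,3) ctr_add ctr_scaleE)

lemma F2_linear:
  "F2 (u + u') v = F2 u v + F2 u' v" "F2 v (u + u') = F2 v u + F2 v u'"
  "F2 (scaleE t u) v = scaleE t (F2 u v)" "F2 v (scaleE t u) = scaleE t (F2 v u)"
  by (simp_all add: F2_def fun_applies(1,3) ctr_add ctr_scaleE)

lemma F1_commute: "F1 u v = F1 v u"
proof -
  have eq: "op3 (crs x' y') p q = op3 (crs y' x') q p" for x' y' p q
    by (simp only: crs_commute[of y' x'] op3_symmetric(2)[of _ q p])
  show ?thesis
    unfolding F1_def by (subst ctr_swap) (intro ctr_cong, rule eq)
qed

lemma F2_commute: "F2 u v = F2 v u"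
proof -
  have eq: "op3 (crs (crs p q) z) (crs x' y') z' = op3 (crs (crs q p) z) (crs y' x') z'" for x' y' p q z z'
    by (simp only: crs_commute[of y' x'] crs_commute[of q p])
  show ?thesis
    unfolding F2_def by (rule ctr_cong, subst ctr_swap) (intro ctr_cong, rule eq)
qed

lemma ctr_in_subspace:
  "E.subspace S \<Longrightarrow> (\<And>x y. \<phi> x y \<in> S) \<Longrightarrow> ctr \<phi> \<in> S"
  unfolding ctr_def by (intro E.subspace_add E.subspace_sum) auto

lemma F1_opspan: "F1 u v \<in> opspan"
  unfolding F1_def by (intro ctr_in_subspace subspace_opspan op3_opspan)

lemma F2_opspan: "F2 u v \<in> opspan"
  unfolding F2_def by (intro ctr_in_subspace subspace_opspan op3_opspan)


subsection \<open>The group\<close>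

lemma G_lin: "g \<in> G \<Longrightarrow> lin g"
  and G_bij: "g \<in> G \<Longrightarrow> bij g"
  and G_det: "g \<in> G \<Longrightarrow> det (g x) = det x"
  by (simp_all add: G_def)

lemma G_inv [simp]: "g \<in> G \<Longrightarrow> g (inv g x) = x" "g \<in> G \<Longrightarrow> inv g (g x) = x"
  using G_bij by (simp_all add: bij_is_surj surj_f_inv_f bij_is_inj inv_f_f)

lemma G_inv_in: assumes "g \<in> G" shows "inv g \<in> G"
proof -
  have "inv g (x + y) = inv g x + inv g y" for x y
    using assms lin_add[OF G_lin[OF assms], of "inv g x" "inv g y"] by (metis G_inv)
  moreover have "inv g (scaleW t x) = scaleW t (inv g x)" for t x
    using assms lin_scale[OF G_lin[OF assms], of t "inv g x"] by (metis G_inv)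
  moreover have "det (inv g x) = det x" for x
    using assms by (metis G_inv(1) G_det)
  ultimately show ?thesis
    using bij_imp_bij_inv[OF G_bij[OF assms]] by (simp add: G_def linear_W_iff)
qed

lemma G_comp: "g \<in> G \<Longrightarrow> h \<in> G \<Longrightarrow> g \<circ> h \<in> G"
  by (simp add: G_def lin_comp bij_comp)

lemma GI:
  assumes "\<And>x y. g (x + y) = g x + g y" "\<And>t x. g (scaleW t x) = scaleW t (g x)"
    "\<And>x. det (g x) = det x" "\<And>x. g (h x) = x" "\<And>x. h (g x) = x"
  shows "g \<in> G" "inv g = h"
proof -
  have "bij g"
    using assms(4,5) by (intro o_bij[of h]) (auto simp: fun_eq_iff)
  then show "g \<in> G"
    using assms(1-3) by (simp add: G_def linear_W_iff)
  show "inv g = h"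
    using assms(4,5) by (intro inv_unique_comp) (auto simp: fun_eq_iff)
qed

lemma tri_G: assumes "g \<in> G" shows "tri (g x) (g y) (g z) = tri x y z"
proof -
  note pol = polarize_symmetric_trilinear[of tri, OF tri_symmetric tri_linear(1)]
  have "6 * tri (g x) (g y) (g z) = 6 * tri x y z"
    unfolding pol tri_self lin_add[OF G_lin[OF assms], symmetric] G_det[OF assms] ..
  then show ?thesis
    by (metis mult_left_cancel small_numerals_nonzero(2))
qed

text \<open>The contragredient of \<open>g\<close>, that is, the adjoint of \<open>inv g\<close> for
  \<open>tf\<close>. The elements of \<open>G\<close> need not preserve \<open>tf\<close>, so the
  second leg of a dual pair transforms by \<open>gt g\<close>.\<close>

definition gt :: "('k, 'o) endo \<Rightarrow> ('k, 'o) endo" where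
  "gt g y = ctr (\<lambda>x x'. scaleW (tf y (inv g x)) x')"

lemma tf_ctr: "tf (ctr \<phi>) z = ctr (\<lambda>x y. tf (\<phi> x y) z)"
  by (rule ctr_hom[of "\<lambda>w. tf w z"]) simp_all

lemma tf_gt: assumes "g \<in> G" shows "tf (gt g y) x = tf y (inv g x)"
proof -
  have "tf (gt g y) x = ctr (\<lambda>z z'. tf z' x * tf y (inv g z))"
    by (simp add: gt_def tf_ctr mult.commute)
  also have "\<dots> = tf y (inv g x)"
    by (rule ctr_reconstruct(2)) (simp_all add: lin_add lin_scale G_lin G_inv_in assms)
  finally show ?thesis .
qed

lemma gt_add: "g \<in> G \<Longrightarrow> gt g (x + y) = gt g x + gt g y"
  and gt_scale: "g \<in> G \<Longrightarrow> gt g (scaleW t x) = scaleW t (gt g x)"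
  by (rule tf_ext, simp add: tf_gt)+

lemma gt_crs: assumes "g \<in> G" shows "gt g (crs x y) = crs (g x) (g y)"
proof (rule tf_ext)
  fix z
  have "tf (crs u v) w = 3 * tri u v w" for u v w
    by (simp add: tri_def)
  then show "tf (gt g (crs x y)) z = tf (crs (g x) (g y)) z"
    using assms tri_G[OF assms, of x y "inv g z"] by (simp add: tf_gt)
qed

text \<open>By the adjoint identity, \<open>3 * det (crs x x)\<close> is
  \<open>tf (scaleW (det x) x) (crs x x)\<close>, and
  \<open>tf x (crs x x) = 3 * det x\<close>.\<close>

lemma det_crs_self: "det (crs x x) = (det x)\<^sup>2"
  unfolding tri_self[symmetric] tri_def[of "crs x x"] crs_crs_self
  by (simp add: tri_self[symmetric] tri_def power2_eq_square tf_commute[of x "crs x x"])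

lemma infinite_nonroots:
  assumes "(p :: 'k poly) \<noteq> 0"
  shows "infinite {t. poly p t \<noteq> 0}"
proof -
  have "infinite (UNIV - {t. poly p t = 0})"
    using assms by (intro Diff_infinite_finite poly_roots_finite infinite_UNIV_alg_closed)
  moreover have "UNIV - {t. poly p t = 0} = {t. poly p t \<noteq> 0}"
    by auto
  ultimately show ?thesis
    by simp
qed

text \<open>With \<open>x = crs y y\<close> one has \<open>crs x x = scaleW (det y) y\<close>.
  Applying \<open>gt g\<close> and the adjoint identity at \<open>g x\<close> proves the claim up to
  the factor \<open>(det y)\<^sup>2\<close>, which can be cancelled when
  \<open>det y \<noteq> 0\<close>; a line through \<open>y\<close> in the direction \<open>I\<close>
  covers the remaining \<open>y\<close>.\<close>

lemma crs_gt_self: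
  assumes g: "g \<in> G"
  shows "crs (gt g y) (gt g y) = g (crs y y)"
proof -
  have nz: "crs (gt g y) (gt g y) = g (crs y y)" if "det y \<noteq> 0" for y
  proof -
    let ?d = "det y" and ?x = "crs y y"
    have "scaleW ?d (gt g y) = crs (g ?x) (g ?x)"
      using gt_crs[OF g, of ?x ?x] by (simp add: crs_crs_self gt_scale g)
    then have "crs (scaleW ?d (gt g y)) (scaleW ?d (gt g y)) = scaleW (?d\<^sup>2) (g ?x)"
      using crs_crs_self[of "g ?x"] by (simp add: G_det g det_crs_self)
    then have "scaleW (?d\<^sup>2) (crs (gt g y) (gt g y)) = scaleW (?d\<^sup>2) (g ?x)"
      by (simp add: power2_eq_square)
    then show ?thesis
      using that by (metis W.scale_cancel_left power_not_zero)
  qed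
  \<comment> \<open>Along \<open>y + scaleW t I\<close> the difference of both sides is a quadratic
    polynomial in \<open>t\<close> with coefficients \<open>c\<close>, and \<open>det\<close> is the
    monic cubic \<open>p\<close>. So the difference vanishes for infinitely many \<open>t\<close>,
    and \<open>c 0\<close> is its value at \<open>y\<close>.\<close>
  define I :: "('k, 'o) albert" where "I = (1, 1, 1, 0, 0, 0)"
  define c where "c i = [crs (gt g y) (gt g y) - g (crs y y),
    scaleW 2 (crs (gt g y) (gt g I)) - scaleW 2 (g (crs y I)),
    crs (gt g I) (gt g I) - g (crs I I)] ! i" for i
  define p where "p = [:det y, 3 * tri y y I, 3 * tri y I I, 1:]"
  have two: "scaleW 2 x = x + x" for x
    using W.scale_left_distrib[of 1 1 x] by simp
  have yI: "(crs (gt g (y + scaleW t I)) (gt g (y + scaleW t I)) - g (crs (y + scaleW t I) (y + scaleW t I)))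
      = (\<Sum>i<3. scaleW (t ^ i) (c i))" for t
    by (simp add: eval_nat_numeral c_def gt_add gt_scale g lin_add lin_scale G_lin crs_commute[of "gt g I" "gt g y"]
        crs_commute[of I y] two W.scale_right_distrib W.scale_right_diff_distrib)
  have "tri I I I = 1"
    by (simp add: tri_self det_eq I_def)
  moreover have "tri I y y = tri y y I" "tri y I y = tri y y I" "tri I y I = tri y I I" "tri I I y = tri y I I"
    by (metis tri_symmetric)+
  ultimately have det_p: "det (y + scaleW t I) = poly p t" for t
    unfolding tri_self[symmetric] p_def by (simp add: algebra_simps)
  have "\<forall>i<3. c i \<in> {0}"
  proof (rule W.poly_curve_coeffs_in_subspace)
    show "infinite {t. poly p t \<noteq> 0}"
      by (rule infinite_nonroots) (simp add: p_def)
    show "(\<Sum>i<3. scaleW (t ^ i) (c i)) \<in> {0}" if "t \<in> {t. poly p t \<noteq> 0}" for t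
      using that nz[of "y + scaleW t I"] unfolding yI[symmetric] by (simp add: det_p)
  qed (simp add: W.subspace_single_0)
  then have "c 0 = 0"
    by simp
  then show ?thesis
    by (simp add: c_def)
qed

lemma crs_gt:
  assumes g: "g \<in> G"
  shows "crs (gt g x) (gt g y) = g (crs x y)"
proof -
  have two: "scaleW 2 x = x + x" for x
    using W.scale_left_distrib[of 1 1 x] by simp
  have "scaleW 2 (crs (gt g x) (gt g y)) = scaleW 2 (g (crs x y))"
    using crs_gt_self[OF g, of "x + y"] crs_gt_self[OF g, of x] crs_gt_self[OF g, of y]
    by (simp add: gt_add g lin_add G_lin crs_commute[of y x] crs_commute[of "gt g y" "gt g x"] two algebra_simps)
  then show ?thesis
    by (metis W.scale_cancel_left two_nonzero)
qed

text \<open>The canonical element is invariant under \<open>g\<close> on one leg and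
  \<open>gt g\<close> on the other. Both assignments are needed, since \<open>ctr\<close>
  distinguishes its legs.\<close>

lemma ctr_G:
  assumes g: "g \<in> G" and \<Phi>: "bilinW s \<Phi>"
  shows "ctr (\<lambda>x y. \<Phi> (g x) (gt g y)) = ctr \<Phi>" "ctr (\<lambda>x y. \<Phi> (gt g x) (g y)) = ctr \<Phi>"
proof -
  note \<Phi> = \<Phi>[unfolded bilinW_def]
  interpret s: vector_space s
    using \<Phi> by blast
  note lg = lin_add[OF G_lin[OF g]] lin_scale[OF G_lin[OF g]] lin_add[OF G_lin[OF G_inv_in[OF g]]]
    lin_scale[OF G_lin[OF G_inv_in[OF g]]]
  have l: "\<Phi> x (gt g y) = ctr (\<lambda>z w. s (tf y (inv g z)) (\<Phi> x w))" for x y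
  proof -
    have "ctr (\<lambda>z w. s (tf (gt g y) z) (\<Phi> x w)) = \<Phi> x (gt g y)"
      by (rule ctr_reconstruct(3)) (use \<Phi> in auto)
    then show ?thesis
      by (simp add: tf_gt g)
  qed
  have "ctr (\<lambda>x y. \<Phi> (g x) (gt g y)) = ctr (\<lambda>x y. ctr (\<lambda>z w. s (tf y (inv g z)) (\<Phi> (g x) w)))"
    by (simp only: l)
  also have "\<dots> = ctr (\<lambda>z w. ctr (\<lambda>x y. s (tf y (inv g z)) (\<Phi> (g x) w)))"
    by (rule ctr_swap)
  also have "\<dots> = ctr (\<lambda>z w. \<Phi> (g (inv g z)) w)"
    by (rule ctr_cong, rule ctr_reconstruct(2)) (use \<Phi> in \<open>auto simp: lg\<close>)
  finally show "ctr (\<lambda>x y. \<Phi> (g x) (gt g y)) = ctr \<Phi>"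
    by (simp add: g)
  have r: "\<Phi> (gt g x) y = ctr (\<lambda>z w. s (tf x (inv g w)) (\<Phi> z y))" for x y
  proof -
    have "ctr (\<lambda>z w. s (tf (gt g x) w) (\<Phi> z y)) = \<Phi> (gt g x) y"
      by (rule ctr_reconstruct(4)) (use \<Phi> in auto)
    then show ?thesis
      by (simp add: tf_gt g)
  qed
  have "ctr (\<lambda>x y. \<Phi> (gt g x) (g y)) = ctr (\<lambda>x y. ctr (\<lambda>z w. s (tf x (inv g w)) (\<Phi> z (g y))))"
    by (simp only: r)
  also have "\<dots> = ctr (\<lambda>z w. ctr (\<lambda>x y. s (tf x (inv g w)) (\<Phi> z (g y))))"
    by (rule ctr_swap)
  also have "\<dots> = ctr (\<lambda>z w. \<Phi> z (g (inv g w)))"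
    by (rule ctr_cong, rule ctr_reconstruct(1)) (use \<Phi> in \<open>auto simp: lg\<close>)
  finally show "ctr (\<lambda>x y. \<Phi> (gt g x) (g y)) = ctr \<Phi>"
    by (simp add: g)
qed

lemma conj_linear:
  assumes "g \<in> G"
  shows "conj_action g (u + v) = conj_action g u + conj_action g v"
    and "conj_action g (scaleE t u) = scaleE t (conj_action g u)"
    and "conj_action g 0 = 0"
  using lin_zero[OF G_lin[OF assms]]
  by (simp_all add: conj_action_def fun_eq_iff fun_applies lin_add lin_scale G_lin assms)

lemma conj_op3: assumes g: "g \<in> G" shows "conj_action g (op3 x y z) = op3 (g x) (g y) (g z)"
proof
  fix w
  have "tri (inv g w) p q = tri w (g p) (g q)" for p q
    using tri_G[OF g, of "inv g w" p q] by (simp add: g)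
  then show "conj_action g (op3 x y z) w = op3 (g x) (g y) (g z) w"
    by (simp add: conj_action_def op3_eq lin_add lin_scale G_lin g)
qed

lemma conj_ctr: "g \<in> G \<Longrightarrow> conj_action g (ctr \<phi>) = ctr (\<lambda>x y. conj_action g (\<phi> x y))"
  by (rule ctr_hom[of "conj_action g"]) (simp_all add: conj_linear)

lemma conj_id: "g \<in> G \<Longrightarrow> conj_action g id = id"
  by (simp add: conj_action_def fun_eq_iff)

lemma conj_comp: "g \<in> G \<Longrightarrow> conj_action g u \<circ> conj_action g v = conj_action g (u \<circ> v)"
  by (simp add: conj_action_def fun_eq_iff)

lemma conj_inv: "g \<in> G \<Longrightarrow> conj_action (inv g) (conj_action g u) = u"
  by (simp add: conj_action_def fun_eq_iff inv_inv_eq G_bij)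

lemma lin_conj: "g \<in> G \<Longrightarrow> lin u \<Longrightarrow> lin (conj_action g u)"
  unfolding conj_action_def by (simp add: lin_comp G_lin G_inv_in)

lemma trace_conj: assumes "g \<in> G" "lin u" shows "trace (conj_action g u) = trace u"
proof -
  have "trace (g \<circ> (u \<circ> inv g)) = trace ((u \<circ> inv g) \<circ> g)"
    using assms by (simp add: trace_comp_commute lin_comp G_lin G_inv_in)
  moreover have "(u \<circ> inv g) \<circ> g = u"
    using assms by (simp add: fun_eq_iff)
  ultimately show ?thesis
    by (simp add: conj_action_def comp_assoc)
qed

lemma conj_opspan: assumes "g \<in> G" "u \<in> opspan" shows "conj_action g u \<in> opspan"
  using assms(2)
proof (induction rule: opspan_induct)
  case zero
  then show ?case
    by (simp add: conj_linear assms E.subspace_0 subspace_opspan)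
next
  case (add t x y z v)
  then show ?case
    by (simp add: conj_linear assms conj_op3 E.subspace_add E.subspace_scale subspace_opspan op3_opspan)
qed

lemma conj_\<sigma>V: "g \<in> G \<Longrightarrow> u \<in> \<sigma>V \<Longrightarrow> conj_action g u \<in> \<sigma>V"
  by (simp add: \<sigma>V_def conj_opspan trace_conj lin_opspan)

text \<open>Replacing each dual pair by its image puts \<open>g\<close> on the legs fed into the
  operators and \<open>gt g\<close> on \<open>x'\<close> and \<open>y'\<close>; the cross product
  then turns two contragredient vectors into \<open>g\<close> of a vector, so all three arguments of
  \<open>op3\<close> carry \<open>g\<close>.\<close>

lemma F1_equivariant:
  assumes g: "g \<in> G" and u: "lin u" and v: "lin v"
  shows "F1 (conj_action g u) (conj_action g v) = conj_action g (F1 u v)"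
proof -
  let ?u = "conj_action g u" and ?v = "conj_action g v"
  note lins = lin_add[OF u] lin_scale[OF u] lin_add[OF v] lin_scale[OF v]
    lin_add[OF lin_conj[OF g u]] lin_scale[OF lin_conj[OF g u]]
    lin_add[OF lin_conj[OF g v]] lin_scale[OF lin_conj[OF g v]]
  have ap: "?u (g x) = g (u x)" "?v (g x) = g (v x)" for x
    by (simp_all add: conj_action_def g)
  have inner: "ctr (\<lambda>y y'. op3 (crs x' y') p (?v y)) = ctr (\<lambda>y y'. op3 (crs x' (gt g y')) p (g (v y)))" for x' p
    using ctr_G(1)[OF g, of scaleE "\<lambda>y y'. op3 (crs x' y') p (?v y)"]
    by (simp add: ap bilinWE_I lins)
  have "F1 ?u ?v = ctr (\<lambda>x x'. ctr (\<lambda>y y'. op3 (crs x' (gt g y')) (?u x) (g (v y))))"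
    unfolding F1_def inner ..
  also have "\<dots> = ctr (\<lambda>x x'. ctr (\<lambda>y y'. op3 (crs (gt g x') (gt g y')) (?u (g x)) (g (v y))))"
    by (rule ctr_G(1)[OF g, symmetric, of scaleE "\<lambda>x x'. ctr (\<lambda>y y'. op3 (crs x' (gt g y')) (?u x) (g (v y)))"])
      (rule bilinWE_I; simp add: lins ctr_add ctr_scaleE)
  also have "\<dots> = conj_action g (F1 u v)"
    unfolding F1_def by (simp add: conj_ctr g conj_op3 ap crs_gt)
  finally show ?thesis .
qed

lemma F2_equivariant:
  assumes g: "g \<in> G" and u: "lin u" and v: "lin v"
  shows "F2 (conj_action g u) (conj_action g v) = conj_action g (F2 u v)"
proof -
  let ?u = "conj_action g u" and ?v = "conj_action g v"
  note lins = lin_add[OF u] lin_scale[OF u] lin_add[OF v] lin_scale[OF v]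
    lin_add[OF lin_conj[OF g u]] lin_scale[OF lin_conj[OF g u]]
    lin_add[OF lin_conj[OF g v]] lin_scale[OF lin_conj[OF g v]]
  have ap: "?u (g x) = g (u x)" "?v (g x) = g (v x)" for x
    by (simp_all add: conj_action_def g)
  let ?h = "\<lambda>z z' x x' y y'. op3 (crs (crs x y) z) (crs x' y') z'"
  have inner: "ctr (\<lambda>y y'. ?h z z' p x' (?v y) y') = ctr (\<lambda>y y'. ?h z z' p x' (g (v y)) (gt g y'))" for x' p z z'
    using ctr_G(1)[OF g, of scaleE "\<lambda>y y'. ?h z z' p x' (?v y) y'"]
    by (simp add: ap bilinWE_I lins)
  have middle: "ctr (\<lambda>x x'. ctr (\<lambda>y y'. ?h z z' (?u x) x' (?v y) y'))
      = ctr (\<lambda>x x'. ctr (\<lambda>y y'. ?h z z' (g (u x)) (gt g x') (g (v y)) (gt g y')))" for z z'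
    unfolding inner
    using ctr_G(1)[OF g, of scaleE "\<lambda>x x'. ctr (\<lambda>y y'. ?h z z' (?u x) x' (g (v y)) (gt g y'))"]
    by (simp add: ap bilinWE_I lins ctr_add ctr_scaleE)
  have "F2 ?u ?v = ctr (\<lambda>z z'. ctr (\<lambda>x x'. ctr (\<lambda>y y'. ?h z z' (g (u x)) (gt g x') (g (v y)) (gt g y'))))"
    unfolding F2_def middle ..
  \<comment> \<open>For the outer pair the roles are reversed: \<open>crs (u x) (v y)\<close> is
    contragredient, so \<open>z\<close> must be moved by \<open>gt g\<close> for the next cross
    product to carry \<open>g\<close>.\<close>
  also have "\<dots> = ctr (\<lambda>z z'. ctr (\<lambda>x x'. ctr (\<lambda>y y'. ?h (gt g z) (g z') (g (u x)) (gt g x') (g (v y)) (gt g y'))))"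
    by (rule ctr_G(2)[OF g, symmetric, of scaleE
          "\<lambda>z z'. ctr (\<lambda>x x'. ctr (\<lambda>y y'. ?h z z' (g (u x)) (gt g x') (g (v y)) (gt g y')))"])
      (rule bilinWE_I; simp add: ctr_add ctr_scaleE)
  also have "\<dots> = conj_action g (F2 u v)"
    unfolding F2_def by (simp add: conj_ctr g conj_op3 crs_gt flip: gt_crs[OF g])
  finally show ?thesis .
qed

subsection \<open>Unipotent elements of the group\<close>

text \<open>
  \<open>Uij\<close> is the congruence \<open>x \<mapsto> g x g*\<close> of hermitian matrices by the elementary matrix \<open>g\<close> that adds a
  multiple of row \<open>i\<close> to row \<open>j\<close>.
\<close>

fun U12 :: "'o \<Rightarrow> ('k, 'o) endo" where
  "U12 p (\<alpha>1, \<alpha>2, \<alpha>3, a, b, c)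
    = (\<alpha>1, \<alpha>2 + ip p c + \<alpha>1 * N p, \<alpha>3, a + cnj p \<bullet> cnj b, b, c + \<alpha>1 *s p)"

fun U23 :: "'o \<Rightarrow> ('k, 'o) endo" where
  "U23 p (\<alpha>1, \<alpha>2, \<alpha>3, a, b, c)
    = (\<alpha>1, \<alpha>2, \<alpha>3 + ip p a + \<alpha>2 * N p, a + \<alpha>2 *s p, b + cnj p \<bullet> cnj c, c)"

fun U13 :: "'o \<Rightarrow> ('k, 'o) endo" where
  "U13 p (\<alpha>1, \<alpha>2, \<alpha>3, a, b, c)
    = (\<alpha>1, \<alpha>2, \<alpha>3 + ip p b + \<alpha>1 * N p, a + cnj c \<bullet> cnj p, b + \<alpha>1 *s p, c)"

lemma U12_G [simp]: "U12 p \<in> G" and inv_U12: "inv (U12 p) = U12 (- p)"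
proof -
  have 1: "U12 p (x + y) = U12 p x + U12 p y" for x y
    by (cases x; cases y) (simp add: scale_left_distrib algebra_simps)
  have 2: "U12 p (scaleW t x) = scaleW t (U12 p x)" for t x
    by (cases x) (simp add: scale_right_distrib algebra_simps)
  have 3: "det (U12 p x) = det x" for x
    by (cases x) (simp add: det_eq N_add N_mult N_scale trp_def ip_mult_same_right ip_self ip_commute[of p]
        power2_eq_square algebra_simps)
  have 4: "U12 p (U12 (- p) x) = x" "U12 (- p) (U12 p x) = x" for x
    by (cases x; simp add: ip_self algebra_simps)+
  show "U12 p \<in> G" "inv (U12 p) = U12 (- p)"
    by (rule GI[OF 1 2 3 4])+
qed

lemma U23_G [simp]: "U23 p \<in> G" and inv_U23: "inv (U23 p) = U23 (- p)"
proof -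
  have 1: "U23 p (x + y) = U23 p x + U23 p y" for x y
    by (cases x; cases y) (simp add: scale_left_distrib algebra_simps)
  have 2: "U23 p (scaleW t x) = scaleW t (U23 p x)" for t x
    by (cases x) (simp add: scale_right_distrib algebra_simps)
  have 3: "det (U23 p x) = det x" for x
  proof -
    obtain \<alpha>1 \<alpha>2 \<alpha>3 a b c where x: "x = (\<alpha>1, \<alpha>2, \<alpha>3, a, b, c)" by (cases x)
    have "trp u v c = ip v (cnj u \<bullet> cnj c)" for u v
      by (subst trp_rotate) (simp add: trp_def)
    then show ?thesis
      by (simp add: x det_eq N_add N_mult N_scale ip_mult_same_right ip_self ip_commute[of p]
          power2_eq_square algebra_simps)
  qed
  have 4: "U23 p (U23 (- p) x) = x" "U23 (- p) (U23 p x) = x" for x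
    by (cases x; simp add: ip_self algebra_simps)+
  show "U23 p \<in> G" "inv (U23 p) = U23 (- p)"
    by (rule GI[OF 1 2 3 4])+
qed

lemma U13_G [simp]: "U13 p \<in> G" and inv_U13: "inv (U13 p) = U13 (- p)"
proof -
  have 1: "U13 p (x + y) = U13 p x + U13 p y" for x y
    by (cases x; cases y) (simp add: scale_left_distrib algebra_simps)
  have 2: "U13 p (scaleW t x) = scaleW t (U13 p x)" for t x
    by (cases x) (simp add: scale_right_distrib algebra_simps)
  have 3: "det (U13 p x) = det x" for x
    by (cases x) (simp add: det_eq N_add N_mult N_scale trp_def ip_mult_same_left ip_self ip_commute[of p]
        power2_eq_square algebra_simps)
  have 4: "U13 p (U13 (- p) x) = x" "U13 (- p) (U13 p x) = x" for x
    by (cases x; simp add: ip_self algebra_simps)+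
  show "U13 p \<in> G" "inv (U13 p) = U13 (- p)"
    by (rule GI[OF 1 2 3 4])+
qed

section \<open>Rank one operators and unipotent curves\<close>

definition r1 :: "('k, 'o) albert \<Rightarrow> ('k, 'o) albert \<Rightarrow> ('k, 'o) endo" where
  "r1 x y = (\<lambda>w. scaleW (tf y w) x)"

lemma r1_linear [simp]:
  "r1 (x + x') y = r1 x y + r1 x' y" "r1 y (x + x') = r1 y x + r1 y x'"
  "r1 (x - x') y = r1 x y - r1 x' y" "r1 y (x - x') = r1 y x - r1 y x'"
  "r1 (scaleW t x) y = scaleE t (r1 x y)" "r1 y (scaleW t x) = scaleE t (r1 y x)"
  by (simp_all add: r1_def fun_eq_iff fun_applies W.scale_right_distrib W.scale_left_distrib
      W.scale_right_diff_distrib W.scale_left_diff_distrib mult.commute)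

lemma r1_zero [simp]: "r1 0 y = 0" "r1 y 0 = 0"
  using r1_linear(3)[of 0 0 y] r1_linear(4)[of y 0 0] by simp_all

lemma r1_neg: "r1 x (Ea (- p)) = - r1 x (Ea p)" "r1 x (Eb (- p)) = - r1 x (Eb p)"
  "r1 x (Ec (- p)) = - r1 x (Ec p)"
  using r1_linear(6)[of x "- 1" "Ea p"] r1_linear(6)[of x "- 1" "Eb p"] r1_linear(6)[of x "- 1" "Ec p"]
  by (simp_all del: r1_linear)

lemma conj_r1: "g \<in> G \<Longrightarrow> conj_action g (r1 x y) = r1 (g x) (gt g y)"
  by (simp add: conj_action_def r1_def fun_eq_iff lin_scale G_lin tf_gt)

lemma trace_r1: "trace (r1 x y) = tf y x"
  unfolding r1_def by (rule trace_rank1) simp_all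

lemma op3_cube: "op3 x x x = r1 x (crs x x)"
proof
  fix w
  have "scaleW (1 / 3) (v + v + v) = v" for v
  proof -
    have "v + v + v = scaleW 3 v"
      using W.scale_left_distrib[of 2 1 v] W.scale_left_distrib[of 1 1 v] by simp
    then show ?thesis by simp
  qed
  then show "op3 x x x w = r1 x (crs x x) w"
    by (simp only: op3_apply r1_def)
qed

lemma gt_eqI: "g \<in> G \<Longrightarrow> (\<And>x. tf y (inv g x) = tf z x) \<Longrightarrow> gt g y = z"
  by (rule tf_ext) (simp add: tf_gt)

lemma gt_U:
  "gt (U12 p) E3 = E3" "gt (U12 p) E2 = E2 - Ec p + scaleW (N p) E1"
  "gt (U13 p) E2 = E2" "gt (U13 p) E3 = E3 - Eb p + scaleW (N p) E1"
  "gt (U23 p) E3 = E3 - Ea p + scaleW (N p) E2"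
proof -
  have "tf E3 (U12 (- p) x) = tf E3 x" "tf E2 (U12 (- p) x) = tf (E2 - Ec p + scaleW (N p) E1) x"
    "tf E2 (U13 (- p) x) = tf E2 x" "tf E3 (U13 (- p) x) = tf (E3 - Eb p + scaleW (N p) E1) x"
    "tf E3 (U23 (- p) x) = tf (E3 - Ea p + scaleW (N p) E2) x" for x
    by (cases x; simp add: mult.commute)+
  then show "gt (U12 p) E3 = E3" "gt (U12 p) E2 = E2 - Ec p + scaleW (N p) E1"
    "gt (U13 p) E2 = E2" "gt (U13 p) E3 = E3 - Eb p + scaleW (N p) E1"
    "gt (U23 p) E3 = E3 - Ea p + scaleW (N p) E2"
    by (auto intro!: gt_eqI simp: inv_U12 inv_U13 inv_U23)
qed

lemma U_E:
  "U12 p E1 = E1 + Ec p + scaleW (N p) E2" "U12 p E2 = E2" "U12 p E3 = E3"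
  "U13 p E1 = E1 + Eb p + scaleW (N p) E3" "U13 p E2 = E2"
  "U23 p E1 = E1" "U23 p E2 = E2 + Ea p + scaleW (N p) E3"
  by simp_all

abbreviation \<Delta> :: "('k, 'o) endo" where
  "\<Delta> \<equiv> r1 E1 E1 + r1 E2 E2 + r1 E3 E3"

text \<open>Stability under these three families, rather than under all of \<open>G\<close>, is
  demanded because they fix \<open>vl\<close>: the subspace of those \<open>u\<close> whose product
  with \<open>vl\<close> is 0 has this stability.\<close>

definition U_stable :: "('k, 'o) endo set \<Rightarrow> bool" where
  "U_stable Z \<longleftrightarrow> (\<forall>p. \<forall>u\<in>Z. conj_action (U12 p) u \<in> Z \<and> conj_action (U23 p) u \<in> Z \<and> conj_action (U13 p) u \<in> Z)"

text \<open>The coefficient of \<open>t\<^sup>2\<close> of the curve. For a one-parameter unipotent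
  subgroup it is the second divided power of its nilpotent generator applied to a rank one
  operator.\<close>

lemma curve_coeff:
  assumes Z: "E.subspace Z"
    and "\<And>t. r1 (x0 + scaleW t x1 + scaleW (t\<^sup>2) x2) (y0 + scaleW t y1 + scaleW (t\<^sup>2) y2) \<in> Z"
  shows "r1 x0 y2 + r1 x1 y1 + r1 x2 y0 \<in> Z"
proof -
  define c where "c i = [r1 x0 y0, r1 x0 y1 + r1 x1 y0, r1 x0 y2 + r1 x1 y1 + r1 x2 y0,
    r1 x1 y2 + r1 x2 y1, r1 x2 y2] ! i" for i
  have "(\<Sum>i<5. scaleE (t ^ i) (c i))
      = r1 (x0 + scaleW t x1 + scaleW (t\<^sup>2) x2) (y0 + scaleW t y1 + scaleW (t\<^sup>2) y2)" for t
    by (simp add: c_def eval_nat_numeral E.scale_right_distrib algebra_simps)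
  then have "\<forall>i<5. c i \<in> Z"
    using assms(2) infinite_UNIV_alg_closed[where 'k = 'k]
    by (intro E.poly_curve_coeffs_in_subspace[OF Z, of UNIV]) auto
  then have "c 2 \<in> Z"
    by simp
  then show ?thesis
    by (simp add: c_def)
qed

text \<open>Polarisation with 6 invertible reduces \<open>op3 x y z\<close> to cubes, which are rank
  one operators \<open>r1 x (crs x x)\<close>.\<close>

lemma opspan_subset_of_cubes:
  assumes Z: "E.subspace Z" and cubes: "\<And>x. op3 x x x \<in> Z"
  shows "opspan \<subseteq> Z"
proof -
  have "op3 x y z \<in> Z" for x y z
  proof -
    define q where "q x = op3 x x x" for x
    have perms: "op3 x z y = op3 x y z" "op3 y x z = op3 x y z" "op3 y z x = op3 x y z"
      "op3 z x y = op3 x y z" "op3 z y x = op3 x y z"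
      by (metis op3_symmetric)+
    have sq: "op3 y x x = op3 x x y" "op3 x y x = op3 x x y" for x y
      by (metis op3_symmetric)+
    have six: "scaleE 6 u = u + u + u + u + u + u" for u
      using E.scale_left_distrib[of 5 1 u] E.scale_left_distrib[of 4 1 u] E.scale_left_distrib[of 3 1 u]
        E.scale_left_distrib[of 2 1 u] E.scale_left_distrib[of 1 1 u] by simp
    have "scaleE 6 (op3 x y z) = q (x + y + z) - q (x + y) - q (y + z) - q (x + z) + q x + q y + q z"
      unfolding six by (simp add: q_def perms sq algebra_simps)
    also have "\<dots> \<in> Z"
      unfolding q_def by (intro E.subspace_add[OF Z] E.subspace_diff[OF Z] cubes)
    finally have "scaleE (1 / 6) (scaleE 6 (op3 x y z)) \<in> Z"
      by (rule E.subspace_scale[OF Z])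
    then show ?thesis
      by simp
  qed
  then show ?thesis
    unfolding opspan_def by (intro E.span_minimal Z) auto
qed

section \<open>The subspace generated by the highest weight vector\<close>

context
  fixes Z :: "('k, 'o) endo set"
  assumes Z: "E.subspace Z" and stable: "U_stable Z" and v0: "r1 E1 E3 \<in> Z"
begin

lemma stable_U:
  "r1 x y \<in> Z \<Longrightarrow> r1 (U12 p x) (gt (U12 p) y) \<in> Z"
  "r1 x y \<in> Z \<Longrightarrow> r1 (U23 p x) (gt (U23 p) y) \<in> Z"
  "r1 x y \<in> Z \<Longrightarrow> r1 (U13 p x) (gt (U13 p) y) \<in> Z"
  using stable unfolding U_stable_def by (metis conj_r1 U12_G, metis conj_r1 U23_G, metis conj_r1 U13_G)

lemma E_matrix_units:
  "r1 E2 E3 \<in> Z" "r1 E1 E2 \<in> Z" "r1 E2 E1 \<in> Z" "r1 E3 E2 \<in> Z" "r1 E3 E1 \<in> Z"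
proof -
  \<comment> \<open>The quadratic term of \<open>U12\<close> carries \<open>E1\<close> to
    \<open>E2\<close> on the first leg, while the second leg \<open>E3\<close> is constant. In
    general \<open>Uij\<close> moves the first leg from \<open>Ei\<close> to \<open>Ej\<close> and
    the second from \<open>Ej\<close> to \<open>Ei\<close>; the five units are reached one after
    another in this way.\<close>
  have "r1 E1 0 + r1 (Ec e) 0 + r1 E2 E3 \<in> Z"
    using stable_U(1)[OF v0, of "t *s e" for t]
    by (intro curve_coeff[OF Z]) (simp only: U_E gt_U, simp add: N_scale)
  then show 23: "r1 E2 E3 \<in> Z"
    by (simp only: r1_zero add_0 add_0_right)
  have "r1 E1 E2 + r1 0 (Ea (- e)) + r1 0 E3 \<in> Z"
    using stable_U(2)[OF v0, of "t *s e" for t]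
    by (intro curve_coeff[OF Z]) (simp only: U_E gt_U, simp add: N_scale)
  then show 12: "r1 E1 E2 \<in> Z"
    by (simp only: r1_zero add_0 add_0_right)
  have "r1 E2 E1 + r1 0 (Eb (- e)) + r1 0 E3 \<in> Z"
    using stable_U(3)[OF 23, of "t *s e" for t]
    by (intro curve_coeff[OF Z]) (simp only: U_E gt_U, simp add: N_scale)
  then show 21: "r1 E2 E1 \<in> Z"
    by (simp only: r1_zero add_0 add_0_right)
  have "r1 E1 0 + r1 (Eb e) 0 + r1 E3 E2 \<in> Z"
    using stable_U(3)[OF 12, of "t *s e" for t]
    by (intro curve_coeff[OF Z]) (simp only: U_E gt_U, simp add: N_scale)
  then show 32: "r1 E3 E2 \<in> Z"
    by (simp only: r1_zero add_0 add_0_right)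
  have "r1 E3 E1 + r1 0 (Ec (- e)) + r1 0 E2 \<in> Z"
    using stable_U(1)[OF 32, of "t *s e" for t]
    by (intro curve_coeff[OF Z]) (simp only: U_E gt_U, simp add: N_scale)
  then show "r1 E3 E1 \<in> Z"
    by (simp only: r1_zero add_0 add_0_right)
qed

text \<open>Polarise the quadratic relation \<open>q\<close> and sum it over the pairs
  \<open>b\<close>, \<open>od b\<close>; each pair contributes \<open>ip b (od b) = 1\<close>, so
  the dimension 8 appears. Both orders of the pair remain.\<close>

lemma contract_diagonal:
  assumes q: "\<And>p. scaleE (N p) v - r1 (h p) (h p) \<in> Z"
    and h: "\<And>x y. h (x + y) = h x + h y"
  shows "scaleE 8 v - (\<Sum>b\<in>OB. r1 (h b) (h (od b))) - (\<Sum>b\<in>OB. r1 (h (od b)) (h b)) \<in> Z"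
proof -
  have pol: "scaleE (ip p q) v - r1 (h p) (h q) - r1 (h q) (h p) \<in> Z" for p q
  proof -
    have "scaleE (N (p + q)) v - r1 (h (p + q)) (h (p + q)) - (scaleE (N p) v - r1 (h p) (h p))
        - (scaleE (N q) v - r1 (h q) (h q)) \<in> Z"
      by (intro E.subspace_diff[OF Z] q)
    then show ?thesis
      by (simp add: N_add h E.scale_left_distrib algebra_simps)
  qed
  have "(\<Sum>b\<in>OB. scaleE (ip b (od b)) v - r1 (h b) (h (od b)) - r1 (h (od b)) (h b)) \<in> Z"
    by (intro E.subspace_sum[OF Z] pol)
  moreover have "(\<Sum>b\<in>OB. scaleE (ip b (od b)) v) = scaleE 8 v"
  proof -
    have "(\<Sum>b\<in>OB. scaleE (ip b (od b)) v) = (\<Sum>b\<in>OB. scaleE 1 v)"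
      using dual_basis(5) by (intro sum.cong) (auto simp: ip_commute)
    also have "\<dots> = scaleE (\<Sum>b\<in>OB. 1) v"
      by (simp only: E.scale_sum_left)
    finally show ?thesis
      by (simp add: dual_basis)
  qed
  ultimately show ?thesis
    by (simp add: sum_subtractf)
qed

text \<open>The three contracted relations add up to \<open>16 \<Delta>\<close> minus twice the
  projection to the off-diagonal entries, that is,
  \<open>16 \<Delta> - 2 (id - \<Delta>) = 2 (9 \<Delta> - id)\<close>. In accordance with this,
  \<open>9 \<Delta> - id\<close> has trace \<open>9 * 3 - 27 = 0\<close>.\<close>

lemma Delta_id: "scaleE 9 \<Delta> - id \<in> Z"
proof -
  have N12: "scaleE (N p) (r1 E1 E1 + r1 E2 E2) - r1 (Ec p) (Ec p) \<in> Z" for p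
  proof -
    \<comment> \<open>The middle term carries a minus sign because the contragredient of
      \<open>U12 p\<close> acts through \<open>- p\<close>.\<close>
    have "r1 E1 (scaleW (N p) E1) + r1 (Ec p) (Ec (- p)) + r1 (scaleW (N p) E2) E2 \<in> Z"
      using stable_U(1)[OF E_matrix_units(2), of "t *s p" for t]
      by (intro curve_coeff[OF Z]) (simp only: U_E gt_U, simp add: N_scale)
    moreover have "r1 (Ec p) (Ec (- p)) = - r1 (Ec p) (Ec p)"
      by (rule r1_neg)
    ultimately show ?thesis
      by (simp only: r1_linear E.scale_right_distrib) (simp add: algebra_simps)
  qed
  have N23: "scaleE (N p) (r1 E2 E2 + r1 E3 E3) - r1 (Ea p) (Ea p) \<in> Z" for p
  proof -
    have "r1 E2 (scaleW (N p) E2) + r1 (Ea p) (Ea (- p)) + r1 (scaleW (N p) E3) E3 \<in> Z"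
      using stable_U(2)[OF E_matrix_units(1), of "t *s p" for t]
      by (intro curve_coeff[OF Z]) (simp only: U_E gt_U, simp add: N_scale)
    moreover have "r1 (Ea p) (Ea (- p)) = - r1 (Ea p) (Ea p)"
      by (rule r1_neg)
    ultimately show ?thesis
      by (simp only: r1_linear E.scale_right_distrib) (simp add: algebra_simps)
  qed
  have N13: "scaleE (N p) (r1 E1 E1 + r1 E3 E3) - r1 (Eb p) (Eb p) \<in> Z" for p
  proof -
    have "r1 E1 (scaleW (N p) E1) + r1 (Eb p) (Eb (- p)) + r1 (scaleW (N p) E3) E3 \<in> Z"
      using stable_U(3)[OF v0, of "t *s p" for t]
      by (intro curve_coeff[OF Z]) (simp only: U_E gt_U, simp add: N_scale)
    moreover have "r1 (Eb p) (Eb (- p)) = - r1 (Eb p) (Eb p)"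
      by (rule r1_neg)
    ultimately show ?thesis
      by (simp only: r1_linear E.scale_right_distrib) (simp add: algebra_simps)
  qed
  define u where "u = (scaleE 8 (r1 E1 E1 + r1 E2 E2) - (\<Sum>b\<in>OB. r1 (Ec b) (Ec (od b))) - (\<Sum>b\<in>OB. r1 (Ec (od b)) (Ec b)))
    + (scaleE 8 (r1 E2 E2 + r1 E3 E3) - (\<Sum>b\<in>OB. r1 (Ea b) (Ea (od b))) - (\<Sum>b\<in>OB. r1 (Ea (od b)) (Ea b)))
    + (scaleE 8 (r1 E1 E1 + r1 E3 E3) - (\<Sum>b\<in>OB. r1 (Eb b) (Eb (od b))) - (\<Sum>b\<in>OB. r1 (Eb (od b)) (Eb b)))"
  have "u \<in> Z"
    unfolding u_def by (intro E.subspace_add[OF Z] contract_diagonal N12 N23 N13) simp_all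
  moreover have "u = scaleE 2 (scaleE 9 \<Delta> - id)"
  proof (rule ext)
    fix w :: "('k, 'o) albert"
    obtain \<alpha>1 \<alpha>2 \<alpha>3 a b c where w: "w = (\<alpha>1, \<alpha>2, \<alpha>3, a, b, c)" by (cases w)
    have ap: "(sum f A) w = (\<Sum>x\<in>A. f x w)" for f :: "'o \<Rightarrow> ('k, 'o) endo" and A
      by (induction A rule: infinite_finite_induct) (auto simp: fun_applies)
    have two: "2 *s x = x + x" for x
      using scale_left_distrib[of 1 1 x] by simp
    have "(u :: ('k, 'o) endo) w = scaleE 2 (scaleE 9 \<Delta> - id) w"
      unfolding u_def fun_applies fun_diff_def ap r1_def
      by (simp add: w sum_E dual_basis(3,4) two)
    then show "u w = scaleE 2 (scaleE 9 \<Delta> - id) w" .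
  qed
  ultimately have "scaleE (1 / 2) (scaleE 2 (scaleE 9 \<Delta> - id)) \<in> Z"
    using E.subspace_scale[OF Z] by metis
  then show ?thesis
    by simp
qed

text \<open>Gaussian elimination: a hermitian matrix whose first two leading minors are nonzero is a
  unipotent congruence image of a diagonal one, and cubes of diagonal matrices are combinations of
  \<open>\<Delta>\<close> and the units \<open>r1 Ei Ej\<close>. A line in the direction of the unit
  matrix reaches every \<open>x\<close>.\<close>

lemma cube_in_Z:
  assumes id: "id \<in> Z"
  shows "op3 x x x \<in> Z"
proof -
  have "scaleE 9 \<Delta> \<in> Z"
    using E.subspace_add[OF Z Delta_id id] by simp
  then have "scaleE (1 / 9) (scaleE 9 \<Delta>) \<in> Z"
    by (rule E.subspace_scale[OF Z])
  then have Delta: "\<Delta> \<in> Z"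
    by simp
  have diag: "op3 D D D \<in> Z" if "D = (\<alpha>, \<beta>, \<gamma>, 0, 0, 0)" for D \<alpha> \<beta> \<gamma>
  proof -
    have D: "D = scaleW \<alpha> E1 + scaleW \<beta> E2 + scaleW \<gamma> E3"
      by (simp add: that)
    have DD: "crs D D = scaleW (\<beta> * \<gamma>) E1 + scaleW (\<gamma> * \<alpha>) E2 + scaleW (\<alpha> * \<beta>) E3"
      by (simp add: that crs_self)
    have "op3 D D D = scaleE (\<alpha> * \<beta> * \<gamma>) \<Delta>
      + scaleE (\<alpha> * (\<gamma> * \<alpha>)) (r1 E1 E2) + scaleE (\<alpha> * (\<alpha> * \<beta>)) (r1 E1 E3)
      + scaleE (\<beta> * (\<beta> * \<gamma>)) (r1 E2 E1) + scaleE (\<beta> * (\<alpha> * \<beta>)) (r1 E2 E3)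
      + scaleE (\<gamma> * (\<beta> * \<gamma>)) (r1 E3 E1) + scaleE (\<gamma> * (\<gamma> * \<alpha>)) (r1 E3 E2)"
      unfolding op3_cube DD
      by (subst D) (simp only: r1_linear E.scale_right_distrib E.scale_scale, simp only: mult_ac add_ac)
    also have "\<dots> \<in> Z"
      by (intro E.subspace_add[OF Z] E.subspace_scale[OF Z] Delta v0 E_matrix_units)
    finally show ?thesis .
  qed
  have st: "op3 (U12 p y) (U12 p y) (U12 p y) \<in> Z" "op3 (U23 p y) (U23 p y) (U23 p y) \<in> Z"
    "op3 (U13 p y) (U13 p y) (U13 p y) \<in> Z" if "op3 y y y \<in> Z" for p y
    using that stable by (auto simp: U_stable_def simp flip: conj_op3)
  have gen: "op3 x x x \<in> Z" if x: "x = (\<alpha>1, \<alpha>2, \<alpha>3, a, b, c)" and nz: "\<alpha>1 \<noteq> 0" "\<alpha>1 * \<alpha>2 - N c \<noteq> 0"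
    for x \<alpha>1 \<alpha>2 \<alpha>3 a b c
  proof -
    \<comment> \<open>\<open>p\<close> and \<open>q\<close> produce the first row and column from
      the pivot \<open>\<alpha>1\<close>, \<open>r\<close> the entry (2,3) from the second pivot
      \<open>\<beta>\<close>; \<open>\<gamma>\<close> is the diagonal entry that is left.\<close>
    define p q where "p = (1 / \<alpha>1) *s c" and "q = (1 / \<alpha>1) *s b"
    define \<beta> where "\<beta> = \<alpha>2 - \<alpha>1 * N p"
    have "\<beta> = (\<alpha>1 * \<alpha>2 - N c) / \<alpha>1"
      using nz(1) by (simp add: \<beta>_def p_def N_scale field_simps power2_eq_square)
    then have \<beta>: "\<beta> \<noteq> 0"
      using nz by simp
    define r where "r = (1 / \<beta>) *s (a - cnj p \<bullet> cnj b)"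
    define \<gamma> where "\<gamma> = \<alpha>3 - \<alpha>1 * N q - \<beta> * N r"
    define D :: "('k, 'o) albert" where "D = (\<alpha>1, \<beta>, \<gamma>, 0, 0, 0)"
    have eq: "x = U12 p (U13 q (U23 r D))"
      using nz(1) \<beta> by (simp add: x D_def p_def q_def) (simp add: r_def \<gamma>_def \<beta>_def p_def q_def)
    show ?thesis
      unfolding eq by (intro st diag[OF D_def])
  qed
  obtain \<alpha>1 \<alpha>2 \<alpha>3 a b c where x: "x = (\<alpha>1, \<alpha>2, \<alpha>3, a, b, c)" by (cases x)
  define I :: "('k, 'o) albert" where "I = (1, 1, 1, 0, 0, 0)"
  \<comment> \<open>The product of the first two leading minors of \<open>x + scaleW t I\<close>; it
    is monic in \<open>t\<close>, hence nonzero as a polynomial. The \<open>f i\<close> below are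
    the coefficients of the cube along this line.\<close>
  define p where "p = [:\<alpha>1, 1:] * [:\<alpha>1 * \<alpha>2 - N c, \<alpha>1 + \<alpha>2, 1:]"
  define f where "f i = [op3 x x x, op3 x x I + op3 x I x + op3 I x x,
    op3 x I I + op3 I x I + op3 I I x, op3 I I I] ! i" for i
  have f: "(\<Sum>i<4. scaleE (t ^ i) (f i)) = op3 (x + scaleW t I) (x + scaleW t I) (x + scaleW t I)" for t
    by (simp add: f_def eval_nat_numeral E.scale_right_distrib algebra_simps)
  have p: "poly p t = (\<alpha>1 + t) * ((\<alpha>1 + t) * (\<alpha>2 + t) - N c)" for t
    by (simp add: p_def algebra_simps)
  have "\<forall>i<4. f i \<in> Z"
  proof (rule E.poly_curve_coeffs_in_subspace[OF Z])
    show "infinite {t. poly p t \<noteq> 0}"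
      by (rule infinite_nonroots) (simp add: p_def)
    show "(\<Sum>i<4. scaleE (t ^ i) (f i)) \<in> Z" if "t \<in> {t. poly p t \<noteq> 0}" for t
      unfolding f using that
      by (intro gen[of _ "\<alpha>1 + t" "\<alpha>2 + t" "\<alpha>3 + t" a b c]) (simp_all add: x I_def p)
  qed
  then have "f 0 \<in> Z"
    by simp
  then show ?thesis
    by (simp add: f_def)
qed

lemma opspan_subset_Z: "id \<in> Z \<Longrightarrow> opspan \<subseteq> Z"
  by (intro opspan_subset_of_cubes Z cube_in_Z)

end

subsection \<open>Equivariant products are determined by one value\<close>

abbreviation v0 :: "('k, 'o) endo" where "v0 \<equiv> r1 E1 E3"
abbreviation vl :: "('k, 'o) endo" where "vl \<equiv> r1 E3 E1"

lemma v0_opspan: "v0 \<in> opspan" and vl_opspan: "vl \<in> opspan" and Delta_opspan: "\<Delta> \<in> opspan"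
proof -
  have "v0 x = scaleE 3 (op3 E1 E1 E2) x" "vl x = scaleE 3 (op3 E3 E3 E2) x" "\<Delta> x = scaleE 6 (op3 E1 E2 E3) x" for x
    by (cases x; simp add: op3_apply r1_def fun_applies)+
  then have "v0 = scaleE 3 (op3 E1 E1 E2)" "vl = scaleE 3 (op3 E3 E3 E2)" "\<Delta> = scaleE 6 (op3 E1 E2 E3)"
    by (blast intro: ext)+
  then show "v0 \<in> opspan" "vl \<in> opspan" "\<Delta> \<in> opspan"
    by (simp_all only: E.subspace_scale[OF subspace_opspan] op3_opspan)
qed

lemma v0_\<sigma>V: "v0 \<in> \<sigma>V" and vl_\<sigma>V: "vl \<in> \<sigma>V"
  by (simp_all add: \<sigma>V_def v0_opspan vl_opspan trace_r1)

lemma U_stable_G: "(\<And>g u. g \<in> G \<Longrightarrow> u \<in> Z \<Longrightarrow> conj_action g u \<in> Z) \<Longrightarrow> U_stable Z"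
  by (simp add: U_stable_def)

text \<open>The relation \<open>Delta_id\<close> applied to \<open>opspan\<close> itself, which
  contains \<open>\<Delta>\<close>.\<close>

lemma id_opspan: "id \<in> opspan"
proof -
  have "U_stable opspan"
    by (intro U_stable_G conj_opspan)
  then have "scaleE 9 \<Delta> - (scaleE 9 \<Delta> - id) \<in> opspan"
    by (intro E.subspace_diff E.subspace_scale Delta_id subspace_opspan v0_opspan Delta_opspan)
  then show ?thesis
    by simp
qed

lemma subspace_\<sigma>V: "E.subspace \<sigma>V"
  unfolding \<sigma>V_def using subspace_opspan
  by (intro E.subspaceI) (auto simp: E.subspace_0 E.subspace_add E.subspace_scale trace_zero trace_add
      trace_scale lin_opspan)

text \<open>Adjoining the scalar operators to \<open>Z\<close> gives a subspace that contains
  \<open>id\<close>, hence all of \<open>opspan\<close>. The trace then separates the two parts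
  because \<open>trace id = 27\<close> is nonzero.\<close>

lemma \<sigma>V_subset:
  assumes Z: "E.subspace Z" "Z \<subseteq> \<sigma>V" and stable: "U_stable Z" and v0: "v0 \<in> Z"
  shows "\<sigma>V \<subseteq> Z"
proof
  fix u assume u: "u \<in> \<sigma>V"
  define Z' where "Z' = {z + scaleE t id | z t. z \<in> Z}"
  have Z'I: "z + scaleE t id \<in> Z'" if "z \<in> Z" for z t
    using that by (auto simp: Z'_def)
  have sub: "E.subspace Z'"
  proof (rule E.subspaceI)
    show "0 \<in> Z'"
      using Z'I[OF E.subspace_0[OF Z(1)], of 0] by simp
    show "x + y \<in> Z'" if xy: "x \<in> Z'" "y \<in> Z'" for x y
    proof -
      obtain z t z' t' where "x = z + scaleE t id" "y = z' + scaleE t' id" "z \<in> Z" "z' \<in> Z"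
        using xy by (auto simp: Z'_def)
      then show ?thesis
        using Z'I[OF E.subspace_add[OF Z(1)], of z z' "t + t'"]
        by (simp add: E.scale_left_distrib algebra_simps)
    qed
    show "scaleE c x \<in> Z'" if x: "x \<in> Z'" for c x
    proof -
      obtain z t where "x = z + scaleE t id" "z \<in> Z"
        using x by (auto simp: Z'_def)
      then show ?thesis
        using Z'I[OF E.subspace_scale[OF Z(1)], of z c "c * t"] by (simp add: E.scale_right_distrib)
    qed
  qed
  have "U_stable Z'"
    unfolding U_stable_def
  proof (intro allI ballI)
    fix p v assume "v \<in> Z'"
    then obtain z t where v: "v = z + scaleE t id" "z \<in> Z"
      by (auto simp: Z'_def)
    show "conj_action (U12 p) v \<in> Z' \<and> conj_action (U23 p) v \<in> Z' \<and> conj_action (U13 p) v \<in> Z'"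
      using stable v(2) unfolding v(1) U_stable_def by (auto simp: conj_linear conj_id intro!: Z'I)
  qed
  moreover have "v0 \<in> Z'"
    using Z'I[OF v0, of 0] by simp
  moreover have "id \<in> Z'"
    using Z'I[OF E.subspace_0[OF Z(1)], of 1] by simp
  ultimately have "opspan \<subseteq> Z'"
    by (intro opspan_subset_Z sub)
  then obtain z t where z: "u = z + scaleE t id" "z \<in> Z"
    using u by (auto simp: \<sigma>V_def Z'_def)
  have "lin z" "trace z = 0"
    using z Z(2) by (auto simp: \<sigma>V_def lin_opspan)
  then have "trace u = t * 27"
    by (simp add: z(1) trace_add trace_scale lin_id lin_ops trace_id)
  then have "t = 0"
    using u by (simp add: \<sigma>V_def)
  then show "u \<in> Z"
    using z by simp
qed

definition equivariant :: "(('k, 'o) endo \<Rightarrow> ('k, 'o) endo \<Rightarrow> ('k, 'o) endo) \<Rightarrow> bool" where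
  "equivariant m \<longleftrightarrow> (\<forall>g\<in>G. \<forall>u\<in>\<sigma>V. \<forall>v\<in>\<sigma>V. m (conj_action g u) (conj_action g v) = conj_action g (m u v))"

lemma bilinear_onD:
  assumes "bilinear_on S m" "u \<in> S" "v \<in> S" "w \<in> S"
  shows "m (u + v) w = m u w + m v w" "m w (u + v) = m w u + m w v"
    "m (scaleE t u) v = scaleE t (m u v)" "m u (scaleE t v) = scaleE t (m u v)"
  using assms unfolding bilinear_on_def by blast+

text \<open>Congruence by the permutation matrix of the indices 1 and 3. It interchanges
  \<open>v0\<close> and \<open>vl\<close>, so it links the two generation steps and also constrains
  the value of a commutative product.\<close>

definition sw :: "('k, 'o) endo" where
  "sw = (\<lambda>(\<alpha>1, \<alpha>2, \<alpha>3, a, b, c). (\<alpha>3, \<alpha>2, \<alpha>1, cnj c, cnj b, cnj a))"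

lemma sw_simp [simp]: "sw (\<alpha>1, \<alpha>2, \<alpha>3, a, b, c) = (\<alpha>3, \<alpha>2, \<alpha>1, cnj c, cnj b, cnj a)"
  by (simp add: sw_def)

lemma sw_G: "sw \<in> G" and inv_sw: "inv sw = sw"
proof -
  have 1: "sw (x + y) = sw x + sw y" for x y
    by (cases x; cases y) simp
  have 2: "sw (scaleW t x) = scaleW t (sw x)" for t x
    by (cases x) simp
  have "trp (cnj c) (cnj b) (cnj a) = trp a b c" for a b c
  proof -
    have "trp (cnj c) (cnj b) (cnj a) = trp c a b"
      by (simp add: trp_def ip_cnj_left)
    then show ?thesis
      by (simp add: trp_rotate[of c a b])
  qed
  then have 3: "det (sw x) = det x" for x
    by (cases x) (simp add: det_eq algebra_simps)
  have 4: "sw (sw x) = x" for x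
    by (cases x) simp
  show "sw \<in> G" "inv sw = sw"
    by (rule GI[OF 1 2 3 4 4])+
qed

lemma conj_sw: "conj_action sw v0 = vl" "conj_action sw vl = v0"
proof -
  have "tf E3 (inv sw x) = tf E1 x" "tf E1 (inv sw x) = tf E3 x" for x
    by (cases x; simp add: inv_sw)+
  then have "gt sw E3 = E1" "gt sw E1 = E3"
    by (auto intro!: gt_eqI sw_G)
  then show "conj_action sw v0 = vl" "conj_action sw vl = v0"
    by (simp_all add: conj_r1 sw_G)
qed

lemma conj_U_vl: "conj_action (U12 p) vl = vl" "conj_action (U23 p) vl = vl" "conj_action (U13 p) vl = vl"
proof -
  have "tf E1 (U12 (- p) x) = tf E1 x" "tf E1 (U23 (- p) x) = tf E1 x" "tf E1 (U13 (- p) x) = tf E1 x" for x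
    by (cases x; simp)+
  then have "gt (U12 p) E1 = E1" "gt (U23 p) E1 = E1" "gt (U13 p) E1 = E1"
    by (auto intro!: gt_eqI simp: inv_U12 inv_U13 inv_U23)
  then show "conj_action (U12 p) vl = vl" "conj_action (U23 p) vl = vl" "conj_action (U13 p) vl = vl"
    by (simp_all add: conj_r1)
qed

text \<open>
  The pair of a highest and a lowest weight vector generates \<open>V \<otimes> V\<close>: first \<open>v0\<close> is moved by the
  unipotent group fixing \<open>vl\<close>, then \<open>vl\<close> is moved by the whole group.
\<close>

lemma equivariant_eq_0:
  assumes bil: "bilinear_on \<sigma>V m" and eqv: "equivariant m" and z: "m v0 vl = 0"
    and uv: "u \<in> \<sigma>V" "v \<in> \<sigma>V"
  shows "m u v = 0"
proof -
  note bilD = bilinear_onD[OF bil]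
  note sub = E.subspace_0[OF subspace_\<sigma>V] E.subspace_add[OF subspace_\<sigma>V] E.subspace_scale[OF subspace_\<sigma>V]
  have m0: "m 0 w = 0" "m w 0 = 0" if "w \<in> \<sigma>V" for w
    using bilD(3)[OF sub(1) that sub(1), of 0] bilD(4)[OF that sub(1) sub(1), of 0] by simp_all
  define A where "A = {u \<in> \<sigma>V. m u vl = 0}"
  have "E.subspace A"
    unfolding A_def using bilD vl_\<sigma>V
    by (intro E.subspaceI) (auto simp: sub m0)
  moreover have "conj_action g u \<in> A" if g: "g \<in> G" "conj_action g vl = vl" and u: "u \<in> A" for g u
  proof -
    have "m (conj_action g u) (conj_action g vl) = conj_action g (m u vl)"
      using eqv g u vl_\<sigma>V unfolding equivariant_def A_def by blast
    also have "m u vl = 0"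
      using u by (simp add: A_def)
    finally show ?thesis
      using g u by (simp add: A_def conj_\<sigma>V conj_linear)
  qed
  then have "U_stable A"
    by (simp add: U_stable_def conj_U_vl)
  ultimately have "\<sigma>V \<subseteq> A"
    using z v0_\<sigma>V by (intro \<sigma>V_subset) (auto simp: A_def)
  then have A: "m u vl = 0" if "u \<in> \<sigma>V" for u
    using that by (auto simp: A_def)
  define B where "B = {v \<in> \<sigma>V. \<forall>u\<in>\<sigma>V. m u v = 0}"
  have "E.subspace B"
    unfolding B_def using bilD
    by (intro E.subspaceI) (auto simp: sub m0)
  moreover have BG: "conj_action g v \<in> B" if g: "g \<in> G" and v: "v \<in> B" for g v
  proof -
    have "m u (conj_action g v) = 0" if u: "u \<in> \<sigma>V" for u
    proof -
      let ?u = "conj_action (inv g) u"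
      have u': "?u \<in> \<sigma>V"
        using g u by (simp add: conj_\<sigma>V G_inv_in)
      have "conj_action g ?u = u"
        using conj_inv[OF G_inv_in[OF g], of u] g by (simp add: inv_inv_eq G_bij)
      then have "m u (conj_action g v) = conj_action g (m ?u v)"
        using eqv g u' v unfolding equivariant_def B_def by force
      also have "m ?u v = 0"
        using u' v by (simp add: B_def)
      finally show ?thesis
        using g by (simp add: conj_linear)
    qed
    then show ?thesis
      using g v by (simp add: B_def conj_\<sigma>V)
  qed
  moreover have "U_stable B"
    by (intro U_stable_G BG)
  moreover have "vl \<in> B"
    using A vl_\<sigma>V by (simp add: B_def)
  \<comment> \<open>The generation lemma starts from \<open>v0\<close>, whereas so far only
    \<open>vl\<close> is known to lie in \<open>B\<close>.\<close>
  then have "v0 \<in> B"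
    using BG[OF sw_G, of vl] by (simp add: conj_sw)
  ultimately have "\<sigma>V \<subseteq> B"
    by (intro \<sigma>V_subset) (auto simp: B_def)
  then show ?thesis
    using uv by (auto simp: B_def)
qed


subsection \<open>The two products\<close>

text \<open>A bilinear \<open>m\<close> with the right values on generators settles existence in
  \<open>THE\<close>; uniqueness is induction over \<open>opspan\<close> in each argument. Thus
  well-definedness of a product amounts to exhibiting such an \<open>m\<close>.\<close>

lemma bilinear_extension_eq:
  assumes bil: "bilinear_on opspan m" and m: "\<And>a b. m (op3v a) (op3v b) = \<phi> a b"
  shows "bilinear_extension \<phi> = restrict_product opspan m"
  unfolding bilinear_extension_def
proof (rule the_equality)
  note sub = E.subspace_0[OF subspace_opspan] E.subspace_add[OF subspace_opspan]
    E.subspace_scale[OF subspace_opspan] op3_opspan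
  show "supported_on opspan (restrict_product opspan m) \<and> bilinear_on opspan (restrict_product opspan m) \<and>
      (\<forall>a b. restrict_product opspan m (op3v a) (op3v b) = \<phi> a b)"
    using bil m by (auto simp: supported_on_def restrict_product_def bilinear_on_def sub)
  fix n
  assume n: "supported_on opspan n \<and> bilinear_on opspan n \<and> (\<forall>a b. n (op3v a) (op3v b) = \<phi> a b)"
  have nm: "n (op3 x y z) (op3 x' y' z') = m (op3 x y z) (op3 x' y' z')" for x y z x' y' z'
    using op3v_exists[of x y z] op3v_exists[of x' y' z'] n m by metis
  note nD = bilinear_onD[of opspan n] and mD = bilinear_onD[OF bil]
  have nb: "bilinear_on opspan n"
    using n by simp
  have k0: "k 0 w = 0" "k w 0 = 0" if "bilinear_on opspan k" "w \<in> opspan" for k w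
    using bilinear_onD(3)[OF that(1) sub(1) that(2) sub(1), of 0]
      bilinear_onD(4)[OF that(1) that(2) sub(1) sub(1), of 0] by simp_all
  have right: "n (op3 x y z) v = m (op3 x y z) v" if "v \<in> opspan" for x y z v
    using that
  proof (induction rule: opspan_induct)
    case zero
    then show ?case
      by (simp add: k0 bil nb sub)
  next
    case (add t x' y' z' v)
    have "k (op3 x y z) (scaleE t (op3 x' y' z') + v) = scaleE t (k (op3 x y z) (op3 x' y' z')) + k (op3 x y z) v"
      if "bilinear_on opspan k" for k
      using bilinear_onD(2)[OF that sub(3)[OF sub(4)] add(1) sub(4)] bilinear_onD(4)[OF that sub(4) sub(4) sub(4)]
      by simp
    then show ?case
      using add nm bil nb by simp
  qed
  have "n u v = m u v" if "u \<in> opspan" "v \<in> opspan" for u v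
    using that(1)
  proof (induction rule: opspan_induct)
    case zero
    then show ?case
      by (simp add: k0 bil nb that(2))
  next
    case (add t x y z u)
    have "k (scaleE t (op3 x y z) + u) v = scaleE t (k (op3 x y z) v) + k u v"
      if "bilinear_on opspan k" for k
      using bilinear_onD(1)[OF that sub(3)[OF sub(4)] add(1) \<open>v \<in> opspan\<close>]
        bilinear_onD(3)[OF that sub(4) \<open>v \<in> opspan\<close> sub(4)]
      by simp
    then show ?case
      using add right[OF that(2)] bil nb by simp
  qed
  then show "n = restrict_product opspan m"
    using n by (auto simp: fun_eq_iff restrict_product_def supported_on_def)
qed

text \<open>The constants of \<open>O1\<close> and \<open>O2\<close> combine \<open>6 ^ 2\<close>
  and \<open>6 ^ 3\<close> from the permutation sums with \<open>f' = 4 trace\<close>: the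
  coefficients 1/12 and 5/4 become 1/3 and 5.\<close>

definition O1 :: "('k, 'o) endo \<Rightarrow> ('k, 'o) endo \<Rightarrow> ('k, 'o) endo" where
  "O1 u v = scaleE 36 (F1 u v) - scaleE (1 / 3 * trace (u \<circ> v)) id"

definition O2 :: "('k, 'o) endo \<Rightarrow> ('k, 'o) endo \<Rightarrow> ('k, 'o) endo" where
  "O2 u v = scaleE 216 (F2 u v) - scaleE (5 * trace (u \<circ> v)) id"

lemma trace_comp_add:
  assumes "lin u" "lin u'" "lin v"
  shows "trace ((u + u') \<circ> v) = trace (u \<circ> v) + trace (u' \<circ> v)"
    "trace (v \<circ> (u + u')) = trace (v \<circ> u) + trace (v \<circ> u')"
proof -
  have "(u + u') \<circ> v = (u \<circ> v) + (u' \<circ> v)" "v \<circ> (u + u') = (v \<circ> u) + (v \<circ> u')"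
    using assms by (auto simp: fun_eq_iff fun_applies lin_add)
  then show "trace ((u + u') \<circ> v) = trace (u \<circ> v) + trace (u' \<circ> v)"
    "trace (v \<circ> (u + u')) = trace (v \<circ> u) + trace (v \<circ> u')"
    using assms by (simp_all add: trace_add lin_comp)
qed

lemma trace_comp_scale:
  assumes "lin u" "lin v"
  shows "trace (scaleE t u \<circ> v) = t * trace (u \<circ> v)" "trace (v \<circ> scaleE t u) = t * trace (v \<circ> u)"
proof -
  have "scaleE t u \<circ> v = scaleE t (u \<circ> v)" "v \<circ> scaleE t u = scaleE t (v \<circ> u)"
    using assms by (auto simp: fun_eq_iff fun_applies lin_scale)
  then show "trace (scaleE t u \<circ> v) = t * trace (u \<circ> v)" "trace (v \<circ> scaleE t u) = t * trace (v \<circ> u)"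
    using assms by (simp_all add: trace_scale lin_comp)
qed

lemma O_bilinear: "bilinear_on opspan O1" "bilinear_on opspan O2"
  unfolding bilinear_on_def O1_def O2_def
  by (auto simp: lin_opspan trace_comp_add trace_comp_scale F1_linear F2_linear E.scale_right_distrib E.scale_left_distrib
      E.scale_right_diff_distrib E.scale_left_commute algebra_simps)

lemma O_commute:
  assumes "u \<in> opspan" "v \<in> opspan"
  shows "O1 u v = O1 v u" "O2 u v = O2 v u"
  unfolding O1_def O2_def F1_commute[of u v] F2_commute[of u v]
    trace_comp_commute[OF lin_opspan[OF assms(1)] lin_opspan[OF assms(2)]] by (rule refl)+

lemma O_opspan: "O1 u v \<in> opspan" "O2 u v \<in> opspan"
  unfolding O1_def O2_def
  by (intro E.subspace_diff E.subspace_scale subspace_opspan F1_opspan F2_opspan id_opspan)+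

lemma conj_diff: "g \<in> G \<Longrightarrow> conj_action g (u - v) = conj_action g u - conj_action g v"
  using conj_linear(1)[of g "u - v" v] by (simp add: eq_diff_eq)

lemma O_equivariant: "equivariant O1" "equivariant O2"
  unfolding equivariant_def O1_def O2_def \<sigma>V_def
  by (simp_all add: F1_equivariant F2_equivariant lin_opspan conj_diff conj_linear conj_id conj_comp trace_conj
      lin_comp)

lemma odot1_eq: "odot1 = restrict_product opspan O1"
  unfolding odot1_def
  by (rule bilinear_extension_eq[OF O_bilinear(1)])
    (simp only: cross_eq F1_op3v f'_eq O1_def, simp)

text \<open>A scalar is absorbed into the first factor of a generator, so membership in the span
  gives a plain sum. Without some decomposition the \<open>THE\<close> in \<open>odot2_gen\<close>
  would have no candidate.\<close>

lemma id_decomposition: "\<exists>xs. id = (\<Sum>x\<leftarrow>xs. op3v x)"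
  using id_opspan
proof (induction rule: opspan_induct)
  case zero
  show ?case
    by (rule exI[of _ "[]"]) (simp only: list.map sum_list.Nil)
next
  case (add t x y z v)
  then obtain xs where "v = (\<Sum>x\<leftarrow>xs. op3v x)"
    by blast
  moreover obtain a where "op3 (scaleW t x) y z = op3v a"
    using op3v_exists by blast
  ultimately show ?case
    by (intro exI[of _ "a # xs"]) (simp flip: op3_linear)
qed

lemma odot2_eq: "odot2 = restrict_product opspan O2"
  unfolding odot2_def
proof (rule bilinear_extension_eq[OF O_bilinear(2)])
  fix a b :: "('k, 'o) albert ^ 3"
  obtain xs where xs: "id = (\<Sum>x\<leftarrow>xs. op3v x)"
    using id_decomposition by blast
  define R where "R xs = (\<Sum>x\<leftarrow>xs. \<Sum>\<sigma>\<in>S3. \<Sum>\<tau>\<in>S3. \<Sum>\<rho>\<in>S3.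
            op3 ((a $ \<tau> 1 \<otimes> b $ \<rho> 1) \<otimes> x $ \<sigma> 1)
                ((a $ \<tau> 2 \<otimes> a $ \<tau> 3) \<otimes> (b $ \<rho> 2 \<otimes> b $ \<rho> 3))
                (x $ \<sigma> 2 \<otimes> x $ \<sigma> 3))
         - scaleE (5 / 4 * f' a b) id" for xs :: "(('k, 'o) albert ^ 3) list"
  have *: "O2 (op3v a) (op3v b) = R xs" if "id = (\<Sum>x\<leftarrow>xs. op3v x)" for xs
    unfolding R_def cross_eq F2_op3v[OF that] f'_eq O2_def by simp
  show "O2 (op3v a) (op3v b) = odot2_gen a b"
    unfolding odot2_gen_def R_def[symmetric]
  proof (rule the_equality[symmetric])
    show "\<exists>xs. id = (\<Sum>x\<leftarrow>xs. op3v x) \<and> O2 (op3v a) (op3v b) = R xs"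
      using xs *[OF xs] by blast
    show "r = O2 (op3v a) (op3v b)" if "\<exists>xs. id = (\<Sum>x\<leftarrow>xs. op3v x) \<and> r = R xs" for r
      using that by (elim exE conjE) (simp only: *)
  qed
qed

subsection \<open>The invariants of the Levi subgroup\<close>

definition dg :: "'k \<Rightarrow> 'k \<Rightarrow> 'k \<Rightarrow> 'k \<Rightarrow> 'k \<Rightarrow> 'k \<Rightarrow> ('k, 'o) endo" where
  "dg x1 x2 x3 xa xb xc = (\<lambda>(\<alpha>1, \<alpha>2, \<alpha>3, a, b, c). (x1 * \<alpha>1, x2 * \<alpha>2, x3 * \<alpha>3, xa *s a, xb *s b, xc *s c))"

lemma dg_simp [simp]: "dg x1 x2 x3 xa xb xc (\<alpha>1, \<alpha>2, \<alpha>3, a, b, c)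
    = (x1 * \<alpha>1, x2 * \<alpha>2, x3 * \<alpha>3, xa *s a, xb *s b, xc *s c)"
  by (simp add: dg_def)

lemma lin_dg: "lin (dg x1 x2 x3 xa xb xc)"
proof -
  have "dg x1 x2 x3 xa xb xc (x + y) = dg x1 x2 x3 xa xb xc x + dg x1 x2 x3 xa xb xc y"
    "dg x1 x2 x3 xa xb xc (scaleW t x) = scaleW t (dg x1 x2 x3 xa xb xc x)" for x y t
    by (cases x; cases y; simp add: scale_right_distrib algebra_simps)+
  then show ?thesis
    by (simp add: linear_W_iff)
qed

lemma trace_dg: "trace (dg x1 x2 x3 xa xb xc) = x1 + x2 + x3 + 8 * xa + 8 * xb + 8 * xc"
  using dual_basis(5)
  by (simp add: trace_eq lin_dg ctr_def ip_commute[of _ "od _"] dual_basis(2))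

lemma dg_comp: "dg x1 x2 x3 xa xb xc \<circ> dg y1 y2 y3 ya yb yc
    = dg (x1 * y1) (x2 * y2) (x3 * y3) (xa * ya) (xb * yb) (xc * yc)"
proof
  fix w
  show "(dg x1 x2 x3 xa xb xc \<circ> dg y1 y2 y3 ya yb yc) w
      = dg (x1 * y1) (x2 * y2) (x3 * y3) (xa * ya) (xb * yb) (xc * yc) w"
    by (cases w) (simp add: mult.assoc)
qed

lemma id_eq_dg: "id = dg 1 1 1 1 1 1"
proof
  show "id w = dg 1 1 1 1 1 1 w" for w :: "('k, 'o) albert"
    by (cases w) simp
qed

lemma dg_linear:
  "dg x1 x2 x3 xa xb xc + dg y1 y2 y3 ya yb yc = dg (x1 + y1) (x2 + y2) (x3 + y3) (xa + ya) (xb + yb) (xc + yc)"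
  "dg x1 x2 x3 xa xb xc - dg y1 y2 y3 ya yb yc = dg (x1 - y1) (x2 - y2) (x3 - y3) (xa - ya) (xb - yb) (xc - yc)"
  "scaleE t (dg x1 x2 x3 xa xb xc) = dg (t * x1) (t * x2) (t * x3) (t * xa) (t * xb) (t * xc)"
proof -
  show "dg x1 x2 x3 xa xb xc + dg y1 y2 y3 ya yb yc = dg (x1 + y1) (x2 + y2) (x3 + y3) (xa + ya) (xb + yb) (xc + yc)"
  proof
    show "(dg x1 x2 x3 xa xb xc + dg y1 y2 y3 ya yb yc) w
        = dg (x1 + y1) (x2 + y2) (x3 + y3) (xa + ya) (xb + yb) (xc + yc) w" for w
      by (cases w) (simp add: fun_applies scale_left_distrib algebra_simps)
  qed
  show "dg x1 x2 x3 xa xb xc - dg y1 y2 y3 ya yb yc = dg (x1 - y1) (x2 - y2) (x3 - y3) (xa - ya) (xb - yb) (xc - yc)"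
  proof
    show "(dg x1 x2 x3 xa xb xc - dg y1 y2 y3 ya yb yc) w
        = dg (x1 - y1) (x2 - y2) (x3 - y3) (xa - ya) (xb - yb) (xc - yc) w" for w
      by (cases w) (simp add: scale_left_diff_distrib algebra_simps)
  qed
  show "scaleE t (dg x1 x2 x3 xa xb xc) = dg (t * x1) (t * x2) (t * x3) (t * xa) (t * xb) (t * xc)"
  proof
    show "scaleE t (dg x1 x2 x3 xa xb xc) w = dg (t * x1) (t * x2) (t * x3) (t * xa) (t * xb) (t * xc) w" for w
      by (cases w) (simp add: fun_applies mult.assoc)
  qed
qed

section \<open>The values of both products at the extreme weight vectors\<close>

lemma ctr_r1:
  assumes "bilinW s \<Phi>"
  shows "ctr (\<lambda>x y. \<Phi> y (r1 p q x)) = \<Phi> q p"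
proof -
  note \<Phi> = assms[unfolded bilinW_def]
  interpret s: vector_space s
    using \<Phi> by blast
  have "ctr (\<lambda>x y. s (tf q x) (\<Phi> y p)) = \<Phi> q p"
    by (rule ctr_reconstruct(3)) (use \<Phi> in auto)
  then show ?thesis
    unfolding r1_def by (simp only: \<Phi>)
qed

lemma F1_v0_vl: "F1 v0 vl = op3 (crs E3 E1) E1 E3"
proof -
  have "ctr (\<lambda>y y'. op3 (crs x' y') (v0 x) (vl y)) = op3 (crs x' E1) (v0 x) E3" for x x'
    by (rule ctr_r1[of scaleE "\<lambda>y' z. op3 (crs x' y') (v0 x) z"]) (rule bilinWE_I; simp)
  moreover have "ctr (\<lambda>x x'. op3 (crs x' E1) (v0 x) E3) = op3 (crs E3 E1) E1 E3"
    by (rule ctr_r1[of scaleE "\<lambda>x' z. op3 (crs x' E1) z E3"]) (rule bilinWE_I; simp)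
  ultimately show ?thesis
    unfolding F1_def by simp
qed

lemma F2_v0_vl: "F2 v0 vl = ctr (\<lambda>z z'. op3 (crs (crs E1 E3) z) (crs E3 E1) z')"
proof -
  have "ctr (\<lambda>y y'. op3 (crs (crs (v0 x) (vl y)) z) (crs x' y') z') = op3 (crs (crs (v0 x) E3) z) (crs x' E1) z'"
    for x x' z z'
    by (rule ctr_r1[of scaleE "\<lambda>y' y. op3 (crs (crs (v0 x) y) z) (crs x' y') z'"]) (rule bilinWE_I; simp)
  moreover have "ctr (\<lambda>x x'. op3 (crs (crs (v0 x) E3) z) (crs x' E1) z') = op3 (crs (crs E1 E3) z) (crs E3 E1) z'"
    for z z'
    by (rule ctr_r1[of scaleE "\<lambda>x' x. op3 (crs (crs x E3) z) (crs x' E1) z'"]) (rule bilinWE_I; simp)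
  ultimately show ?thesis
    unfolding F2_def by simp
qed

lemma op3_E: "op3 E1 E2 E3 = dg (1 / 6) (1 / 6) (1 / 6) 0 0 0"
proof
  show "op3 E1 E2 E3 w = dg (1 / 6) (1 / 6) (1 / 6) 0 0 0 w" for w
    by (cases w) (simp add: op3_apply)
qed

lemma op3_Eb: "op3 (Eb x) E2 (Eb y) (\<alpha>1, \<alpha>2, \<alpha>3, a, b, c)
    = (0, - (1 / 6) * ip x y * \<alpha>2, 0, 0, - (1 / 6) *s (ip y b *s x + ip x b *s y), 0)"
  by (simp add: op3_apply scale_right_distrib ip_commute[of y x])
    (simp add: scale_right_diff_distrib algebra_simps)

text \<open>On \<open>E2\<close> the 8 pairs contribute \<open>- 1/6\<close> each; on the entry
  \<open>b\<close> the two expansions in dual bases contribute \<open>- 1/6\<close> each.\<close>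

lemma sum_op3_Eb: "(\<Sum>x\<in>OB. op3 (Eb x) E2 (Eb (od x))) = dg 0 (- (4 / 3)) 0 0 (- (1 / 3)) 0"
proof (rule ext)
  fix w :: "('k, 'o) albert"
  obtain \<alpha>1 \<alpha>2 \<alpha>3 a b c where w: "w = (\<alpha>1, \<alpha>2, \<alpha>3, a, b, c)" by (cases w)
  have ap: "(sum f A) w = (\<Sum>x\<in>A. f x w)" for f :: "'o \<Rightarrow> ('k, 'o) endo" and A
    by (induction A rule: infinite_finite_induct) (auto simp: fun_applies)
  have tup: "(\<Sum>x\<in>A. (0, f x, 0, 0, h x, 0)) = (0, sum f A, 0, 0, sum h A, 0)"
    for f :: "'o \<Rightarrow> 'k" and h :: "'o \<Rightarrow> 'o" and A
    by (induction A rule: infinite_finite_induct) (auto simp: zero_prod_def)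
  have "(\<Sum>x\<in>OB. - (1 / 6) * ip x (od x) * \<alpha>2) = (\<Sum>x\<in>OB. - (1 / 6) * \<alpha>2)"
    using dual_basis(5) by (intro sum.cong) (auto simp: ip_commute)
  also have "\<dots> = - (4 / 3) * \<alpha>2"
    by (simp add: dual_basis(2) field_simps)
  finally have 1: "(\<Sum>x\<in>OB. - (1 / 6) * ip x (od x) * \<alpha>2) = - (4 / 3) * \<alpha>2" .
  have "(\<Sum>x\<in>OB. - (1 / 6) *s (ip (od x) b *s x + ip x b *s od x)) = - (1 / 6) *s (b + b)"
    by (simp only: scale_sum_right[symmetric] sum.distrib dual_basis(3,4))
  also have "\<dots> = - (1 / 3) *s b"
  proof -
    have "b + b = 2 *s b"
      using scale_left_distrib[of 1 1 b] by simp
    moreover have "(2::'k) / 6 = 1 / 3"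
      by (simp add: field_simps)
    ultimately show ?thesis
      by simp
  qed
  finally have 2: "(\<Sum>x\<in>OB. - (1 / 6) *s (ip (od x) b *s x + ip x b *s od x)) = - (1 / 3) *s b" .
  show "(\<Sum>x\<in>OB. op3 (Eb x) E2 (Eb (od x))) w = dg 0 (- (4 / 3)) 0 0 (- (1 / 3)) 0 w"
    unfolding ap unfolding w op3_Eb tup 1 2 by simp
qed

lemma trace_v0_vl: "trace (v0 \<circ> vl) = 1"
proof -
  have "v0 \<circ> vl = r1 E1 E1"
    by (simp add: fun_eq_iff r1_def)
  then show ?thesis
    by (simp add: trace_r1)
qed

text \<open>Since \<open>crs E3 E1\<close> is half of \<open>E2\<close>, \<open>36 F1\<close> is
  \<open>3 \<Delta>\<close>; subtracting 1/3 of the identity leaves 8/3 on the diagonal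
  entries.\<close>

lemma O1_v0_vl: "O1 v0 vl = dg (8 / 3) (8 / 3) (8 / 3) (- 1 / 3) (- 1 / 3) (- 1 / 3)"
proof -
  have "crs E3 E1 = scaleW (1 / 2) E2"
    by simp
  then have "F1 v0 vl = scaleE (1 / 2) (op3 E1 E2 E3)"
    unfolding F1_v0_vl by (simp only: op3_linear op3_symmetric(1)[of E2 E1 E3])
  moreover have num: "(36::'k) / 12 - 1 / 3 = 8 / 3"
  proof -
    have "(36::'k) / 12 = 3"
      by (simp add: divide_eq_eq)
    then show ?thesis
      by (simp only:) (simp add: field_simps)
  qed
  ultimately show ?thesis
    unfolding O1_def trace_v0_vl by (simp add: op3_E dg_linear id_eq_dg num)
qed

text \<open>Both factors \<open>crs E1 E3\<close> and \<open>crs E3 E1\<close> give 1/2, so the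
  contraction is multiplied by \<open>216 / 4 = 54\<close>; its nonzero entries 1/6 and 5/6 become 9
  and 45, from which 5 is subtracted.\<close>

lemma O2_v0_vl: "O2 v0 vl = dg 4 40 4 (- 5) 4 (- 5)"
proof -
  have c: "crs E1 E3 = scaleW (1 / 2) E2" "crs E3 E1 = scaleW (1 / 2) E2"
    by simp_all
  have nums: "(2::'k) / 12 = 1 / 6" "(1::'k) / 6 + 4 / 6 = 5 / 6"
    by (simp_all add: field_simps)
  have z: "crs E2 E1 = scaleW (1 / 2) E3" "crs E2 E2 = 0" "crs E2 E3 = scaleW (1 / 2) E1"
    "crs E2 (Ea x) = 0" "crs E2 (Eb x) = scaleW (- 1 / 2) (Eb x)" "crs E2 (Ec x) = 0" for x
    by (simp_all add: zero_prod_def)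
  have "ctr (\<lambda>z z'. op3 (crs E2 z) E2 z')
      = scaleE (1 / 2) (op3 E3 E2 E1) + scaleE (1 / 2) (op3 E1 E2 E3) + scaleE (- 1 / 2) (\<Sum>x\<in>OB. op3 (Eb x) E2 (Eb (od x)))"
    unfolding ctr_def z by (simp only: op3_linear op3_zero sum.neutral_const add_0_right E.scale_sum_right)
  also have "op3 E3 E2 E1 = op3 E1 E2 E3"
    by (metis op3_symmetric)
  finally have "ctr (\<lambda>z z'. op3 (crs E2 z) E2 z') = dg (1 / 6) (5 / 6) (1 / 6) 0 (1 / 6) 0"
    by (simp add: op3_E sum_op3_Eb dg_linear nums)
  moreover have "F2 v0 vl = scaleE (1 / 2) (scaleE (1 / 2) (ctr (\<lambda>z z'. op3 (crs E2 z) E2 z')))"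
  proof -
    have "F2 v0 vl = ctr (\<lambda>z z'. scaleE (1 / 2) (scaleE (1 / 2) (op3 (crs E2 z) E2 z')))"
      unfolding F2_v0_vl c by (rule ctr_cong) (simp only: crs_linear op3_linear)
    then show ?thesis
      by (simp only: ctr_scaleE)
  qed
  moreover have num: "(216::'k) / 24 = 9" "(1080::'k) / 24 = 45"
    by (simp_all add: divide_eq_eq)
  ultimately show ?thesis
    unfolding O2_def trace_v0_vl by (simp add: dg_linear id_eq_dg num)
qed

text \<open>The map \<open>trace (m u v)\<close> times \<open>id\<close> is itself bilinear and
  equivariant, so it vanishes as soon as it vanishes at \<open>v0\<close>, \<open>vl\<close>. The
  vanishing lemma applies although these values are scalar operators outside
  \<open>\<sigma>V\<close>.\<close>

lemma O_trace:
  assumes "u \<in> \<sigma>V" "v \<in> \<sigma>V"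
  shows "trace (O1 u v) = 0" "trace (O2 u v) = 0"
proof -
  have *: "trace (m u v) = 0"
    if bil: "bilinear_on opspan m" and eqv: "equivariant m" and m: "\<And>u v. m u v \<in> opspan"
      and z: "trace (m v0 vl) = 0" for m
  proof -
    define n where "n u v = scaleE (trace (m u v)) id" for u v
    have lin: "lin (m u v)" for u v
      using m by (rule lin_opspan)
    have b: "bilinear_on \<sigma>V n"
      using bil unfolding bilinear_on_def n_def \<sigma>V_def
      by (simp add: trace_add trace_scale lin E.scale_left_distrib)
    have q: "equivariant n"
      using eqv unfolding equivariant_def n_def by (simp add: trace_conj lin conj_linear conj_id)
    have "n v0 vl = 0"
      by (simp add: n_def z)
    then have "n u v = 0"
      by (rule equivariant_eq_0[OF b q _ assms])
    then have "trace (n u v) = 0"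
      by (simp add: trace_zero)
    then show ?thesis
      by (simp add: n_def trace_scale lin_id trace_id)
  qed
  show "trace (O1 u v) = 0" "trace (O2 u v) = 0"
    by (rule *; simp add: O_bilinear O_equivariant O_opspan O1_v0_vl O2_v0_vl trace_dg)+
qed

section \<open>Commuting operators on the octonions, a torus and Spin8\<close>

text \<open>Rescaling by a square root reaches all \<open>p\<close> with
  \<open>N p \<noteq> 0\<close>, and adding a multiple of \<open>e\<close> reaches the isotropic
  ones. Then \<open>f\<close> is multiplication by \<open>f e\<close>, which commutes with every
  octonion, and the only such elements are multiples of \<open>e\<close>.\<close>

lemma scalar_of_commuting:
  assumes f: "\<And>x y. f (x + y) = f x + f y" "\<And>t x. f (t *s x) = t *s f x"
    and L: "\<And>p x. N p = 1 \<Longrightarrow> f (p \<bullet> x) = p \<bullet> f x"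
    and R: "\<And>p x. N p = 1 \<Longrightarrow> f (x \<bullet> p) = f x \<bullet> p"
  shows "\<exists>t. \<forall>x. f x = t *s x"
proof -
  have aniso: "f (x \<bullet> y) = x \<bullet> f y" "f (y \<bullet> x) = f y \<bullet> x" if "N x \<noteq> 0" for x y
  proof -
    obtain t where t: "t ^ 2 = N x"
      using nth_root_exists[of 2 "N x"] by auto
    then have t0: "t \<noteq> 0"
      using that by auto
    define p where "p = (1 / t) *s x"
    have p: "N p = 1" "x = t *s p"
      using t t0 that by (simp_all add: p_def N_scale power_divide)
    show "f (x \<bullet> y) = x \<bullet> f y" "f (y \<bullet> x) = f y \<bullet> x"
      by (simp_all add: p(2) f L R p(1))
  qed
  have all: "f (x \<bullet> y) = x \<bullet> f y" "f (y \<bullet> x) = f y \<bullet> x" for x y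
  proof -
    have "infinite (UNIV - {0, - ip x e} :: 'k set)"
      by (intro Diff_infinite_finite infinite_UNIV_alg_closed) simp
    then obtain t where t: "t \<noteq> 0" "t \<noteq> - ip x e"
      using infinite_imp_nonempty by blast
    have "f (x \<bullet> y) = x \<bullet> f y \<and> f (y \<bullet> x) = f y \<bullet> x" if "N x = 0"
    proof -
      have "N (x + t *s e) = t * (t + ip x e)"
        by (simp add: N_add that N_scale power2_eq_square algebra_simps)
      then have 1: "N (x + t *s e) \<noteq> 0"
        using t by (simp add: eq_neg_iff_add_eq_0)
      have "f ((x + t *s e) \<bullet> y) = (x + t *s e) \<bullet> f y" "f (y \<bullet> (x + t *s e)) = f y \<bullet> (x + t *s e)"
        by (rule aniso[OF 1])+
      then show ?thesis
        by (simp add: f unit_left unit_right)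
    qed
    then show "f (x \<bullet> y) = x \<bullet> f y" "f (y \<bullet> x) = f y \<bullet> x"
      using aniso[of x y] by blast+
  qed
  define s where "s = ip (f e) e / 2"
  define z where "z = f e - s *s e"
  have fz: "f x = s *s x + x \<bullet> z" "x \<bullet> z = z \<bullet> x" for x
    using all(1)[of x e] all(2)[of e x] by (simp_all add: z_def unit_left unit_right)
  have ze: "ip z e = 0"
    by (simp add: z_def s_def ip_e_e)
  \<comment> \<open>For \<open>x\<close> and \<open>z\<close> orthogonal to \<open>e\<close>,
    \<open>x \<bullet> z + z \<bullet> x\<close> is \<open>- ip x z *s e\<close>. As
    \<open>z\<close> commutes with \<open>x\<close>, multiplying by \<open>x\<close> gives this
    relation.\<close>
  have *: "(2 * N x) *s z = ip x z *s x" if x: "ip x e = 0" for x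
  proof -
    have "- (x \<bullet> z) - z \<bullet> x = ip x z *s e"
      using mult_cnj_add[of x z] x ze by (simp add: cnj_def)
    then have "x \<bullet> (- (x \<bullet> z) - (x \<bullet> z)) = x \<bullet> (ip x z *s e)"
      by (simp add: fz(2))
    moreover have "x \<bullet> (x \<bullet> z) = - (N x *s z)"
      using cnj_mult_cancel[of x z] x by (simp add: cnj_def eq_neg_iff_add_eq_0 minus_equation_iff)
    moreover have "(2 * N x) *s z = N x *s z + N x *s z"
      using scale_left_distrib[of "N x" "N x" z] by simp
    ultimately show ?thesis
      by (simp add: unit_right)
  qed
  have "z = 0"
  proof (rule ccontr)
    assume "z \<noteq> 0"
    then obtain y where y: "ip z y \<noteq> 0"
      using N_nondegenerate by blast
    define x where "x = y - (ip y e / 2) *s e"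
    have x: "ip x e = 0" "ip x z \<noteq> 0"
      using y ze by (simp_all add: x_def ip_e_e ip_commute[of y z] ip_commute[of e z])
    \<comment> \<open>Polarising \<open>*\<close> at \<open>x\<close> in the direction
      \<open>w\<close> expresses \<open>w\<close> through \<open>z\<close> and \<open>x\<close>.
      Together with \<open>e\<close> this would bound the dimension by 3.\<close>
    have perp: "w \<in> span {e, z, x}" if w: "ip w e = 0" for w
    proof -
      have "(2 * N (x + w)) *s z = ip (x + w) z *s (x + w)"
        by (rule *) (simp add: x w)
      then have "(2 * N x) *s z + (2 * N w) *s z + (2 * ip x w) *s z
          = ip x z *s x + ip x z *s w + (ip w z *s x + ip w z *s w)"
        by (simp add: N_add distrib_left scale_left_distrib scale_right_distrib)
      then have "ip x z *s w = (2 * ip x w) *s z - ip w z *s x"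
        unfolding *[OF x(1)] *[OF w] by (simp add: algebra_simps)
      then have "w = (1 / ip x z) *s ((2 * ip x w) *s z - ip w z *s x)"
        using x(2) by (metis scale_scale nonzero_divide_eq_eq scale_one)
      also have "\<dots> \<in> span {e, z, x}"
        by (intro span_scale span_diff span_base) auto
      finally show ?thesis .
    qed
    have "v \<in> span {e, z, x}" for v
    proof -
      have "v - (ip v e / 2) *s e \<in> span {e, z, x}"
        by (rule perp) (simp add: ip_e_e)
      then have "v - (ip v e / 2) *s e + (ip v e / 2) *s e \<in> span {e, z, x}"
        by (rule span_add) (rule span_scale, rule span_base, simp)
      then show ?thesis
        by simp
    qed
    then have "dim UNIV \<le> card {e, z, x}"
      by (intro dim_le_card) auto
    also have "\<dots> \<le> 3"
      by (simp add: card_insert_if)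
    finally show False
      using dim_8 by simp
  qed
  then show ?thesis
    using fz(1) by auto
qed

text \<open>The exponents make the six weights of this one-parameter subgroup on \<open>W\<close> distinct.\<close>

fun T :: "'k \<Rightarrow> ('k, 'o) endo" where
  "T s (\<alpha>1, \<alpha>2, \<alpha>3, a, b, c) = (inverse s ^ 2 * \<alpha>1, inverse s ^ 10 * \<alpha>2, s ^ 12 * \<alpha>3,
    s *s a, s ^ 5 *s b, inverse s ^ 6 *s c)"

lemma power_inverse_cancel: "s \<noteq> 0 \<Longrightarrow> s ^ n * inverse s ^ n = (1::'k)" "s \<noteq> 0 \<Longrightarrow> inverse s ^ n * s ^ n = (1::'k)"
  by (simp_all flip: power_mult_distrib)

lemma T_G: assumes s: "s \<noteq> 0" shows "T s \<in> G" "inv (T s) = T (inverse s)"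
proof -
  have 1: "T s (x + y) = T s x + T s y" for x y
    by (cases x; cases y) (simp add: scale_right_distrib distrib_left)
  have 2: "T s (scaleW t x) = scaleW t (T s x)" for t x
    by (cases x) (simp add: mult.commute mult.left_commute)
  have 3: "det (T s x) = det x" for x
  proof -
    obtain \<alpha>1 \<alpha>2 \<alpha>3 a b c where x: "x = (\<alpha>1, \<alpha>2, \<alpha>3, a, b, c)" by (cases x)
    have "inverse s ^ 2 * \<alpha>1 * (inverse s ^ 10 * \<alpha>2) * (s ^ 12 * \<alpha>3) = \<alpha>1 * \<alpha>2 * \<alpha>3"
      "inverse s ^ 2 * \<alpha>1 * (s ^ 2 * N a) = \<alpha>1 * N a"
      "inverse s ^ 10 * \<alpha>2 * (s ^ 10 * N b) = \<alpha>2 * N b"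
      "s ^ 12 * \<alpha>3 * (inverse s ^ 12 * N c) = \<alpha>3 * N c"
      "inverse s ^ 6 * (s ^ 5 * (s * trp a b c)) = trp a b c"
      using s by (simp_all add: power_inverse eval_nat_numeral field_simps)
    note eqs = this
    show ?thesis
      by (simp add: x det_eq N_scale eqs)
  qed
  have 4: "T s (T (inverse s) x) = x" "T (inverse s) (T s x) = x" for x
    using s by (cases x; simp add: power_inverse_cancel flip: mult.assoc)+
  show "T s \<in> G" "inv (T s) = T (inverse s)"
    by (rule GI[OF 1 2 3 4])+
qed

lemma conj_T:
  assumes s: "s \<noteq> 0"
  shows "conj_action (T s) v0 = scaleE (inverse s ^ 14) v0" "conj_action (T s) vl = scaleE (s ^ 14) vl"
proof -
  have "tf E3 (inv (T s) x) = tf (scaleW (inverse s ^ 12) E3) x" "tf E1 (inv (T s) x) = tf (scaleW (s ^ 2) E1) x" for x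
    unfolding T_G(2)[OF s] by (cases x; simp)+
  then have "gt (T s) E3 = scaleW (inverse s ^ 12) E3" "gt (T s) E1 = scaleW (s ^ 2) E1"
    by (auto intro!: gt_eqI T_G s)
  moreover have "T s E1 = scaleW (inverse s ^ 2) E1" "T s E3 = scaleW (s ^ 12) E3"
    by simp_all
  ultimately show "conj_action (T s) v0 = scaleE (inverse s ^ 14) v0" "conj_action (T s) vl = scaleE (s ^ 14) vl"
    by (simp_all only: conj_r1[OF T_G(1)[OF s]] r1_linear E.scale_scale, simp_all flip: power_add)
qed

text \<open>Avoid 0 and the roots of unity of order at most 22; this bound is the largest weight of
  \<open>T\<close> once all weights are shifted to be nonnegative.\<close>

lemma exists_generic: "\<exists>s::'k. s \<noteq> 0 \<and> (\<forall>m\<le>22. \<forall>n\<le>22. s ^ m = s ^ n \<longrightarrow> m = n)"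
proof -
  define p :: "'k poly" where "p = [:0, 1:] * (\<Prod>n\<in>{1..22}. monom 1 n - 1)"
  have "monom 1 n - 1 \<noteq> (0 :: 'k poly)" if "n \<ge> 1" for n
  proof
    assume "monom 1 n - 1 = (0 :: 'k poly)"
    then have "coeff (monom 1 n - 1) n = (0 :: 'k)"
      by simp
    then show False
      using that by simp
  qed
  then have "p \<noteq> 0"
    by (auto simp: p_def)
  then obtain s where s: "poly p s \<noteq> 0"
    using infinite_imp_nonempty[OF infinite_nonroots] by auto
  then have s0: "s \<noteq> 0" and s1: "s ^ n \<noteq> 1" if "1 \<le> n" "n \<le> 22" for n
    using that by (auto simp: p_def poly_prod poly_monom)
  have le: "m = n" if "s ^ m = s ^ n" "m \<le> n" "n \<le> 22" for m n
  proof (rule ccontr)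
    assume "m \<noteq> n"
    have "s ^ n = s ^ m * s ^ (n - m)"
      using that(2) by (simp flip: power_add)
    then have "s ^ (n - m) = 1"
      using that s0[of 1] by simp
    then show False
      using s1[of "n - m"] that \<open>m \<noteq> n\<close> by simp
  qed
  have "m = n" if "s ^ m = s ^ n" "m \<le> 22" "n \<le> 22" for m n
    using le[of m n] le[of n m] that by (cases "m \<le> n") simp_all
  then show ?thesis
    using s0[of 1] by (intro exI[of _ s]) simp
qed

text \<open>For \<open>N p = 1\<close> this is an element of Spin8 in its three 8-dimensional
  representations, related by triality. The third component is
  \<open>cnj p \<bullet> c \<bullet> cnj p\<close>, expanded so that no triple product
  occurs.\<close>

fun SLa :: "'o \<Rightarrow> ('k, 'o) endo" where
  "SLa p (\<alpha>1, \<alpha>2, \<alpha>3, a, b, c) = (\<alpha>1, \<alpha>2, \<alpha>3, p \<bullet> a, b \<bullet> p, ip p c *s cnj p - cnj c)"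

fun SLa' :: "'o \<Rightarrow> ('k, 'o) endo" where
  "SLa' p (\<alpha>1, \<alpha>2, \<alpha>3, a, b, c) = (\<alpha>1, \<alpha>2, \<alpha>3, cnj p \<bullet> a, b \<bullet> cnj p, ip p (cnj c) *s p - cnj c)"

fun rot :: "('k, 'o) endo" where
  "rot (\<alpha>1, \<alpha>2, \<alpha>3, a, b, c) = (\<alpha>2, \<alpha>3, \<alpha>1, b, c, a)"

fun rot' :: "('k, 'o) endo" where
  "rot' (\<alpha>1, \<alpha>2, \<alpha>3, a, b, c) = (\<alpha>3, \<alpha>1, \<alpha>2, c, a, b)"

lemma rot_G: "rot \<in> G" "inv rot = rot'"
proof -
  have 1: "rot (x + y) = rot x + rot y" for x y
    by (cases x; cases y) simp
  have 2: "rot (scaleW t x) = scaleW t (rot x)" for t x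
    by (cases x) simp
  have 3: "det (rot x) = det x" for x
  proof -
    obtain \<alpha>1 \<alpha>2 \<alpha>3 a b c where x: "x = (\<alpha>1, \<alpha>2, \<alpha>3, a, b, c)" by (cases x)
    show ?thesis
      using trp_rotate[of a b c] by (simp add: x det_eq)
  qed
  have 4: "rot (rot' x) = x" "rot' (rot x) = x" for x
    by (cases x; simp)+
  show "rot \<in> G" "inv rot = rot'"
    by (rule GI[OF 1 2 3 4])+
qed

text \<open>
  The determinant is preserved by the middle Moufang identity: \<open>(pa)(bp)\<close> is, up to sign, the
  reflection of \<open>cnj (ab)\<close> along \<open>p\<close>.
\<close>

lemma SLa_G: assumes p: "N p = 1" shows "SLa p \<in> G" "inv (SLa p) = SLa' p"
proof -
  have 1: "SLa p (x + y) = SLa p x + SLa p y" for x y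
    by (cases x; cases y) (simp add: scale_left_distrib)
  have 2: "SLa p (scaleW t x) = scaleW t (SLa p x)" for t x
    by (cases x) (simp add: scale_right_diff_distrib)
  have pp: "ip p p = 2"
    by (simp add: ip_self p)
  have 3: "det (SLa p x) = det x" for x
  proof -
    obtain \<alpha>1 \<alpha>2 \<alpha>3 a b c where x: "x = (\<alpha>1, \<alpha>2, \<alpha>3, a, b, c)" by (cases x)
    have t: "trp a b c = ip (a \<bullet> b) (cnj c)" for a b c
      by (simp add: trp_def ip_mult_right)
    have refl: "ip (ip p y *s p - y) (ip p c *s p - c) = ip y c" for y
      by (simp add: pp ip_commute[of y p] algebra_simps)
    have "trp (p \<bullet> a) (b \<bullet> p) (ip p c *s cnj p - cnj c) = ip (ip p (cnj (a \<bullet> b)) *s p - cnj (a \<bullet> b)) (ip p c *s p - c)"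
      unfolding t middle_moufang by (simp add: p)
    also have "\<dots> = ip (cnj (a \<bullet> b)) c"
      by (rule refl)
    also have "\<dots> = trp a b c"
      unfolding t by (rule ip_cnj_left)
    finally have "trp (p \<bullet> a) (b \<bullet> p) (ip p c *s cnj p - cnj c) = trp a b c" .
    moreover have "N (ip p c *s cnj p - cnj c) = N c"
      by (simp add: N_diff N_scale p power2_eq_square)
    ultimately show ?thesis
      by (simp add: x det_eq N_mult p)
  qed
  have 4: "SLa p (SLa' p x) = x" "SLa' p (SLa p x) = x" for x
    by (cases x; simp add: p pp ip_cnj_left)+
  show "SLa p \<in> G" "inv (SLa p) = SLa' p"
    by (rule GI[OF 1 2 3 4])+
qed

definition "SLb p = rot' \<circ> SLa p \<circ> rot"
definition "SLc p = rot \<circ> SLa p \<circ> rot'"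

lemma SLbc_simp [simp]:
  "SLb p (\<alpha>1, \<alpha>2, \<alpha>3, a, b, c) = (\<alpha>1, \<alpha>2, \<alpha>3, ip p a *s cnj p - cnj a, p \<bullet> b, c \<bullet> p)"
  "SLc p (\<alpha>1, \<alpha>2, \<alpha>3, a, b, c) = (\<alpha>1, \<alpha>2, \<alpha>3, a \<bullet> p, ip p b *s cnj p - cnj b, p \<bullet> c)"
  by (simp_all add: SLb_def SLc_def)

lemma SLbc_G: assumes "N p = 1" shows "SLb p \<in> G" "SLc p \<in> G"
  using assms rot_G SLa_G[OF assms] G_inv_in[OF rot_G(1)] unfolding SLb_def SLc_def
  by (simp_all add: G_comp)

lemma conj_fix_v:
  assumes g: "g \<in> G" and gx: "\<And>x. tf E1 (g x) = tf E1 x" "\<And>x. tf E3 (g x) = tf E3 x"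
    and gE: "g E1 = E1" "g E3 = E3"
  shows "conj_action g v0 = v0" "conj_action g vl = vl"
proof -
  have "tf E1 (inv g x) = tf E1 x" "tf E3 (inv g x) = tf E3 x" for x
    using gx[of "inv g x"] g by simp_all
  then have "gt g E1 = E1" "gt g E3 = E3"
    by (auto intro!: gt_eqI g)
  then show "conj_action g v0 = v0" "conj_action g vl = vl"
    by (simp_all only: conj_r1[OF g] gE)
qed

lemma conj_SL:
  assumes p: "N p = 1" and g: "g = SLa p \<or> g = SLb p \<or> g = SLc p"
  shows "g \<in> G" "conj_action g v0 = v0" "conj_action g vl = vl"
proof -
  show G: "g \<in> G"
    using g SLa_G[OF p] SLbc_G[OF p] by blast
  have gx: "tf E1 (g x) = tf E1 x" "tf E3 (g x) = tf E3 x" for x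
    using g by (cases x; auto)+
  have gE: "g E1 = E1" "g E3 = E3"
    using g by auto
  show "conj_action g v0 = v0" "conj_action g vl = vl"
    by (rule conj_fix_v[OF G gx gE])+
qed

lemma conj_fixed_commute: "g \<in> G \<Longrightarrow> conj_action g u = u \<Longrightarrow> u (g x) = g (u x)"
  by (metis G_inv(2) comp_apply conj_action_def)

text \<open>A generic \<open>T s\<close> has six distinct eigenvalues, so \<open>u\<close> preserves
  the six summands. On each octonion summand, one of the families \<open>SLa\<close>,
  \<open>SLb\<close>, \<open>SLc\<close> acts by left and another by right multiplication, so
  \<open>u\<close> is scalar there.\<close>

lemma levi_invariant:
  assumes u: "lin u" and T: "\<And>s. s \<noteq> 0 \<Longrightarrow> conj_action (T s) u = u"
    and S: "\<And>p g. N p = 1 \<Longrightarrow> g = SLa p \<or> g = SLb p \<or> g = SLc p \<Longrightarrow> conj_action g u = u"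
  shows "\<exists>x1 x2 x3 xa xb xc. u = dg x1 x2 x3 xa xb xc"
proof -
  obtain s :: 'k where s: "s \<noteq> 0" "\<And>m n. m \<le> 22 \<Longrightarrow> n \<le> 22 \<Longrightarrow> s ^ m = s ^ n \<Longrightarrow> m = n"
    using exists_generic by blast
  \<comment> \<open>The factor \<open>s ^ 10\<close> clears the negative exponents; the weights
    become 8, 0, 22, 11, 15, 4.\<close>
  have Ts: "scaleW (s ^ 10) (T s (\<alpha>1, \<alpha>2, \<alpha>3, a, b, c))
      = (s ^ 8 * \<alpha>1, s ^ 0 * \<alpha>2, s ^ 22 * \<alpha>3, s ^ 11 *s a, s ^ 15 *s b, s ^ 4 *s c)" for \<alpha>1 \<alpha>2 \<alpha>3 a b c
  proof -
    have "s ^ 10 * inverse s ^ 2 = s ^ 8" "s ^ 10 * inverse s ^ 6 = s ^ 4" "s ^ 10 * inverse s ^ 10 = 1"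
      using s(1) by (simp_all add: power_inverse eval_nat_numeral field_simps)
    moreover have "s ^ 10 * s ^ 12 = s ^ 22" "s ^ 10 * s = s ^ 11" "s ^ 10 * s ^ 5 = s ^ 15"
      by (simp_all flip: power_add power_Suc2)
    ultimately show ?thesis
      by (simp flip: mult.assoc)
  qed
  have eig: "(n \<noteq> 8 \<longrightarrow> \<alpha>1 = 0) \<and> (n \<noteq> 0 \<longrightarrow> \<alpha>2 = 0) \<and> (n \<noteq> 22 \<longrightarrow> \<alpha>3 = 0) \<and> (n \<noteq> 11 \<longrightarrow> a = 0)
      \<and> (n \<noteq> 15 \<longrightarrow> b = 0) \<and> (n \<noteq> 4 \<longrightarrow> c = 0)"
    if x: "scaleW (s ^ 10) (T s x) = scaleW (s ^ n) x" and n: "n \<le> 22" and ux: "u x = (\<alpha>1, \<alpha>2, \<alpha>3, a, b, c)"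
    for n x \<alpha>1 \<alpha>2 \<alpha>3 a b c
  proof -
    have "scaleW (s ^ 10) (T s (u x)) = scaleW (s ^ n) (u x)"
      using conj_fixed_commute[OF T_G(1) T, OF s(1) s(1), of x] arg_cong[OF x, of u] by (simp add: lin_scale u)
    then have eq: "s ^ 8 * \<alpha>1 = s ^ n * \<alpha>1" "s ^ 0 * \<alpha>2 = s ^ n * \<alpha>2" "s ^ 22 * \<alpha>3 = s ^ n * \<alpha>3"
      "s ^ 11 *s a = s ^ n *s a" "s ^ 15 *s b = s ^ n *s b" "s ^ 4 *s c = s ^ n *s c"
      unfolding ux Ts by simp_all
    have k: "s ^ m * t = s ^ n * t \<Longrightarrow> n \<noteq> m \<Longrightarrow> t = 0" and o: "s ^ m *s v = s ^ n *s v \<Longrightarrow> n \<noteq> m \<Longrightarrow> v = 0"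
      if "m \<le> 22" for m t v
      using s(2)[OF that n] by auto
    show ?thesis
      using k[OF _ eq(1)] k[OF _ eq(2)] k[OF _ eq(3)] o[OF _ eq(4)] o[OF _ eq(5)] o[OF _ eq(6)] by simp
  qed
  have "\<exists>t. u E1 = scaleW t E1"
  proof -
    obtain \<alpha>1 \<alpha>2 \<alpha>3 a b c where x: "u E1 = (\<alpha>1, \<alpha>2, \<alpha>3, a, b, c)" by (cases "u E1")
    show ?thesis
      using eig[OF _ _ x, of 8] unfolding x Ts by simp
  qed
  then obtain x1 where x1: "u E1 = scaleW x1 E1" by blast
  have "\<exists>t. u E2 = scaleW t E2"
  proof -
    obtain \<alpha>1 \<alpha>2 \<alpha>3 a b c where x: "u E2 = (\<alpha>1, \<alpha>2, \<alpha>3, a, b, c)" by (cases "u E2")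
    show ?thesis
      using eig[OF _ _ x, of 0] unfolding x Ts by simp
  qed
  then obtain x2 where x2: "u E2 = scaleW x2 E2" by blast
  have "\<exists>t. u E3 = scaleW t E3"
  proof -
    obtain \<alpha>1 \<alpha>2 \<alpha>3 a b c where x: "u E3 = (\<alpha>1, \<alpha>2, \<alpha>3, a, b, c)" by (cases "u E3")
    show ?thesis
      using eig[OF _ _ x, of 22] unfolding x Ts by simp
  qed
  then obtain x3 where x3: "u E3 = scaleW x3 E3" by blast
  have "\<exists>q. u (Ea p) = Ea q" for p
  proof -
    obtain \<alpha>1 \<alpha>2 \<alpha>3 a b c where x: "u (Ea p) = (\<alpha>1, \<alpha>2, \<alpha>3, a, b, c)" by (cases "u (Ea p)")
    show ?thesis
      using eig[OF _ _ x, of 11] unfolding x Ts by simp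
  qed
  then obtain fa where fa: "\<And>p. u (Ea p) = Ea (fa p)" by metis
  have "\<exists>q. u (Eb p) = Eb q" for p
  proof -
    obtain \<alpha>1 \<alpha>2 \<alpha>3 a b c where x: "u (Eb p) = (\<alpha>1, \<alpha>2, \<alpha>3, a, b, c)" by (cases "u (Eb p)")
    show ?thesis
      using eig[OF _ _ x, of 15] unfolding x Ts by simp
  qed
  then obtain fb where fb: "\<And>p. u (Eb p) = Eb (fb p)" by metis
  have "\<exists>q. u (Ec p) = Ec q" for p
  proof -
    obtain \<alpha>1 \<alpha>2 \<alpha>3 a b c where x: "u (Ec p) = (\<alpha>1, \<alpha>2, \<alpha>3, a, b, c)" by (cases "u (Ec p)")
    show ?thesis
      using eig[OF _ _ x, of 4] unfolding x Ts by simp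
  qed
  then obtain fc where fc: "\<And>p. u (Ec p) = Ec (fc p)" by metis
  have comm: "u (SLa p x) = SLa p (u x)" "u (SLb p x) = SLb p (u x)" "u (SLc p x) = SLc p (u x)"
    if "N p = 1" for p x
    using that by (auto intro!: conj_fixed_commute conj_SL(1)[OF that] S)
  have "\<exists>t. \<forall>x. fa x = t *s x"
  proof (rule scalar_of_commuting)
    show "fa (x + y) = fa x + fa y" "fa (t *s x) = t *s fa x" for x y t
      using lin_add[OF u, of "Ea x" "Ea y"] lin_scale[OF u, of t "Ea x"] by (simp_all add: fa)
    show "fa (p \<bullet> x) = p \<bullet> fa x" "fa (x \<bullet> p) = fa x \<bullet> p" if "N p = 1" for p x
      using comm(1,3)[OF that, of "Ea x"] by (simp_all add: fa)
  qed
  then obtain xa where xa: "\<And>x. fa x = xa *s x" by blast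
  have "\<exists>t. \<forall>x. fb x = t *s x"
  proof (rule scalar_of_commuting)
    show "fb (x + y) = fb x + fb y" "fb (t *s x) = t *s fb x" for x y t
      using lin_add[OF u, of "Eb x" "Eb y"] lin_scale[OF u, of t "Eb x"] by (simp_all add: fb)
    show "fb (p \<bullet> x) = p \<bullet> fb x" "fb (x \<bullet> p) = fb x \<bullet> p" if "N p = 1" for p x
      using comm(1,2)[OF that, of "Eb x"] by (simp_all add: fb)
  qed
  then obtain xb where xb: "\<And>x. fb x = xb *s x" by blast
  have "\<exists>t. \<forall>x. fc x = t *s x"
  proof (rule scalar_of_commuting)
    show "fc (x + y) = fc x + fc y" "fc (t *s x) = t *s fc x" for x y t
      using lin_add[OF u, of "Ec x" "Ec y"] lin_scale[OF u, of t "Ec x"] by (simp_all add: fc)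
    show "fc (p \<bullet> x) = p \<bullet> fc x" "fc (x \<bullet> p) = fc x \<bullet> p" if "N p = 1" for p x
      using comm(2,3)[OF that, of "Ec x"] by (simp_all add: fc)
  qed
  then obtain xc where xc: "\<And>x. fc x = xc *s x" by blast
  have "u w = dg x1 x2 x3 xa xb xc w" for w
  proof -
    obtain \<alpha>1 \<alpha>2 \<alpha>3 a b c where w: "w = (\<alpha>1, \<alpha>2, \<alpha>3, a, b, c)" by (cases w)
    have "w = scaleW \<alpha>1 E1 + scaleW \<alpha>2 E2 + scaleW \<alpha>3 E3 + Ea a + Eb b + Ec c"
      by (simp add: w)
    then have "u w = scaleW \<alpha>1 (u E1) + scaleW \<alpha>2 (u E2) + scaleW \<alpha>3 (u E3) + u (Ea a) + u (Eb b) + u (Ec c)"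
      by (simp only: lin_add[OF u] lin_scale[OF u])
    then show ?thesis
      by (simp add: w x1 x2 x3 fa fb fc xa xb xc mult.commute)
  qed
  then show ?thesis
    by (intro exI ext)
qed

text \<open>
  The elements of \<open>opspan\<close> are orthogonal, for the trace form, to the Lie algebra of \<open>G\<close>; here
  this is used for one element of the Cartan subalgebra.
\<close>

lemma opspan_orthogonal:
  assumes "u \<in> opspan"
  shows "trace (u \<circ> dg 1 (- 1) 0 (- 1 / 2) (1 / 2) 0) = 0"
proof -
  let ?D = "dg 1 (- 1) 0 (- 1 / 2) (1 / 2) 0"
  have "op3 x x x \<in> {u. lin u \<and> trace (u \<circ> ?D) = 0}" for x
  proof -
    obtain \<alpha>1 \<alpha>2 \<alpha>3 a b c where x: "x = (\<alpha>1, \<alpha>2, \<alpha>3, a, b, c)" by (cases x)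
    have "op3 x x x \<circ> ?D = (\<lambda>w. scaleW (tf (crs x x) (?D w)) x)"
      by (simp add: op3_cube r1_def fun_eq_iff)
    moreover have "trace (\<lambda>w. scaleW (tf (crs x x) (?D w)) x) = tf (crs x x) (?D x)"
      by (rule trace_rank1) (simp_all add: lin_add lin_scale lin_dg)
    \<comment> \<open>Infinitesimal invariance of \<open>det\<close>: the left side is the
      derivative of \<open>det\<close> at \<open>x\<close> in the direction \<open>?D x\<close>. The
      scalars of \<open>?D\<close> on the off-diagonal entries are the means of the two diagonal
      ones that they join.\<close>
    moreover have "tf (crs x x) (?D x) = 0"
      unfolding x crs_self by (simp add: trp_a trp_b[of a c b] trp_rotate[of b c a] trp_rotate[of c a b]
          ip_self algebra_simps)
    ultimately show ?thesis
      by (simp add: lin_op3)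
  qed
  moreover have "E.subspace {u. lin u \<and> trace (u \<circ> ?D) = 0}"
  proof (rule E.subspaceI)
    have "(0 :: ('k, 'o) endo) \<circ> ?D = 0"
      by (simp add: fun_eq_iff fun_applies)
    then show "0 \<in> {u. lin u \<and> trace (u \<circ> ?D) = 0}"
      by (simp only: mem_Collect_eq lin_ops trace_zero simp_thms)
  qed (auto simp: lin_ops trace_comp_add trace_comp_scale lin_dg)
  ultimately show ?thesis
    using opspan_subset_of_cubes assms by blast
qed

lemma dg_cong: "x1 = y1 \<Longrightarrow> x2 = y2 \<Longrightarrow> x3 = y3 \<Longrightarrow> xa = ya \<Longrightarrow> xb = yb \<Longrightarrow> xc = yc
    \<Longrightarrow> dg x1 x2 x3 xa xb xc = dg y1 y2 y3 ya yb yc"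
  by simp

section \<open>The possible values at the extreme weight vectors\<close>

lemma value_at_v0_vl:
  assumes bil: "bilinear_on \<sigma>V m" and eqv: "equivariant m"
    and sym: "m v0 vl = m vl v0" and V: "m v0 vl \<in> \<sigma>V"
  shows "\<exists>c d. m v0 vl = scaleE c (O1 v0 vl) + scaleE d (O2 v0 vl)"
proof -
  let ?u = "m v0 vl"
  have lin: "lin ?u" and op: "?u \<in> opspan" and tr: "trace ?u = 0"
    using V by (auto simp: \<sigma>V_def lin_opspan)
  have eq: "m (conj_action g v0) (conj_action g vl) = conj_action g ?u" if "g \<in> G" for g
    using eqv that v0_\<sigma>V vl_\<sigma>V unfolding equivariant_def by blast
  \<comment> \<open>The weights of \<open>v0\<close> and \<open>vl\<close> under \<open>T s\<close>
    are \<open>-14\<close> and \<open>14\<close>, so their product has weight zero.\<close>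
  have "conj_action (T s) ?u = ?u" if s: "s \<noteq> 0" for s
  proof -
    have "conj_action (T s) ?u = m (scaleE (inverse s ^ 14) v0) (scaleE (s ^ 14) vl)"
      using eq[OF T_G(1)[OF s]] by (simp only: conj_T[OF s])
    also have "\<dots> = scaleE (inverse s ^ 14) (scaleE (s ^ 14) ?u)"
      using bilinear_onD(3)[OF bil v0_\<sigma>V E.subspace_scale[OF subspace_\<sigma>V vl_\<sigma>V] v0_\<sigma>V]
        bilinear_onD(4)[OF bil v0_\<sigma>V vl_\<sigma>V v0_\<sigma>V] by (simp only:)
    finally show ?thesis
      using s by (simp add: power_inverse_cancel)
  qed
  moreover have "conj_action g ?u = ?u" if "N p = 1" "g = SLa p \<or> g = SLb p \<or> g = SLc p" for g p
    using eq[OF conj_SL(1)[OF that]] by (simp only: conj_SL(2,3)[OF that])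
  ultimately obtain x1 x2 x3 xa xb xc where u: "?u = dg x1 x2 x3 xa xb xc"
    using levi_invariant[OF lin] by blast
  have "conj_action sw ?u = ?u"
    using eq[OF sw_G] by (simp only: conj_sw sym)
  then have "?u (sw E1) = sw (?u E1)" "?u (sw (Ea e)) = sw (?u (Ea e))"
    by (rule conj_fixed_commute[OF sw_G])+
  then have "xc *s e = xa *s e" and x3: "x3 = x1"
    unfolding u by simp_all
  then have xc: "xc = xa"
    using e_nonzero by simp
  have "trace (?u \<circ> dg 1 (- 1) 0 (- 1 / 2) (1 / 2) 0) = 0"
    by (rule opspan_orthogonal[OF op])
  moreover have "t * 8 / 2 = t * (4::'k)" for t
    by (simp add: divide_eq_eq)
  ultimately have x2: "x2 = x1 - 4 * xa + 4 * xb"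
    unfolding u dg_comp trace_dg by (simp add: algebra_simps)
  \<comment> \<open>The first value has equal scalars on \<open>a\<close> and \<open>b\<close>,
    whereas in the second they differ by 9; this fixes the coefficient \<open>d\<close> of the
    second. Comparing the scalars on \<open>a\<close>, namely \<open>xa = - c / 3 - 5 * d\<close>,
    then gives the other coefficient.\<close>
  define d where "d = (xb - xa) / 9"
  have "d * 9 = xb - xa"
    using d_def by (simp only: nonzero_eq_divide_eq[OF small_numerals_nonzero(4)])
  then have xb: "xb = xa + 9 * d"
    by (simp add: mult.commute)
  have "3 * x1 = 3 * (- 8 * xa - 36 * d)"
    using tr unfolding u trace_dg x2 x3 xc xb by (simp add: algebra_simps eq_neg_iff_add_eq_0)
  then have x1: "x1 = - 8 * xa - 36 * d"
    by (metis mult_left_cancel three_nonzero)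
  have "?u = scaleE (- 3 * xa - 15 * d) (O1 v0 vl) + scaleE d (O2 v0 vl)"
    unfolding u O1_v0_vl O2_v0_vl dg_linear x2 x3 xc xb x1
    by (rule dg_cong) (simp_all add: field_simps)
  then show ?thesis
    by blast
qed

section \<open>The space of commutative equivariant products\<close>

lemma \<sigma>V_opspan: "u \<in> \<sigma>V \<Longrightarrow> u \<in> opspan"
  by (simp add: \<sigma>V_def)

lemma bilinear_on_subset: "bilinear_on S m \<Longrightarrow> S' \<subseteq> S \<Longrightarrow> bilinear_on S' m"
  unfolding bilinear_on_def by blast

lemma restrict_odot:
  "restrict_product \<sigma>V odot1 = restrict_product \<sigma>V O1" "restrict_product \<sigma>V odot2 = restrict_product \<sigma>V O2"
  by (auto simp: fun_eq_iff restrict_product_def odot1_eq odot2_eq \<sigma>V_opspan)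

lemma equivariant_products_iff:
  "m \<in> equivariant_products \<longleftrightarrow> supported_on \<sigma>V m \<and> bilinear_on \<sigma>V m \<and>
     (\<forall>u\<in>\<sigma>V. \<forall>v\<in>\<sigma>V. m u v \<in> \<sigma>V \<and> m u v = m v u) \<and> equivariant m"
  by (simp add: equivariant_products_def equivariant_def)

lemma restrict_in_equivariant_products:
  assumes "bilinear_on \<sigma>V m" "equivariant m" "\<And>u v. u \<in> \<sigma>V \<Longrightarrow> v \<in> \<sigma>V \<Longrightarrow> m u v \<in> \<sigma>V"
    "\<And>u v. u \<in> \<sigma>V \<Longrightarrow> v \<in> \<sigma>V \<Longrightarrow> m u v = m v u"
  shows "restrict_product \<sigma>V m \<in> equivariant_products"
proof -
  have "bilinear_on \<sigma>V (restrict_product \<sigma>V m)"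
    using assms(1) E.subspace_add[OF subspace_\<sigma>V] E.subspace_scale[OF subspace_\<sigma>V]
    by (simp add: bilinear_on_def restrict_product_def)
  moreover have "equivariant (restrict_product \<sigma>V m)"
    using assms(2) by (simp add: equivariant_def restrict_product_def conj_\<sigma>V)
  ultimately show ?thesis
    using assms(3,4) by (auto simp: equivariant_products_iff supported_on_def restrict_product_def)
qed

lemma O_restrict: "restrict_product \<sigma>V O1 \<in> equivariant_products" "restrict_product \<sigma>V O2 \<in> equivariant_products"
proof -
  have sub: "\<sigma>V \<subseteq> opspan"
    using \<sigma>V_opspan by blast
  have V: "O1 u v \<in> \<sigma>V" "O2 u v \<in> \<sigma>V" if "u \<in> \<sigma>V" "v \<in> \<sigma>V" for u v
    using O_trace[OF that] O_opspan[of u v] by (simp_all add: \<sigma>V_def)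
  note bil = O_bilinear[THEN bilinear_on_subset[OF _ sub]]
  note comm = O_commute[OF \<sigma>V_opspan \<sigma>V_opspan]
  show "restrict_product \<sigma>V O1 \<in> equivariant_products"
    by (rule restrict_in_equivariant_products[OF bil(1) O_equivariant(1) V(1) comm(1)])
  show "restrict_product \<sigma>V O2 \<in> equivariant_products"
    by (rule restrict_in_equivariant_products[OF bil(2) O_equivariant(2) V(2) comm(2)])
qed

lemma plusP_apply:
  fixes m n :: "('k, 'o) endo \<Rightarrow> ('k, 'o) endo \<Rightarrow> ('k, 'o) endo"
  shows "(m + n) u v = m u v + n u v"
  by (simp add: plus_fun_apply)

lemma scaleP_apply: "scaleP c m u v = scaleE c (m u v)"
  unfolding fun_scale_def by (rule refl)

lemma subspace_equivariant_products: "P.subspace equivariant_products"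
proof (rule P.subspaceI)
  note sub = E.subspace_0[OF subspace_\<sigma>V] E.subspace_add[OF subspace_\<sigma>V] E.subspace_scale[OF subspace_\<sigma>V]
  have z: "(0 :: ('k, 'o) endo \<Rightarrow> ('k, 'o) endo \<Rightarrow> ('k, 'o) endo) u v = 0" for u v
    by (simp add: zero_fun_apply)
  show "0 \<in> equivariant_products"
    unfolding equivariant_products_iff supported_on_def bilinear_on_def equivariant_def z
    by (simp add: sub conj_linear)
  show "m + n \<in> equivariant_products" if mn: "m \<in> equivariant_products" "n \<in> equivariant_products" for m n
  proof -
    show ?thesis
      using mn unfolding equivariant_products_iff supported_on_def bilinear_on_def equivariant_def plusP_apply
      by (simp add: sub conj_linear E.scale_right_distrib add_ac)
  qed
  show "scaleP c m \<in> equivariant_products" if m: "m \<in> equivariant_products" for c m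
    using m unfolding equivariant_products_iff supported_on_def bilinear_on_def equivariant_def scaleP_apply
    by (simp add: sub conj_linear E.scale_right_distrib E.scale_left_commute)
qed

theorem equivariant_products_eq_span:
  "equivariant_products = P.span {restrict_product \<sigma>V odot1, restrict_product \<sigma>V odot2}"
  unfolding restrict_odot
proof (rule equalityI)
  show "P.span {restrict_product \<sigma>V O1, restrict_product \<sigma>V O2} \<subseteq> equivariant_products"
    using O_restrict by (intro P.span_minimal subspace_equivariant_products) simp
  show "equivariant_products \<subseteq> P.span {restrict_product \<sigma>V O1, restrict_product \<sigma>V O2}"
  proof
    fix m assume m: "m \<in> equivariant_products"
    note m' = m[unfolded equivariant_products_iff]
    have "\<exists>c d. m v0 vl = scaleE c (O1 v0 vl) + scaleE d (O2 v0 vl)"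
      using m' v0_\<sigma>V vl_\<sigma>V by (intro value_at_v0_vl) blast+
    then obtain c d where cd: "m v0 vl = scaleE c (O1 v0 vl) + scaleE d (O2 v0 vl)"
      by blast
    define n where "n = scaleP c (restrict_product \<sigma>V O1) + scaleP d (restrict_product \<sigma>V O2)"
    have n: "n \<in> equivariant_products"
      unfolding n_def using O_restrict
      by (intro P.subspace_add[OF subspace_equivariant_products] P.subspace_scale[OF subspace_equivariant_products])
    have n_ap: "n u v = scaleE c (O1 u v) + scaleE d (O2 u v)" if "u \<in> \<sigma>V" "v \<in> \<sigma>V" for u v
      using that unfolding n_def plusP_apply scaleP_apply restrict_product_def by (simp only: if_True simp_thms)
    \<comment> \<open>The difference from the combination \<open>n\<close> with the same value at
      \<open>v0\<close>, \<open>vl\<close> is again an equivariant product, so the vanishing lemma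
      applies to it on \<open>\<sigma>V\<close>; outside, both products are 0 by the
      encoding.\<close>
    have "m + scaleP (- 1) n \<in> equivariant_products"
      using m n
      by (intro P.subspace_add[OF subspace_equivariant_products] P.subspace_scale[OF subspace_equivariant_products])
    note mn = this[unfolded equivariant_products_iff]
    have "(m + scaleP (- 1) n) v0 vl = 0"
      unfolding plusP_apply scaleP_apply n_ap[OF v0_\<sigma>V vl_\<sigma>V] cd by simp
    then have "(m + scaleP (- 1) n) u v = 0" if "u \<in> \<sigma>V" "v \<in> \<sigma>V" for u v
      using mn that equivariant_eq_0[of "m + scaleP (- 1) n" u v] by (elim conjE)
    then have mn_eq: "m u v = n u v" if "u \<in> \<sigma>V" "v \<in> \<sigma>V" for u v
      using that unfolding plusP_apply scaleP_apply by simp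
    have "m = n"
    proof (rule ext, rule ext)
      fix u v
      have "m u v = 0" "n u v = 0" if "u \<notin> \<sigma>V \<or> v \<notin> \<sigma>V"
        using that m' n[unfolded equivariant_products_iff] unfolding supported_on_def by simp_all
      then show "m u v = n u v"
        using mn_eq[of u v] by (cases "u \<in> \<sigma>V"; cases "v \<in> \<sigma>V") simp_all
    qed
    also have "n \<in> P.span {restrict_product \<sigma>V O1, restrict_product \<sigma>V O2}"
      unfolding n_def by (intro P.span_add P.span_scale P.span_base) simp_all
    finally show "m \<in> P.span {restrict_product \<sigma>V O1, restrict_product \<sigma>V O2}" .
  qed
qed

end

theorem proposition4p18:
  fixes scale :: "'k::alg_closed_field \<Rightarrow> 'o::ab_group_add \<Rightarrow> 'o"
    and mult :: "'o \<Rightarrow> 'o \<Rightarrow> 'o"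
    and e :: 'o
    and N :: "'o \<Rightarrow> 'k"
  assumes char: "CHAR('k) = 0 \<or> CHAR('k) \<ge> 14"
    and oct: "split_octonion_algebra scale mult e N"
  shows "split_octonion_algebra.equivariant_products scale mult e N =
    module.span (split_octonion_algebra.scaleP scale)
      {restrict_product
         (split_octonion_algebra.\<sigma>V scale mult e N)
         (split_octonion_algebra.odot1 scale mult e N),
       restrict_product
         (split_octonion_algebra.\<sigma>V scale mult e N)
         (split_octonion_algebra.odot2 scale mult e N)}"
proof -
  interpret albert_algebra scale mult e N
    using oct numeral_nonzero_of_CHAR[OF char] by (intro albert_algebra.intro albert_algebra_axioms.intro)
  show ?thesis
    by (rule equivariant_products_eq_span)
qed

end
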